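(* For $\mu$-almost every $\omega\in\Omega$ and every $E\in\mathcal{G}(H_\omega)$, $$\lim_{n\to\infty}\frac1n\log\|M_n^E(\omega)\|=\lim_{n\to-\infty}\frac1{|n|}\log\|M_n^E(\omega)\|=L(E).$$
   Context: Let $\widetilde\mu$ be a Borel probability measure on $\mathbb R$ whose support $\mathcal A=\operatorname{supp}\widetilde\mu$ is compact and contains at least two points; $\Omega=\mathcal A^{\mathbb Z}$, $\mu=\widetilde\mu^{\mathbb Z}$, $(T\omega)_n=\omega_{n+1}$. For $\omega\in\Omega$, $[H_\omega\psi](n)=\psi(n+1)+\psi(n-1)+\omega_n\psi(n)$ on $\ell^2(\mathbb Z)$. For $E\in\mathbb R$, $\alpha\in\mathcal A$, let $M^E(\alpha)=\begin{pmatrix}E-\alpha&-1\\1&0\end{pmatrix}$, $M^E(\omega)=M^E(\omega_0)$, $M_n^E(\omega)=M^E(T^{n-1}\omega)\cdots M^E(\omega)$ for $n\ge1$, $M_0^E=I$, and $M_n^E(\omega)=[M_{-n}^E(T^n\omega)]^{-1}$ for $n<0$ (so $(u(n),u(n-1))^\top=M_n^E(\omega)(u(0),u(-1))^\top$ for solutions of $H_\omega u=Eu$). The Lyapunov exponent is $L(E)=\lim_{n\to\infty}\frac1n\int_\Omega\log\|M_n^E\|\,d\mu$. $\mathcal G(H_\omega)$ is the set of $E\in\mathbb R$ for which the equation $u(n+1)+u(n-1)+\omega_nu(n)=Eu(n)$ has a nontrivial solution with $|u(n)|\le C_u(1+|n|)$ for all $n$ (generalized eigenvalues). *)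

theory Defs
  imports "HOL-Probability.Probability"
begin

definition msupp :: "real measure \<Rightarrow> real set" where
  "msupp M = {x. \<forall>e>0. emeasure M (ball x e) > 0}"

definition Mone :: "real \<Rightarrow> real \<Rightarrow> real^2^2" where
  "Mone E a = vector [vector [E - a, -1], vector [1, 0]]"

definition shift :: "int \<Rightarrow> (int \<Rightarrow> real) \<Rightarrow> (int \<Rightarrow> real)" where
  "shift k \<omega> = (\<lambda>n. \<omega> (n + k))"

fun Mnat :: "real \<Rightarrow> (int \<Rightarrow> real) \<Rightarrow> nat \<Rightarrow> real^2^2" where
  "Mnat E \<omega> 0 = mat 1"
| "Mnat E \<omega> (Suc n) = Mone E (\<omega> (int n)) ** Mnat E \<omega> n"

definition Mint :: "real \<Rightarrow> (int \<Rightarrow> real) \<Rightarrow> int \<Rightarrow> real^2^2" where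
  "Mint E \<omega> n = (if n \<ge> 0 then Mnat E \<omega> (nat n)
                   else matrix_inv (Mnat E (shift n \<omega>) (nat (- n))))"

definition mnorm :: "real^2^2 \<Rightarrow> real" where
  "mnorm A = onorm (\<lambda>v. A *v v)"

definition lyap :: "(int \<Rightarrow> real) measure \<Rightarrow> real \<Rightarrow> real" where
  "lyap \<mu> E = lim (\<lambda>n. (1 / real n) * (\<integral>\<omega>. ln (mnorm (Mnat E \<omega> n)) \<partial>\<mu>))"

definition geneig :: "(int \<Rightarrow> real) \<Rightarrow> real set" where
  "geneig \<omega> = {E. \<exists>u :: int \<Rightarrow> complex. u \<noteq> (\<lambda>_. 0) \<and>
      (\<forall>n. u (n + 1) + u (n - 1) + complex_of_real (\<omega> n) * u n = complex_of_real E * u n) \<and>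
      (\<exists>C. \<forall>n. cmod (u n) \<le> C * (1 + real_of_int \<bar>n\<bar>))}"

end

theory Submission
  imports Defs "HOL-Computational_Algebra.Fundamental_Theorem_Algebra" "HOL-Real_Asymp.Real_Asymp"
begin

text \<open>
  Let \<open>\<Lambda>(E)\<close> be the supremum over \<open>k\<close> of \<open>1/k\<close> times the smallest mean growth \<open>\<integral> ln \<bar>M\<^sub>k v\<bar>\<close> over unit
  vectors \<open>v\<close>. Submultiplicativity of negative moments gives exponential lower tails at every rate
  below \<open>\<Lambda>(E)\<close>. If \<open>v\<close> nearly minimizes the mean growth, so do its images under one more step for
  suitable site values; two different values give two transversal near-minimizers, whose growth
  controls the matrix norm. Hence \<open>\<Lambda>(E)\<close> is the Lyapunov exponent and all estimates are locally uniform
  in \<open>E\<close>. Positivity of the exponent is never needed: where it vanishes, the lower bound is trivial.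

  Now let \<open>E\<close> be a generalized eigenvalue near \<open>E0\<close> with \<open>\<Lambda>(E0) > 0\<close>. Both half-line products over
  \<open>[-n, n)\<close> contract the Cauchy data of the eigenfunction, so the norm of the product over the whole
  window is far below its typical size \<open>exp(2n\<Lambda>)\<close>, whereas on an exponentially fine grid of energies the
  typical size is attained. The matrix entries being polynomials in the energy of degree at most \<open>2n\<close>,
  such a drop between a grid point and \<open>E\<close> occurs only near one of their roots, that is, at polynomially
  many grid points. For these, windows of length \<open>Tn\<close> next to \<open>[-n, n)\<close> are independent of the selection,
  so almost surely the product over them is large; since \<open>E\<close> is exponentially close to a grid point, this
  persists at \<open>E\<close>. Letting \<open>T\<close> grow makes the contribution of the central window negligible.
\<close>

subsection \<open>Two-by-two matrices\<close>

text \<open>Passing from a grid point to \<open>E\<close> on a long window loses a factor of order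
  exp(2 \<epsilon> (T + 1) n), where \<epsilon> is the precision of the growth rates, so the grid
  must be finer than that. A union bound over the whole grid at rate \<Lambda> - \<epsilon> would
  not allow it: the spacing exponent would have to stay below a deviation rate of the form T s
  \<epsilon>, where the moment exponent s itself shrinks with \<epsilon>. The two kinds of windows
  therefore work at different precisions. On the central window the drop is exponential, so the
  coarse rate 3/4 \<Lambda> suffices at grid points, and its spacing exponent \<eta> is fixed before
  \<epsilon>. On the long windows the fine rate is tested only at the polynomially many grid points
  with a drop, and their number is bounded whatever the spacing, so \<eta> is kept while \<epsilon>
  is made small. Local uniformity has a simple source: a rate below \<Lambda>(E0) is certified by
  the drift of one finite block, a rate above it by the mean log norm of one finite block, and both
  kinds of certificate survive a small change of energy.\<close>

lemma norm_matrix_vector_le: "norm (A *v x) \<le> mnorm A * norm x"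
  unfolding mnorm_def by (rule onorm[OF matrix_vector_mul_bounded_linear])

lemma mnorm_nonneg: "0 \<le> mnorm A"
  unfolding mnorm_def by (rule onorm_pos_le[OF matrix_vector_mul_bounded_linear])

lemma mnorm_mult_le: "mnorm (A ** B) \<le> mnorm A * mnorm B"
proof -
  have "(\<lambda>v. (A ** B) *v v) = (\<lambda>v. A *v v) \<circ> (\<lambda>v. B *v v)"
    by (auto simp: matrix_vector_mul_assoc)
  then show ?thesis
    unfolding mnorm_def
    using onorm_compose[OF matrix_vector_mul_bounded_linear matrix_vector_mul_bounded_linear, of A B] by simp
qed

lemma mnorm_leI:
  assumes "\<And>x. norm x = 1 \<Longrightarrow> norm (A *v x) \<le> b"
  shows "mnorm A \<le> b"
  unfolding mnorm_def
proof (rule onorm_le)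
  fix x :: "real^2"
  show "norm (A *v x) \<le> b * norm x"
  proof (cases "x = 0")
    case False
    have "A *v x = norm x *\<^sub>R (A *v (x /\<^sub>R norm x))"
      using False by (simp add: matrix_vector_mult_scaleR)
    then show ?thesis using assms[of "x /\<^sub>R norm x"] False
      by (metis (no_types, lifting) abs_norm_cancel mult.commute mult_right_mono norm_ge_zero norm_scaleR
          left_inverse norm_eq_zero abs_inverse)
  qed simp
qed

lemma mnorm_triangle: "mnorm (A + B) \<le> mnorm A + mnorm B"
  by (rule mnorm_leI)
    (metis add_mono matrix_vector_mult_add_rdistrib mult.right_neutral norm_matrix_vector_le norm_triangle_mono)

lemma mnorm_uminus: "mnorm (- A) = mnorm A"
proof -
  have "(- A) *v x = - (A *v x)" for x
    by (simp add: vec_eq_iff matrix_vector_mult_def sum_negf)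
  then have "(*v) (- A) = (\<lambda>x. - (A *v x))" by auto
  then show ?thesis unfolding mnorm_def by (simp add: onorm_neg)
qed

lemma mnorm_diff_le: "mnorm A \<le> mnorm B + mnorm (A - B)"
  using mnorm_triangle[of B "A - B"] by simp

lemma entry_le_mnorm: "\<bar>A $ i $ j\<bar> \<le> mnorm A"
  unfolding mnorm_def by (rule matrix_component_le_onorm)

lemma mnorm_le_entries: "mnorm A \<le> \<bar>A$1$1\<bar> + \<bar>A$1$2\<bar> + \<bar>A$2$1\<bar> + \<bar>A$2$2\<bar>"
  unfolding mnorm_def using onorm_le_matrix_component_sum[of A] by (simp add: sum_2 add.assoc)

section \<open>The area form on the plane and unimodular matrices\<close>

definition wedge :: "real^2 \<Rightarrow> real^2 \<Rightarrow> real" where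
  "wedge x y = x$1 * y$2 - x$2 * y$1"

definition perp :: "real^2 \<Rightarrow> real^2" where
  "perp y = vector [- y$2, y$1]"

lemma norm_sq_2: "(norm (x::real^2))\<^sup>2 = (x$1)\<^sup>2 + (x$2)\<^sup>2"
  by (simp add: norm_vec_def L2_set_def sum_2)

lemma norm_perp [simp]: "norm (perp y) = norm y"
  by (rule power2_eq_imp_eq) (simp_all add: norm_sq_2 perp_def)

lemma wedge_perp: "wedge y (perp y) = (norm y)\<^sup>2"
  unfolding norm_sq_2 by (simp add: wedge_def perp_def power2_eq_square)

lemma abs_wedge_le: "\<bar>wedge x y\<bar> \<le> norm x * norm y"
proof -
  have "wedge x y = perp x \<bullet> y"
    by (simp add: wedge_def perp_def inner_vec_def sum_2)
  then show ?thesis using Cauchy_Schwarz_ineq2[of "perp x" y] by simp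
qed

lemma wedge_mult: "wedge (A *v x) (A *v y) = det A * wedge x y"
  by (simp add: wedge_def matrix_vector_mult_def sum_2 det_2 algebra_simps)

text \<open>The orthogonal pair \<open>y\<close>, \<open>perp y\<close> spans the area
  \<open>norm y * norm y\<close>, which a matrix of determinant one preserves; the image area is at
  most the length of one image times the bound for the other. Lower bounds for single vectors thus
  follow from upper bounds for the norm.\<close>

lemma norm_le_mnorm_mult:
  assumes "det A = 1" shows "norm y \<le> mnorm A * norm (A *v y)"
proof (cases "y = 0")
  case False
  have "norm y * norm y = wedge (A *v y) (A *v perp y)"
    by (simp add: wedge_mult assms wedge_perp power2_eq_square)
  also have "\<dots> \<le> norm (A *v y) * norm (A *v perp y)"
    using abs_wedge_le[of "A *v y" "A *v perp y"] by linarith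
  also have "\<dots> \<le> norm (A *v y) * (mnorm A * norm y)"
    using norm_matrix_vector_le[of A "perp y"] by (intro mult_left_mono) auto
  finally show ?thesis using False by (simp add: mult.assoc mult.left_commute mult.commute)
qed (simp add: mnorm_nonneg)

lemma mnorm_ge_1: assumes "det A = 1" shows "1 \<le> mnorm A"
proof -
  have "norm (axis 1 1 :: real^2) \<le> mnorm A * norm (A *v axis 1 1)" (is "norm ?y \<le> _")
    by (rule norm_le_mnorm_mult[OF assms])
  also have "\<dots> \<le> mnorm A * (mnorm A * norm ?y)"
    by (intro mult_left_mono norm_matrix_vector_le mnorm_nonneg)
  finally have "1 \<le> (mnorm A)\<^sup>2" by (simp add: power2_eq_square)
  then show ?thesis using mnorm_nonneg[of A] by (metis one_power2 power2_le_imp_le)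
qed

lemma mult_vec_nonzero: "det (A :: real^2^2) = 1 \<Longrightarrow> y \<noteq> 0 \<Longrightarrow> A *v y \<noteq> 0"
  using norm_le_mnorm_mult[of A y] by auto

lemma mnorm_matrix_inv:
  assumes "det A = 1" shows "mnorm (matrix_inv A) = mnorm A"
proof -
  have inv: "invertible A" using assms by (simp add: invertible_det_nz)
  have le: "mnorm C \<le> mnorm B" if "det B = 1" "B ** C = mat 1" for B C :: "real^2^2"
  proof (rule mnorm_leI)
    fix x :: "real^2" assume "norm x = 1"
    have "B *v (C *v x) = x" using that(2) by (simp add: matrix_vector_mul_assoc)
    then show "norm (C *v x) \<le> mnorm B"
      using norm_le_mnorm_mult[OF that(1), of "C *v x"] \<open>norm x = 1\<close> by simp
  qed
  have eqs: "A ** matrix_inv A = mat 1" "matrix_inv A ** A = mat 1"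
    using inv someI_ex[OF inv[unfolded invertible_def]] unfolding matrix_inv_def by auto
  have "det (matrix_inv A) = 1"
    using arg_cong[OF eqs(1), of det] assms by (simp add: det_mul)
  then show ?thesis using le[OF assms eqs(1)] le[OF _ eqs(2)] by auto
qed

text \<open>The inverse of a unimodular factor has the same norm, so such a factor can be stripped
  off at the cost of its own norm. This is how central windows and remainders are removed at the
  end.\<close>

lemma mnorm_factor_le:
  assumes "det A = 1"
  shows "mnorm B \<le> mnorm (B ** A) * mnorm A" "mnorm B \<le> mnorm (A ** B) * mnorm A"
proof -
  have inv: "invertible A" using assms by (simp add: invertible_det_nz)
  have eqs: "A ** matrix_inv A = mat 1" "matrix_inv A ** A = mat 1"
    using inv someI_ex[OF inv[unfolded invertible_def]] unfolding matrix_inv_def by auto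
  have "B = (B ** A) ** matrix_inv A" by (simp add: eqs flip: matrix_mul_assoc)
  then show "mnorm B \<le> mnorm (B ** A) * mnorm A"
    using mnorm_mult_le[of "B ** A" "matrix_inv A"] mnorm_matrix_inv[OF assms] by simp
  have "B = matrix_inv A ** (A ** B)" by (simp add: eqs matrix_mul_assoc)
  then show "mnorm B \<le> mnorm (A ** B) * mnorm A"
    using mnorm_mult_le[of "matrix_inv A" "A ** B"] mnorm_matrix_inv[OF assms] by (simp add: mult.commute)
qed

subsection \<open>Transfer matrices\<close>

lemma Mone_nth [simp]:
  "Mone E a $ 1 $ 1 = E - a" "Mone E a $ 1 $ 2 = - 1" "Mone E a $ 2 $ 1 = 1" "Mone E a $ 2 $ 2 = 0"
  by (simp_all add: Mone_def)

lemma det_Mone [simp]: "det (Mone E a) = 1"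
  by (simp add: det_2)

lemma det_Mnat [simp]: "det (Mnat E \<omega> n) = 1"
  by (induction n) (simp_all add: det_mul)

lemma shift_apply: "shift k \<omega> i = \<omega> (i + k)"
  by (simp add: shift_def)

lemma shift_shift [simp]: "shift a (shift b \<omega>) = shift (a + b) \<omega>"
  by (auto simp: shift_def algebra_simps)

lemma shift_0 [simp]: "shift 0 \<omega> = \<omega>"
  by (simp add: shift_def)

lemma Mnat_add: "Mnat E \<omega> (n + m) = Mnat E (shift (int n) \<omega>) m ** Mnat E \<omega> n"
  by (induction m) (simp_all add: shift_apply matrix_mul_assoc algebra_simps)

lemma Mnat_cong:
  "(\<And>i. 0 \<le> i \<Longrightarrow> i < int n \<Longrightarrow> \<omega> i = \<omega>' i) \<Longrightarrow> Mnat E \<omega> n = Mnat E \<omega>' n"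
  by (induction n) simp_all

lemma Mnat_vec_nonzero: "v \<noteq> 0 \<Longrightarrow> Mnat E \<omega> n *v v \<noteq> 0"
  by (rule mult_vec_nonzero) simp_all

lemma mnorm_Mone_le: "mnorm (Mone E a) \<le> \<bar>E - a\<bar> + 2"
  using mnorm_le_entries[of "Mone E a"] by simp

lemma mnorm_Mnat_le:
  assumes "\<And>i. \<bar>\<omega> i\<bar> \<le> R" "\<bar>E\<bar> \<le> K"
  shows "mnorm (Mnat E \<omega> n) \<le> (K + R + 2) ^ n"
proof (induction n)
  case 0
  then show ?case by (auto intro: mnorm_leI)
next
  case (Suc n)
  have "mnorm (Mone E (\<omega> (int n))) \<le> K + R + 2"
    using mnorm_Mone_le[of E "\<omega> (int n)"] assms(1)[of "int n"] assms(2) by linarith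
  then have "mnorm (Mone E (\<omega> (int n)) ** Mnat E \<omega> n) \<le> (K + R + 2) * (K + R + 2) ^ n"
    using Suc mnorm_nonneg by (intro order.trans[OF mnorm_mult_le] mult_mono) (auto intro: order.trans)
  then show ?case by simp
qed

lemma ln_norm_Mnat_bound:
  assumes "\<And>i. \<bar>\<omega> i\<bar> \<le> R" "\<bar>E\<bar> \<le> K" "norm v = 1"
  shows "\<bar>ln (norm (Mnat E \<omega> n *v v))\<bar> \<le> real n * ln (K + R + 2)"
proof -
  have KR: "K + R + 2 \<ge> 2" using assms(1)[of 0] assms(2) by linarith
  have v: "v \<noteq> 0" using assms(3) by auto
  let ?x = "norm (Mnat E \<omega> n *v v)"
  have pos: "?x > 0" using Mnat_vec_nonzero[OF v] by simp
  have mn: "mnorm (Mnat E \<omega> n) \<le> (K + R + 2) ^ n" by (rule mnorm_Mnat_le[OF assms(1,2)])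
  have "?x \<le> (K + R + 2) ^ n"
    using norm_matrix_vector_le[of "Mnat E \<omega> n" v] mn assms(3) by simp
  then have 1: "ln ?x \<le> real n * ln (K + R + 2)"
    using ln_mono[of ?x "(K + R + 2) ^ n"] pos KR by (simp add: ln_realpow)
  have "1 \<le> mnorm (Mnat E \<omega> n) * ?x"
    using norm_le_mnorm_mult[of "Mnat E \<omega> n" v] assms(3) by simp
  also have "\<dots> \<le> (K + R + 2) ^ n * ?x" using mn by (intro mult_right_mono) auto
  finally have "ln 1 \<le> ln ((K + R + 2) ^ n * ?x)"
    using pos KR by (subst ln_le_cancel_iff) auto
  also have "\<dots> = real n * ln (K + R + 2) + ln ?x"
    using pos KR by (subst ln_mult) (auto simp: ln_realpow)
  finally show ?thesis using 1 by simp
qed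

lemma ln_mnorm_Mnat_bound:
  assumes "\<And>i. \<bar>\<omega> i\<bar> \<le> R" "\<bar>E\<bar> \<le> K"
  shows "0 \<le> ln (mnorm (Mnat E \<omega> n))" "ln (mnorm (Mnat E \<omega> n)) \<le> real n * ln (K + R + 2)"
proof -
  have KR: "K + R + 2 \<ge> 2" using assms(1)[of 0] assms(2) by linarith
  have g1: "mnorm (Mnat E \<omega> n) \<ge> 1" by (rule mnorm_ge_1) simp
  then show "0 \<le> ln (mnorm (Mnat E \<omega> n))" by simp
  show "ln (mnorm (Mnat E \<omega> n)) \<le> real n * ln (K + R + 2)"
    using ln_mono[OF mnorm_Mnat_le[OF assms(1,2), where n=n]] g1 KR by (simp add: ln_realpow)
qed

section \<open>Dependence of the products on the energy\<close>

lemma matrix_mult_diff: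
  fixes A B C :: "real^2^2"
  shows "(A - B) ** C = A ** C - B ** C" "C ** (A - B) = C ** A - C ** B"
  by (simp_all add: vec_eq_iff matrix_matrix_mult_def sum_subtractf algebra_simps)

lemma matrix_mult_sum_right: "(A :: real^2^2) ** (\<Sum>i\<in>I. f i) = (\<Sum>i\<in>I. A ** f i)"
  by (induction I rule: infinite_finite_induct) (simp_all add: matrix_add_ldistrib)

text \<open>The energy is exchanged one site at a time: sites before \<open>i\<close> already carry
  \<open>E'\<close>, sites after \<open>i\<close> still carry \<open>E\<close>, and site
  \<open>i\<close> contributes the difference.\<close>

lemma Mnat_telescope:
  "Mnat E \<omega> n - Mnat E' \<omega> n =
     (\<Sum>i<n. Mnat E (shift (int i + 1) \<omega>) (n - 1 - i) ** ((Mone E (\<omega> (int i)) - Mone E' (\<omega> (int i))) ** Mnat E' \<omega> i))"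
proof (induction n)
  case (Suc n)
  have "Mnat E (shift (int i + 1) \<omega>) (n - i) = Mone E (\<omega> (int n)) ** Mnat E (shift (int i + 1) \<omega>) (n - 1 - i)"
    if "i < n" for i
  proof -
    have "n - i = Suc (n - 1 - i)" using that by simp
    moreover have "int (n - Suc i) + (int i + 1) = int n" using that by simp
    ultimately show ?thesis by (simp add: shift_apply)
  qed
  then have "(\<Sum>i<n. Mnat E (shift (int i + 1) \<omega>) (n - i) ** ((Mone E (\<omega> (int i)) - Mone E' (\<omega> (int i))) ** Mnat E' \<omega> i))
     = (\<Sum>i<n. Mone E (\<omega> (int n)) ** (Mnat E (shift (int i + 1) \<omega>) (n - 1 - i) ** ((Mone E (\<omega> (int i)) - Mone E' (\<omega> (int i))) ** Mnat E' \<omega> i)))"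
    by (intro sum.cong) (simp_all add: matrix_mul_assoc)
  also have "\<dots> = Mone E (\<omega> (int n)) ** (Mnat E \<omega> n - Mnat E' \<omega> n)"
    unfolding Suc matrix_mult_sum_right ..
  finally show ?case
    by (simp add: matrix_mult_diff)
qed simp

lemma mnorm_sum_le: "mnorm (\<Sum>i\<in>I. f i) \<le> (\<Sum>i\<in>I. mnorm (f i))"
proof (induction I rule: infinite_finite_induct)
  case (insert i I)
  then show ?case using mnorm_triangle[of "f i" "sum f I"] by simp
qed (auto intro!: mnorm_leI)

lemma mnorm_Mone_diff: "mnorm (Mone E x - Mone E' x) \<le> \<bar>E - E'\<bar>"
  using mnorm_le_entries[of "Mone E x - Mone E' x"] by simp

text \<open>\<open>B\<close> is left open because it is used at two levels: a deterministic bound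
  yields a crude Lipschitz constant, while almost sure window bounds yield one close to the typical
  size of the product, as the exponentially fine grid requires.\<close>

lemma mnorm_Mnat_diff_le:
  assumes "\<And>i. i < n \<Longrightarrow> mnorm (Mnat E (shift (int i + 1) \<omega>) (n - 1 - i)) * mnorm (Mnat E' \<omega> i) \<le> B"
  shows "mnorm (Mnat E \<omega> n - Mnat E' \<omega> n) \<le> real n * B * \<bar>E - E'\<bar>"
proof -
  have "mnorm (Mnat E (shift (int i + 1) \<omega>) (n - 1 - i) ** ((Mone E (\<omega> (int i)) - Mone E' (\<omega> (int i))) ** Mnat E' \<omega> i))
      \<le> B * \<bar>E - E'\<bar>" (is "mnorm (?X ** (?D ** ?Y)) \<le> _") if "i < n" for i
  proof -
    have "mnorm (?X ** (?D ** ?Y)) \<le> mnorm ?X * (mnorm ?D * mnorm ?Y)"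
      by (intro order.trans[OF mnorm_mult_le] mult_left_mono mnorm_mult_le mnorm_nonneg)
    also have "\<dots> \<le> mnorm ?X * (\<bar>E - E'\<bar> * mnorm ?Y)"
      by (intro mult_left_mono mult_right_mono mnorm_Mone_diff mnorm_nonneg)
    also have "\<dots> = (mnorm ?X * mnorm ?Y) * \<bar>E - E'\<bar>" by simp
    also have "\<dots> \<le> B * \<bar>E - E'\<bar>" using assms[OF that] by (intro mult_right_mono) auto
    finally show ?thesis .
  qed
  then show ?thesis
    unfolding Mnat_telescope
    by (intro order.trans[OF mnorm_sum_le] order.trans[OF sum_bounded_above[where K="B * \<bar>E - E'\<bar>"]]) auto
qed

lemma mnorm_Mnat_Lipschitz:
  assumes "\<And>i. \<bar>\<omega> i\<bar> \<le> R" "\<bar>E\<bar> \<le> K" "\<bar>E'\<bar> \<le> K"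
  shows "mnorm (Mnat E \<omega> n - Mnat E' \<omega> n) \<le> real n * (K + R + 2) ^ n * \<bar>E - E'\<bar>"
proof (rule mnorm_Mnat_diff_le)
  fix i assume "i < n"
  have KR: "K + R + 2 \<ge> 1" using assms(1)[of 0] assms(2) by linarith
  have "mnorm (Mnat E (shift (int i + 1) \<omega>) (n - 1 - i)) \<le> (K + R + 2) ^ (n - 1 - i)"
    by (rule mnorm_Mnat_le) (use assms in \<open>auto simp: shift_apply\<close>)
  moreover have "mnorm (Mnat E' \<omega> i) \<le> (K + R + 2) ^ i"
    by (rule mnorm_Mnat_le) (use assms in auto)
  ultimately have "mnorm (Mnat E (shift (int i + 1) \<omega>) (n - 1 - i)) * mnorm (Mnat E' \<omega> i)
      \<le> (K + R + 2) ^ (n - 1 - i) * (K + R + 2) ^ i"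
    using KR by (intro mult_mono mnorm_nonneg) auto
  also have "\<dots> = (K + R + 2) ^ (n - 1 - i + i)" by (rule power_add[symmetric])
  also have "\<dots> \<le> (K + R + 2) ^ n" using KR \<open>i < n\<close> by (intro power_increasing) auto
  finally show "mnorm (Mnat E (shift (int i + 1) \<omega>) (n - 1 - i)) * mnorm (Mnat E' \<omega> i) \<le> (K + R + 2) ^ n" .
qed

subsection \<open>Entries as polynomials in the energy\<close>

lemma Mnat_entry_poly:
  "\<exists>p. degree p \<le> n \<and> (\<forall>E. Mnat E \<omega> n $ i $ j = poly p E)"
proof (induction n arbitrary: i)
  case 0
  have "Mnat E \<omega> 0 $ i $ j = poly [:if i = j then 1 else 0:] E" for E
    by (simp add: mat_def)
  then show ?case by (intro exI[of _ "[:if i = j then 1 else 0:]"]) simp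
next
  case (Suc n)
  obtain p1 where p1: "degree p1 \<le> n" "\<And>E. Mnat E \<omega> n $ 1 $ j = poly p1 E" using Suc[of 1] by blast
  obtain p2 where p2: "degree p2 \<le> n" "\<And>E. Mnat E \<omega> n $ 2 $ j = poly p2 E" using Suc[of 2] by blast
  let ?q = "[:- \<omega> (int n), 1:] * p1 - p2"
  have "degree ([:- \<omega> (int n), 1:] * p1) \<le> Suc n"
    using degree_mult_le[of "[:- \<omega> (int n), 1:]" p1] p1(1) by simp
  then have 1: "degree ?q \<le> Suc n" using p2(1) by (intro degree_diff_le) auto
  have 2: "Mnat E \<omega> (Suc n) $ 1 $ j = poly ?q E" for E
    by (simp add: matrix_matrix_mult_def sum_2 p1(2) p2(2) algebra_simps)
  have 3: "Mnat E \<omega> (Suc n) $ 2 $ j = poly p1 E" for E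
    by (simp add: matrix_matrix_mult_def sum_2 p1(2) p2(2))
  consider "i = 1" | "i = 2" using exhaust_2 by blast
  then show ?case
  proof cases
    case 1 then show ?thesis using \<open>degree ?q \<le> Suc n\<close> 2 by blast
  next
    case 2 then show ?thesis using p1(1) 3 le_SucI by blast
  qed
qed

section \<open>Roots near points where a polynomial drops\<close>

lemma prod_mset_norm_lower:
  fixes x y :: complex
  assumes "\<And>z. z \<in># A \<Longrightarrow> c * norm (x - z) \<le> norm (y - z)" "0 \<le> c"
  shows "c ^ size A * norm (\<Prod>z\<in>#A. x - z) \<le> norm (\<Prod>z\<in>#A. y - z)"
  using assms
proof (induction A)
  case (add a A)
  have "c * norm (x - a) * (c ^ size A * norm (\<Prod>z\<in>#A. x - z)) \<le> norm (y - a) * norm (\<Prod>z\<in>#A. y - z)"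
    using add by (intro mult_mono) auto
  then show ?case by (simp add: norm_mult mult_ac )
qed simp

text \<open>If all roots are far from \<open>x\<close> compared with \<open>\<bar>y - x\<bar>\<close>, the product over the roots changes
  at most by the factor \<open>(1 - 1/(2N)) ^ N \<ge> 1/2\<close> (Bernoulli).\<close>

lemma poly_drop_root:
  fixes p :: "real poly"
  assumes deg: "degree p \<le> N" "N > 0" and drop: "\<bar>poly p y\<bar> < \<bar>poly p x\<bar> / 2" and r: "\<bar>y - x\<bar> \<le> r"
  shows "\<exists>z. poly (map_poly complex_of_real p) z = 0 \<and> norm (of_real x - z) < 2 * real N * r"
proof (rule ccontr)
  let ?P = "map_poly complex_of_real p"
  assume "\<not> ?thesis"
  then have far: "2 * real N * r \<le> norm (of_real x - z)" if "poly ?P z = 0" for z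
    using that by (force simp: not_less)
  have ev: "poly ?P (of_real t) = of_real (poly p t)" for t
    by (induction p) (auto simp: map_poly_pCons)
  have "p \<noteq> 0" using drop by auto
  then have P0: "?P \<noteq> 0" by (simp add: map_poly_eq_0_iff)
  from alg_closed_imp_factorization[OF this] obtain A where
    A: "size A = degree ?P" "?P = smult (lead_coeff ?P) (\<Prod>z\<in>#A. [:-z, 1:])" by blast
  have evA: "poly ?P t = lead_coeff ?P * (\<Prod>z\<in>#A. t - z)" for t
    by (subst A(2)) (simp add: poly_prod_mset image_mset.compositionality o_def)
  have szA: "size A \<le> N" using A(1) deg by (simp add: degree_map_poly)
  define c :: real where "c = 1 - 1 / (2 * real N)"
  have c: "0 \<le> c" "c \<le> 1" using deg(2) by (auto simp: c_def field_simps)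
  have "c * norm (of_real x - z) \<le> norm (of_real y - z)" if "z \<in># A" for z
  proof -
    have "poly ?P z = 0" using that by (auto simp: evA prod_mset_zero_iff image_iff intro!: bexI[of _ z])
    from far[OF this] have f: "r \<le> norm (of_real x - z) / (2 * real N)"
      using deg(2) by (simp add: field_simps)
    have "norm (of_real x - z) \<le> norm (of_real y - z) + norm (of_real x - of_real y :: complex)"
      using norm_triangle_ineq[of "of_real y - z" "of_real x - of_real y"] by simp
    also have "norm (of_real x - of_real y :: complex) = \<bar>y - x\<bar>"
      by (metis abs_minus_commute norm_of_real of_real_diff)
    finally have "norm (of_real x - z) - norm (of_real x - z) / (2 * real N) \<le> norm (of_real y - z)"
      using f r by linarith
    then show ?thesis by (simp add: c_def algebra_simps)
  qed
  from prod_mset_norm_lower[OF this c(1)]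
  have "c ^ size A * norm (\<Prod>z\<in>#A. of_real x - z) \<le> norm (\<Prod>z\<in>#A. of_real y - z)" .
  then have "norm (lead_coeff ?P) * (c ^ size A * norm (\<Prod>z\<in>#A. of_real x - z))
      \<le> norm (lead_coeff ?P) * norm (\<Prod>z\<in>#A. of_real y - z)"
    by (rule mult_left_mono) simp
  then have "c ^ size A * norm (poly ?P (of_real x)) \<le> norm (poly ?P (of_real y))"
    by (simp add: evA norm_mult mult_ac)
  then have 1: "c ^ size A * \<bar>poly p x\<bar> \<le> \<bar>poly p y\<bar>" by (simp add: ev)
  have "1 / 2 \<le> c ^ N"
  proof -
    have "1 + real N * (- (1 / (2 * real N))) \<le> (1 + (- (1 / (2 * real N)))) ^ N"
      using deg(2) by (intro Bernoulli_inequality) (simp add: field_simps)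
    then show ?thesis using deg(2) by (simp add: c_def)
  qed
  also have "c ^ N \<le> c ^ size A" using szA c by (intro power_decreasing) auto
  finally have "1 / 2 * \<bar>poly p x\<bar> \<le> c ^ size A * \<bar>poly p x\<bar>" by (intro mult_right_mono) auto
  with 1 drop show False by linarith
qed

lemma card_int_interval:
  fixes c x :: real
  assumes "0 \<le> c" shows "finite {i::int. \<bar>real_of_int i - x\<bar> \<le> c}" "card {i::int. \<bar>real_of_int i - x\<bar> \<le> c} \<le> 2 * c + 1"
proof -
  have sub: "{i::int. \<bar>real_of_int i - x\<bar> \<le> c} \<subseteq> {\<lceil>x - c\<rceil>..\<lfloor>x + c\<rfloor>}"
    by (auto simp: ceiling_le_iff le_floor_iff abs_le_iff algebra_simps)
  then show "finite {i::int. \<bar>real_of_int i - x\<bar> \<le> c}" by (rule finite_subset) simp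
  have "card {i::int. \<bar>real_of_int i - x\<bar> \<le> c} \<le> nat (\<lfloor>x + c\<rfloor> - \<lceil>x - c\<rceil> + 1)"
    using card_mono[OF _ sub] by simp
  also have "real (nat (\<lfloor>x + c\<rfloor> - \<lceil>x - c\<rceil> + 1)) \<le> 2 * c + 1"
    using assms by linarith
  finally show "card {i::int. \<bar>real_of_int i - x\<bar> \<le> c} \<le> 2 * c + 1" by simp
qed

text \<open>By \<open>poly_drop_root\<close> each counted index lies within \<open>2 * N\<close>
  grid steps of the real part of one of at most \<open>N\<close> complex roots, and each root
  accounts for at most \<open>4 * N + 1\<close> indices. The count depends neither on the spacing
  \<open>r\<close> nor on the coefficients.\<close>

lemma card_poly_drops:
  fixes p :: "real poly"
  assumes deg: "degree p \<le> N" "N > 0" and r: "r > 0"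
  shows "finite {i::int. \<exists>y. \<bar>y - (x0 + i * r)\<bar> \<le> r \<and> \<bar>poly p y\<bar> < \<bar>poly p (x0 + i * r)\<bar> / 2}" (is "finite ?S")
    and "card {i::int. \<exists>y. \<bar>y - (x0 + i * r)\<bar> \<le> r \<and> \<bar>poly p y\<bar> < \<bar>poly p (x0 + i * r)\<bar> / 2} \<le> N * (4 * N + 1)"
proof -
  have "finite ?S \<and> card ?S \<le> N * (4 * N + 1)"
  proof (cases "p = 0")
    case False
    let ?P = "map_poly complex_of_real p"
    have P0: "?P \<noteq> 0" using False by (simp add: map_poly_eq_0_iff)
    let ?Z = "{z. poly ?P z = 0}"
    have Z: "finite ?Z" "card ?Z \<le> N"
      using poly_roots_finite[OF P0] card_poly_roots_bound[OF P0] deg(1) by (auto simp: degree_map_poly)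
    let ?I = "\<lambda>z. {i::int. \<bar>real_of_int i - (Re z - x0) / r\<bar> \<le> 2 * real N}"
    have sub: "?S \<subseteq> (\<Union>z\<in>?Z. ?I z)"
    proof
      fix i assume "i \<in> ?S"
      then obtain y where y: "\<bar>y - (x0 + i * r)\<bar> \<le> r" "\<bar>poly p y\<bar> < \<bar>poly p (x0 + i * r)\<bar> / 2" by blast
      from poly_drop_root[OF deg y(2,1)] obtain z where
        z: "poly ?P z = 0" "norm (of_real (x0 + i * r) - z) < 2 * real N * r" by blast
      have "\<bar>(x0 + i * r) - Re z\<bar> \<le> 2 * real N * r"
        using abs_Re_le_cmod[of "of_real (x0 + i * r) - z"] z(2) by simp
      moreover have "(real_of_int i - (Re z - x0) / r) * r = (x0 + i * r) - Re z"
        using r by (simp add: field_simps)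
      ultimately have "\<bar>real_of_int i - (Re z - x0) / r\<bar> * r \<le> 2 * real N * r"
        using r by (metis abs_mult abs_of_pos)
      then have "i \<in> ?I z" using r by simp
      then show "i \<in> (\<Union>z\<in>?Z. ?I z)" using z(1) by blast
    qed
    have fI: "finite (?I z)" for z
      by (rule card_int_interval) simp
    have cI: "card (?I z) \<le> 4 * N + 1" for z
    proof -
      have "real (card (?I z)) \<le> real (4 * N + 1)"
        using card_int_interval(2)[of "2 * real N" "(Re z - x0) / r"] by simp
      then show ?thesis by (simp only: of_nat_le_iff)
    qed
    have "card ?S \<le> card (\<Union>z\<in>?Z. ?I z)" using Z fI by (intro card_mono sub) auto
    also have "\<dots> \<le> (\<Sum>z\<in>?Z. card (?I z))" using Z by (intro card_UN_le)
    also have "\<dots> \<le> card ?Z * (4 * N + 1)" using sum_bounded_above[of ?Z "\<lambda>z. card (?I z)" "4 * N + 1"] cI by simp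
    also have "\<dots> \<le> N * (4 * N + 1)" using Z by (intro mult_right_mono) auto
    finally show ?thesis using finite_subset[OF sub] Z fI by blast
  qed simp
  then show "finite ?S" "card ?S \<le> N * (4 * N + 1)" by auto
qed

text \<open>The norm dominates every entry and is at most the sum of the four, so a drop by a factor
  8 forces some entry below half its modulus. The factor 4 in the count is the number of
  entries.\<close>

lemma card_mnorm_drops:
  fixes x0 r :: real and \<omega> :: "int \<Rightarrow> real"
  assumes N: "N > 0" and r: "r > 0"
  defines "S \<equiv> {i::int. \<exists>y. \<bar>y - (x0 + i * r)\<bar> \<le> r \<and> mnorm (Mnat y \<omega> N) < mnorm (Mnat (x0 + i * r) \<omega> N) / 8}"
  shows "finite S" "card S \<le> 4 * (N * (4 * N + 1))"
proof -
  from Mnat_entry_poly[of N \<omega>] obtain p where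
    p: "\<And>i j. degree (p i j) \<le> N" "\<And>E i j. Mnat E \<omega> N $ i $ j = poly (p i j) E" by metis
  let ?S = "\<lambda>(k, l). {i::int. \<exists>y. \<bar>y - (x0 + i * r)\<bar> \<le> r \<and> \<bar>poly (p k l) y\<bar> < \<bar>poly (p k l) (x0 + i * r)\<bar> / 2}"
  have sub: "S \<subseteq> (\<Union>kl\<in>(UNIV :: (2 \<times> 2) set). ?S kl)"
  proof
    fix i assume "i \<in> S"
    then obtain y where y: "\<bar>y - (x0 + i * r)\<bar> \<le> r" "mnorm (Mnat y \<omega> N) < mnorm (Mnat (x0 + i * r) \<omega> N) / 8"
      unfolding S_def by blast
    have "\<exists>k l. \<bar>poly (p k l) y\<bar> < \<bar>poly (p k l) (x0 + i * r)\<bar> / 2"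
    proof (rule ccontr)
      assume "\<not> ?thesis"
      then have "\<bar>poly (p k l) (x0 + i * r)\<bar> / 2 \<le> mnorm (Mnat y \<omega> N)" for k l
        using entry_le_mnorm[of "Mnat y \<omega> N" k l] p(2)[of y k l] by (metis not_le order.trans)
      from this[of 1 1] this[of 1 2] this[of 2 1] this[of 2 2] show False
        using mnorm_le_entries[of "Mnat (x0 + i * r) \<omega> N"] y(2) unfolding p(2) by linarith
    qed
    then obtain k l where "i \<in> ?S (k, l)" using y(1) by auto
    then show "i \<in> (\<Union>kl\<in>UNIV. ?S kl)" by blast
  qed
  have f: "finite (?S kl)" and c: "card (?S kl) \<le> N * (4 * N + 1)" for kl
    using card_poly_drops[OF p(1) N r] by (auto split: prod.split)
  show "finite S" by (rule finite_subset[OF sub]) (use f in auto)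
  have "card S \<le> card (\<Union>kl\<in>(UNIV :: (2 \<times> 2) set). ?S kl)" using f by (intro card_mono sub) auto
  also have "\<dots> \<le> (\<Sum>kl\<in>(UNIV :: (2 \<times> 2) set). card (?S kl))" by (rule card_UN_le) simp
  also have "\<dots> \<le> card (UNIV :: (2 \<times> 2) set) * (N * (4 * N + 1))"
    using sum_bounded_above[of "UNIV :: (2 \<times> 2) set" "\<lambda>kl. card (?S kl)" "N * (4 * N + 1)"] c by simp
  finally show "card S \<le> 4 * (N * (4 * N + 1))" by simp
qed

subsection \<open>Generalized eigenfunctions\<close>

lemma geneig_real_solution:
  assumes "E \<in> geneig \<omega>"
  shows "\<exists>w :: int \<Rightarrow> real. \<exists>C. w \<noteq> (\<lambda>_. 0) \<and> (\<forall>n. w (n + 1) + w (n - 1) + \<omega> n * w n = E * w n)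
      \<and> (\<forall>n. \<bar>w n\<bar> \<le> C * (1 + \<bar>real_of_int n\<bar>))"
proof -
  from assms obtain u C where u: "u \<noteq> (\<lambda>_. 0)"
    "\<And>n. u (n + 1) + u (n - 1) + complex_of_real (\<omega> n) * u n = complex_of_real E * u n"
    "\<And>n. cmod (u n) \<le> C * (1 + real_of_int \<bar>n\<bar>)" unfolding geneig_def by blast
  have re: "Re (u (n + 1)) + Re (u (n - 1)) + \<omega> n * Re (u n) = E * Re (u n)" for n
    using arg_cong[OF u(2)[of n], of Re] by simp
  have im: "Im (u (n + 1)) + Im (u (n - 1)) + \<omega> n * Im (u n) = E * Im (u n)" for n
    using arg_cong[OF u(2)[of n], of Im] by simp
  have "\<bar>Re (u n)\<bar> \<le> C * (1 + \<bar>real_of_int n\<bar>)" "\<bar>Im (u n)\<bar> \<le> C * (1 + \<bar>real_of_int n\<bar>)" for n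
    using u(3)[of n] order.trans[OF abs_Re_le_cmod[of "u n"]] order.trans[OF abs_Im_le_cmod[of "u n"]] by simp_all
  moreover have "(\<lambda>n. Re (u n)) \<noteq> (\<lambda>_. 0) \<or> (\<lambda>n. Im (u n)) \<noteq> (\<lambda>_. 0)"
    using u(1) by (auto simp: fun_eq_iff complex_eq_iff)
  ultimately show ?thesis using re im
    by (elim disjE) (rule exI, rule exI, intro conjI allI; assumption)+
qed

text \<open>The data \<open>U 0\<close> at the origin split the plane. The right product sends
  \<open>U 0\<close> to a polynomially bounded vector, and by conservation of area the component of
  \<open>?Y *v x\<close> transversal to \<open>U 0\<close> is an area formed with
  \<open>U (- n)\<close>, again polynomially bounded. Each term then contains the norm of only one
  half, so a sum replaces the product. The constant may depend on \<open>E\<close> and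
  \<open>\<omega>\<close>, but not on \<open>n\<close>.\<close>

lemma geneig_mnorm_le:
  assumes "E \<in> geneig \<omega>"
  shows "\<exists>C. \<forall>n. mnorm (Mnat E (shift (- int n) \<omega>) (2 * n)) \<le>
     C * (real n + 2) * (mnorm (Mnat E \<omega> n) + mnorm (Mnat E (shift (- int n) \<omega>) n))"
proof -
  from geneig_real_solution[OF assms] obtain w C where w: "w \<noteq> (\<lambda>_. 0)"
    and eq: "\<And>n. w (n + 1) + w (n - 1) + \<omega> n * w n = E * w n"
    and bd: "\<And>n. \<bar>w n\<bar> \<le> C * (1 + \<bar>real_of_int n\<bar>)" by blast
  define U :: "int \<Rightarrow> real^2" where "U n = vector [w n, w (n - 1)]" for n
  have step: "Mone E (\<omega> n) *v U n = U (n + 1)" for n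
    using eq[of n] by (simp add: U_def vec_eq_iff matrix_vector_mult_def sum_2 forall_2 algebra_simps)
  have run: "Mnat E (shift m \<omega>) n *v U m = U (m + int n)" for m n
  proof (induction n)
    case (Suc n)
    have "Mnat E (shift m \<omega>) (Suc n) *v U m = Mone E (\<omega> (m + int n)) *v (Mnat E (shift m \<omega>) n *v U m)"
      by (simp add: matrix_vector_mul_assoc shift_apply add.commute)
    also have "\<dots> = U (m + int n + 1)" by (simp add: Suc step)
    finally show ?case by (simp add: algebra_simps)
  qed simp
  \<comment> \<open>Zero data at the origin propagate to the right by the recursion and to the left
    because transfer matrices are injective.\<close>
  have U0: "U 0 \<noteq> 0"
  proof
    assume U00: "U 0 = 0"
    have "U (int n) = 0 \<and> U (- int n) = 0" for n
      using run[of 0 n] run[of "- int n" n] U00 Mnat_vec_nonzero[of "U (- int n)" E "shift (- int n) \<omega>" n] by force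
    then have "U n = 0" for n by (cases n rule: int_cases2) auto
    then have "w n = 0" for n by (metis U_def vector_2(1) zero_index)
    with w show False by auto
  qed
  have C0: "C \<ge> 0" using bd[of 0] by simp
  \<comment> \<open>\<open>U m\<close> also contains \<open>w (m - 1)\<close>, whose growth bound
    involves 1 + (n + 1).\<close>
  have Ub: "norm (U m) \<le> 2 * C * (real n + 2)" if "\<bar>m\<bar> = int n" for m n
  proof -
    have "\<bar>w m\<bar> \<le> C * (real n + 2)" using bd[of m] that C0
      by (elim order.trans) (intro mult_left_mono, auto)
    moreover have "\<bar>w (m - 1)\<bar> \<le> C * (real n + 2)" using bd[of "m - 1"] that C0
      by (elim order.trans) (intro mult_left_mono, auto)
    moreover have "norm (U m) \<le> \<bar>w m\<bar> + \<bar>w (m - 1)\<bar>"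
      using norm_le_l1_cart[of "U m"] by (simp add: U_def sum_2)
    ultimately show ?thesis by (simp add: algebra_simps)
  qed
  define D where "D = 2 * C / norm (U 0)"
  have D0: "D \<ge> 0" using C0 by (simp add: D_def)
  have "mnorm (Mnat E (shift (- int n) \<omega>) (2 * n)) \<le>
     D * (real n + 2) * (mnorm (Mnat E \<omega> n) + mnorm (Mnat E (shift (- int n) \<omega>) n))" for n
  proof (rule mnorm_leI)
    fix x :: "real^2" assume x: "norm x = 1"
    let ?X = "Mnat E \<omega> n" and ?Y = "Mnat E (shift (- int n) \<omega>) n"
    have B: "Mnat E (shift (- int n) \<omega>) (2 * n) = ?X ** ?Y"
      using Mnat_add[of E "shift (- int n) \<omega>" n n] by (simp add: mult_2)
    let ?y = "?Y *v x"
    let ?e = "U 0" let ?N = "(norm ?e)\<^sup>2"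
    have N0: "?N > 0" using U0 by simp
    have N0': "norm ?e > 0" using U0 by simp
    \<comment> \<open>Orthogonal decomposition along \<open>U 0\<close>, cleared of denominators;
      the coefficient of \<open>perp ?e\<close> is an area and hence can be transported back to
      \<open>- n\<close>.\<close>
    have dec: "?N *\<^sub>R y = (y \<bullet> ?e) *\<^sub>R ?e + wedge ?e y *\<^sub>R perp ?e" for y
      unfolding norm_sq_2
      by (simp add: vec_eq_iff forall_2 inner_vec_def sum_2 wedge_def perp_def power2_eq_square algebra_simps)
    have "?N *\<^sub>R (?X *v ?y) = ?X *v (?N *\<^sub>R ?y)"
      by (simp add: matrix_vector_mult_scaleR)
    also have "\<dots> = (?y \<bullet> ?e) *\<^sub>R (?X *v ?e) + wedge ?e ?y *\<^sub>R (?X *v perp ?e)"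
      unfolding dec by (simp add: matrix_vector_right_distrib matrix_vector_mult_scaleR)
    finally have eqn: "?N *\<^sub>R (?X *v ?y) = (?y \<bullet> ?e) *\<^sub>R (?X *v ?e) + wedge ?e ?y *\<^sub>R (?X *v perp ?e)" .
    have "?N * norm (?X *v ?y) = norm (?N *\<^sub>R (?X *v ?y))" by simp
    also have "\<dots> \<le> \<bar>?y \<bullet> ?e\<bar> * norm (?X *v ?e) + \<bar>wedge ?e ?y\<bar> * norm (?X *v perp ?e)"
      unfolding eqn by (rule order.trans[OF norm_triangle_ineq]) simp
    also have "\<dots> \<le> (mnorm ?Y * norm ?e) * (2 * C * (real n + 2)) + (2 * C * (real n + 2)) * (mnorm ?X * norm ?e)"
    proof (intro add_mono mult_mono)
      have "\<bar>?y \<bullet> ?e\<bar> \<le> norm ?y * norm ?e" by (rule Cauchy_Schwarz_ineq2)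
      also have "\<dots> \<le> mnorm ?Y * norm ?e"
        using norm_matrix_vector_le[of ?Y x] x by (intro mult_right_mono) auto
      finally show "\<bar>?y \<bullet> ?e\<bar> \<le> mnorm ?Y * norm ?e" .
      show "norm (?X *v ?e) \<le> 2 * C * (real n + 2)" using run[of 0 n] Ub[of "int n" n] by simp
      have "wedge ?e ?y = wedge (U (- int n)) x"
        using run[of "- int n" n] wedge_mult[of ?Y "U (- int n)" x] by simp
      then show "\<bar>wedge ?e ?y\<bar> \<le> 2 * C * (real n + 2)"
        using abs_wedge_le[of "U (- int n)" x] x Ub[of "- int n" n] by simp
      show "norm (?X *v perp ?e) \<le> mnorm ?X * norm ?e"
        using norm_matrix_vector_le[of ?X "perp ?e"] by simp
    qed (use C0 mnorm_nonneg in auto)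
    also have "\<dots> = ?N * (D * (real n + 2) * (mnorm ?X + mnorm ?Y))"
      using N0' by (simp add: D_def power2_eq_square field_simps)
    finally have "norm (?X *v ?y) \<le> D * (real n + 2) * (mnorm ?X + mnorm ?Y)" using N0 by simp
    then show "norm (Mnat E (shift (- int n) \<omega>) (2 * n) *v x) \<le> D * (real n + 2) * (mnorm ?X + mnorm ?Y)"
      by (simp add: B matrix_vector_mul_assoc)
  qed
  then show ?thesis by blast
qed

subsection \<open>Measurability\<close>

lemma borel_measurable_vec2:
  fixes f :: "'a \<Rightarrow> real^2"
  assumes "\<And>i. (\<lambda>x. f x $ i) \<in> borel_measurable N"
  shows "f \<in> borel_measurable N"
  unfolding borel_measurable_euclidean_space[of f]
  using assms by (auto simp: Basis_vec_def inner_axis)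

lemma borel_measurable_mat2:
  fixes f :: "'a \<Rightarrow> real^2^2"
  assumes "\<And>i j. (\<lambda>x. f x $ i $ j) \<in> borel_measurable N"
  shows "f \<in> borel_measurable N"
  unfolding borel_measurable_euclidean_space[of f]
  using assms by (auto simp: Basis_vec_def inner_axis)

lemma borel_measurable_nth2 [measurable (raw)]:
  fixes f :: "'a \<Rightarrow> ('b::{real_normed_vector, second_countable_topology})^2"
  assumes "f \<in> borel_measurable N" shows "(\<lambda>x. f x $ i) \<in> borel_measurable N"
  by (rule borel_measurable_continuous_on[OF _ assms]) (intro continuous_intros)

lemma borel_measurable_matvec2 [measurable (raw)]:
  fixes f :: "'a \<Rightarrow> real^2^2" and g :: "'a \<Rightarrow> real^2"
  assumes [measurable]: "f \<in> borel_measurable N" "g \<in> borel_measurable N"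
  shows "(\<lambda>x. f x *v g x) \<in> borel_measurable N"
  by (rule borel_measurable_vec2) (simp add: matrix_vector_mult_def sum_2)

lemma borel_measurable_matmat2 [measurable (raw)]:
  fixes f g :: "'a \<Rightarrow> real^2^2"
  assumes [measurable]: "f \<in> borel_measurable N" "g \<in> borel_measurable N"
  shows "(\<lambda>x. f x ** g x) \<in> borel_measurable N"
  by (rule borel_measurable_mat2) (simp add: matrix_matrix_mult_def sum_2)

lemma mnorm_le_norm: "mnorm A \<le> 4 * norm A"
proof -
  have "\<bar>A $ i $ j\<bar> \<le> norm A" for i j
    by (rule order.trans[OF component_le_norm_cart Finite_Cartesian_Product.norm_nth_le])
  from this[of 1 1] this[of 1 2] this[of 2 1] this[of 2 2] show ?thesis
    using mnorm_le_entries[of A] by linarith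
qed

lemma abs_mnorm_diff: "\<bar>mnorm A - mnorm B\<bar> \<le> mnorm (A - B)"
  using mnorm_diff_le[of A B] mnorm_diff_le[of B A] mnorm_uminus[of "A - B"] by (simp add: abs_le_iff)

lemma continuous_mnorm: "continuous_on UNIV mnorm"
proof (rule lipschitz_on_continuous_on)
  show "4-lipschitz_on UNIV mnorm"
    by (rule lipschitz_onI)
      (auto simp: dist_real_def dist_norm intro: order.trans[OF abs_mnorm_diff mnorm_le_norm])
qed

lemma borel_measurable_mnorm [measurable (raw)]:
  "f \<in> borel_measurable N \<Longrightarrow> (\<lambda>x. mnorm (f x)) \<in> borel_measurable N"
  by (rule borel_measurable_continuous_on[OF continuous_mnorm])

lemma borel_measurable_Mone [measurable (raw)]:
  assumes [measurable]: "f \<in> borel_measurable N"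
  shows "(\<lambda>x. Mone E (f x)) \<in> borel_measurable N"
proof (rule borel_measurable_mat2)
  fix i j :: 2
  show "(\<lambda>x. Mone E (f x) $ i $ j) \<in> borel_measurable N"
    using exhaust_2[of i] exhaust_2[of j] by (elim disjE) simp_all
qed

subsection \<open>The product measure\<close>

text \<open>Nondegeneracy of the support appears in quantitative form: two separated half-lines of
  mass at least \<open>p\<close> each. They supply the two site values that create transversal
  directions in \<open>near_minimizer_pair\<close>.\<close>

locale iid_potential = prob_space M for M :: "real measure" +
  fixes R a b p :: real
  assumes sets_M [measurable_cong]: "sets M = sets borel"
    and bounded: "AE x in M. \<bar>x\<bar> \<le> R"
    and ab: "a < b" and p: "0 < p" "p \<le> prob {..a}" "p \<le> prob {b..}"
begin

abbreviation P :: "(int \<Rightarrow> real) measure" where "P \<equiv> PiM UNIV (\<lambda>_. M)"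

lemma product_prob: "product_prob_space (\<lambda>_::int. M)"
  by (intro product_prob_spaceI) (rule prob_space_axioms)

lemma prob_space_P: "prob_space P"
  by (rule prob_space_PiM) (rule prob_space_axioms)

lemma sigma_P: "sigma_finite_measure P"
  using prob_space_P by (rule prob_space_imp_sigma_finite)

lemma pair_sigma_P: "pair_sigma_finite P P"
  using prob_space_P by (simp add: pair_sigma_finite_def prob_space_imp_sigma_finite)

lemma pair_prob_P: "prob_space (P \<Otimes>\<^sub>M P)"
  using prob_space_P by (intro prob_space_pair)

lemma space_M: "space M = UNIV"
  using sets_eq_imp_space_eq[OF sets_M] by simp

lemma space_P [simp]: "space P = UNIV"
  by (auto simp: space_PiM space_M)

lemma P_UNIV [simp]: "emeasure P UNIV = 1" "measure P UNIV = 1"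
  using prob_space.emeasure_space_1[OF prob_space_P] by (simp_all add: measure_def)

lemma measurable_coord [measurable (raw)]:
  "f \<in> measurable N P \<Longrightarrow> (\<lambda>x. f x i) \<in> borel_measurable N"
  using measurable_compose[OF _ measurable_component_singleton, of f N UNIV "\<lambda>_. M" i]
  by (simp add: measurable_cong_sets[OF refl sets_M])

lemma measurable_into_P:
  "(\<And>i. (\<lambda>x. f x i) \<in> borel_measurable N) \<Longrightarrow> f \<in> measurable N P"
  by (rule measurable_PiM_single') (auto simp: measurable_cong_sets[OF refl sets_M] space_M)

lemma measurable_shift [measurable (raw)]:
  "f \<in> measurable N P \<Longrightarrow> (\<lambda>x. shift k (f x)) \<in> measurable N P"
  by (rule measurable_into_P) (simp add: shift_apply measurable_coord)

lemma borel_measurable_Mnat [measurable (raw)]: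
  assumes [measurable]: "f \<in> measurable N P"
  shows "(\<lambda>x. Mnat E (f x) n) \<in> borel_measurable N"
  by (induction n) simp_all

lemma AE_bounded: "AE \<omega> in P. \<forall>i. \<bar>\<omega> i\<bar> \<le> R"
  unfolding AE_all_countable
  by (intro allI AE_PiM_component) (auto simp: bounded prob_space_axioms)

lemma distr_shift: "distr P P (shift k) = P"
proof -
  have "distr P (PiM UNIV (\<lambda>_. M)) (\<lambda>\<omega>. \<lambda>n\<in>UNIV. \<omega> (n + k)) = P"
    by (rule distr_PiM_reindex) (auto simp: prob_space_axioms inj_on_def)
  then show ?thesis by (simp add: shift_def[abs_def] restrict_def)
qed

lemma nn_integral_shift:
  assumes [measurable]: "f \<in> borel_measurable P"
  shows "(\<integral>\<^sup>+\<omega>. f (shift k \<omega>) \<partial>P) = (\<integral>\<^sup>+\<omega>. f \<omega> \<partial>P)"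
  by (subst (2) distr_shift[of k, symmetric]) (simp add: nn_integral_distr)

lemma integral_shift:
  fixes f :: "_ \<Rightarrow> real"
  assumes [measurable]: "f \<in> borel_measurable P"
  shows "(\<integral>\<omega>. f (shift k \<omega>) \<partial>P) = (\<integral>\<omega>. f \<omega> \<partial>P)"
  by (subst (2) distr_shift[of k, symmetric]) (simp add: integral_distr)

lemma measurable_merge_on [measurable]:
  "(\<lambda>z i. if i \<in> A then fst z i else snd z i) \<in> measurable (P \<Otimes>\<^sub>M P) P"
  by (rule measurable_into_P) simp

text \<open>On cylinders both sides are products of one-site probabilities, so sites inside and
  outside \<open>A\<close> may be drawn from independent copies. All independence arguments below
  reduce to this.\<close>

lemma resample: "distr (P \<Otimes>\<^sub>M P) P (\<lambda>z i. if i \<in> A then fst z i else snd z i) = P"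
  (is "distr _ _ ?m = _")
proof (rule measure_eqI_PiM_infinite[where I=UNIV and M="\<lambda>_. M"])
  interpret PS: product_prob_space "\<lambda>_::int. M" UNIV by (rule product_prob)
  interpret pair_sigma_finite P P by (rule pair_sigma_P)
  show "finite_measure (distr (P \<Otimes>\<^sub>M P) P ?m)"
    using prob_space.prob_space_distr[OF pair_prob_P, of ?m P] by (simp add: prob_space.finite_measure)
  fix X and J :: "int set" assume J: "finite J" and X: "\<And>i. i \<in> J \<Longrightarrow> X i \<in> sets M"
  let ?C = "\<lambda>J. {\<omega> \<in> space P. \<forall>i\<in>J. \<omega> i \<in> X i}"
  have meas: "?C K \<in> sets P" if "K \<subseteq> J" for K
    proof -
    have fK: "finite K" using finite_subset[OF that J] .
    have XK: "X i \<in> sets M" if "i \<in> K" for i using X that \<open>K \<subseteq> J\<close> by auto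
    show ?thesis using fK XK by measurable
  qed
  have em: "prod_emb UNIV (\<lambda>_. M) J (Pi\<^sub>E J X) = ?C J"
    by (auto simp: prod_emb_def space_PiM Pi_iff)
  have "?m -` ?C J \<inter> space (P \<Otimes>\<^sub>M P) = ?C (J \<inter> A) \<times> ?C (J - A)"
    by (auto simp: space_pair_measure space_M space_PiM)
  then have "emeasure (distr (P \<Otimes>\<^sub>M P) P ?m) (?C J) = emeasure P (?C (J \<inter> A)) * emeasure P (?C (J - A))"
    using meas by (simp add: emeasure_distr sigma_finite_measure.emeasure_pair_measure_Times[OF sigma_P])
  also have "\<dots> = (\<Prod>i\<in>J \<inter> A. emeasure M (X i)) * (\<Prod>i\<in>J - A. emeasure M (X i))"
    using J X by (intro arg_cong2[where f="(*)"] PS.emeasure_PiM_Collect) auto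
  also have "\<dots> = (\<Prod>i\<in>J. emeasure M (X i))"
    by (rule prod.Int_Diff[symmetric]) (rule J)
  also have "\<dots> = emeasure P (?C J)"
    using J X by (intro PS.emeasure_PiM_Collect[symmetric]) auto
  finally show "emeasure (distr (P \<Otimes>\<^sub>M P) P ?m) (prod_emb UNIV (\<lambda>_. M) J (Pi\<^sub>E J X)) =
      emeasure P (prod_emb UNIV (\<lambda>_. M) J (Pi\<^sub>E J X))" unfolding em .
qed simp_all

text \<open>Independence as decoupling: the configuration is passed to \<open>F\<close> twice, and
  \<open>dep\<close> lets the first slot read only sites in \<open>A\<close>, the second only sites
  outside. Resampling then makes the slots independent.\<close>

lemma split_nn_integral:
  assumes m [measurable]: "(\<lambda>z. F (fst z) (snd z)) \<in> borel_measurable (P \<Otimes>\<^sub>M P)"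
    and dep: "\<And>x x' y y'. (\<And>i. i \<in> A \<Longrightarrow> x i = x' i) \<Longrightarrow> (\<And>i. i \<notin> A \<Longrightarrow> y i = y' i) \<Longrightarrow> F x y = F x' y'"
  shows "(\<integral>\<^sup>+\<omega>. F \<omega> \<omega> \<partial>P) = (\<integral>\<^sup>+\<omega>. \<integral>\<^sup>+\<omega>'. F \<omega> \<omega>' \<partial>P \<partial>P)"
proof -
  interpret pair_sigma_finite P P by (rule pair_sigma_P)
  let ?m = "\<lambda>z i. if i \<in> A then fst z i else snd z i"
  have [measurable]: "(\<lambda>\<omega>. F \<omega> \<omega>) \<in> borel_measurable P"
    using measurable_compose[OF _ m, of "\<lambda>\<omega>. (\<omega>, \<omega>)" P] by simp
  have "(\<integral>\<^sup>+\<omega>. F \<omega> \<omega> \<partial>P) = (\<integral>\<^sup>+z. F (?m z) (?m z) \<partial>(P \<Otimes>\<^sub>M P))"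
    by (subst (1) resample[of A, symmetric]) (simp add: nn_integral_distr)
  also have "\<dots> = (\<integral>\<^sup>+z. F (fst z) (snd z) \<partial>(P \<Otimes>\<^sub>M P))"
    by (intro nn_integral_cong dep) auto
  also have "\<dots> = (\<integral>\<^sup>+\<omega>. \<integral>\<^sup>+\<omega>'. F \<omega> \<omega>' \<partial>P \<partial>P)"
    using sigma_finite_measure.nn_integral_fst[OF sigma_P m] by simp
  finally show ?thesis .
qed

lemma split_integral:
  fixes F :: "_ \<Rightarrow> _ \<Rightarrow> real"
  assumes int: "integrable (P \<Otimes>\<^sub>M P) (\<lambda>z. F (fst z) (snd z))"
    and dep: "\<And>x x' y y'. (\<And>i. i \<in> A \<Longrightarrow> x i = x' i) \<Longrightarrow> (\<And>i. i \<notin> A \<Longrightarrow> y i = y' i) \<Longrightarrow> F x y = F x' y'"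
  shows "(\<integral>\<omega>. F \<omega> \<omega> \<partial>P) = (\<integral>\<omega>. \<integral>\<omega>'. F \<omega> \<omega>' \<partial>P \<partial>P)"
    and "integrable P (\<lambda>\<omega>. \<integral>\<omega>'. F \<omega> \<omega>' \<partial>P)"
proof -
  interpret pair_sigma_finite P P by (rule pair_sigma_P)
  let ?m = "\<lambda>z i. if i \<in> A then fst z i else snd z i"
  have m [measurable]: "(\<lambda>z. F (fst z) (snd z)) \<in> borel_measurable (P \<Otimes>\<^sub>M P)" using int by auto
  have [measurable]: "(\<lambda>\<omega>. F \<omega> \<omega>) \<in> borel_measurable P"
    using measurable_compose[OF _ m, of "\<lambda>\<omega>. (\<omega>, \<omega>)" P] by simp
  have "(\<integral>\<omega>. F \<omega> \<omega> \<partial>P) = (\<integral>z. F (?m z) (?m z) \<partial>(P \<Otimes>\<^sub>M P))"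
    by (subst (1) resample[of A, symmetric]) (simp add: integral_distr)
  also have "\<dots> = (\<integral>z. F (fst z) (snd z) \<partial>(P \<Otimes>\<^sub>M P))"
    by (intro Bochner_Integration.integral_cong refl dep) auto
  also have "\<dots> = (\<integral>\<omega>. \<integral>\<omega>'. F \<omega> \<omega>' \<partial>P \<partial>P)"
    using integral_fst'[OF int] by simp
  finally show "(\<integral>\<omega>. F \<omega> \<omega> \<partial>P) = (\<integral>\<omega>. \<integral>\<omega>'. F \<omega> \<omega>' \<partial>P \<partial>P)" .
  show "integrable P (\<lambda>\<omega>. \<integral>\<omega>'. F \<omega> \<omega>' \<partial>P)"
    using integrable_fst'[OF int] by simp
qed

end

subsection \<open>Exponential moments\<close>

lemma exp_le_quadratic:
  fixes x :: real assumes "\<bar>x\<bar> \<le> 1" shows "exp x \<le> 1 + x + x\<^sup>2"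
proof (cases "0 \<le> x")
  case True then show ?thesis using assms by (intro exp_bound) auto
next
  case False
  have "exp x * (1 - x) \<le> exp x * exp (- x)"
    using exp_ge_add_one_self[of "- x"] by (intro mult_left_mono) auto
  also have "\<dots> = 1" by (simp flip: exp_add)
  also have "1 \<le> (1 + x + x\<^sup>2) * (1 - x)"
  proof -
    have "(1 + x + x\<^sup>2) * (1 - x) = 1 - x ^ 3" by (simp add: algebra_simps power2_eq_square power3_eq_cube)
    moreover have "x ^ 3 \<le> 0" using False by (simp add: power_le_zero_eq odd_numeral)
    ultimately show ?thesis by simp
  qed
  finally show ?thesis using False by simp
qed

text \<open>The first bound keeps the exponent of a block of length \<open>k\<close> in the range of
  the quadratic estimate for \<open>exp\<close>; the second makes its second-order term
  \<open>s\<^sup>2 * (k * B)\<^sup>2\<close> at most \<open>s * k * \<epsilon>\<close>.\<close>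

lemma small_exponent:
  fixes B \<epsilon> :: real and k :: nat
  assumes B: "0 < B" and k: "1 \<le> k" and \<epsilon>: "0 < \<epsilon>"
  shows "\<exists>s>0. s * (real k * B) \<le> 1 \<and> s * (real k * B\<^sup>2) \<le> \<epsilon>"
proof -
  define s where "s = min (1 / (real k * B)) (\<epsilon> / (real k * B\<^sup>2))"
  have s: "s > 0" using B k \<epsilon> by (simp add: s_def)
  have s1: "s * (real k * B) \<le> 1"
  proof -
    have "s \<le> 1 / (real k * B)" by (simp add: s_def)
    then show ?thesis using B k by (simp add: field_simps)
  qed
  have s2: "s * (real k * B\<^sup>2) \<le> \<epsilon>"
  proof -
    have "s \<le> \<epsilon> / (real k * B\<^sup>2)" by (simp add: s_def)
    moreover have "real k * B\<^sup>2 > 0" using B k by simp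
    ultimately show ?thesis by (simp add: pos_le_divide_eq)
  qed
  show ?thesis using s s1 s2 by blast
qed

text \<open>Integrating \<open>exp_le_quadratic\<close> leaves the mean plus a second-order error.
  Both the lower and the upper large deviation bounds come from this estimate for a single
  block.\<close>

lemma (in prob_space) exp_moment_le:
  fixes f :: "'a \<Rightarrow> real"
  assumes [measurable]: "f \<in> borel_measurable M" and bd: "AE x in M. \<bar>f x\<bar> \<le> B"
    and m: "(\<integral>x. f x \<partial>M) \<le> m" and s: "0 \<le> s" "s * B \<le> 1"
  shows "(\<integral>\<^sup>+x. ennreal (exp (s * f x)) \<partial>M) \<le> ennreal (exp (s * m + s\<^sup>2 * B\<^sup>2))"
proof -
  have intf: "integrable M f" using bd by (intro integrable_const_bound[of _ B]) auto
  have bd2: "AE x in M. exp (s * f x) \<le> 1 + s * f x + s\<^sup>2 * B\<^sup>2"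
    using bd
  proof eventually_elim
    case (elim x)
    have "\<bar>s * f x\<bar> \<le> s * B" using elim s by (simp add: abs_mult mult_left_mono)
    moreover have "(s * f x)\<^sup>2 \<le> (s * B)\<^sup>2" using calculation by (rule abs_le_square_iff[THEN iffD1, OF order.trans]) auto
    ultimately show ?case using exp_le_quadratic[of "s * f x"] s by (simp add: power_mult_distrib)
  qed
  have "(\<integral>\<^sup>+x. ennreal (exp (s * f x)) \<partial>M) \<le> (\<integral>\<^sup>+x. ennreal (1 + s * f x + s\<^sup>2 * B\<^sup>2) \<partial>M)"
    using bd2 by (intro nn_integral_mono_AE) (auto simp: ennreal_leI elim!: eventually_mono)
  also have "\<dots> = ennreal (\<integral>x. 1 + s * f x + s\<^sup>2 * B\<^sup>2 \<partial>M)"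
    using intf bd2 by (intro nn_integral_eq_integral) (auto elim!: eventually_mono intro: order.trans[OF exp_ge_zero])
  also have "(\<integral>x. 1 + s * f x + s\<^sup>2 * B\<^sup>2 \<partial>M) = 1 + (s * (\<integral>x. f x \<partial>M) + s\<^sup>2 * B\<^sup>2)"
    using intf by (simp add: prob_space)
  also have "\<dots> \<le> 1 + (s * m + s\<^sup>2 * B\<^sup>2)" using m s by (simp add: mult_left_mono)
  also have "\<dots> \<le> exp (s * m + s\<^sup>2 * B\<^sup>2)" by (rule exp_ge_add_one_self)
  finally show ?thesis by (simp add: ennreal_leI)
qed

context iid_potential
begin

lemma R_nonneg: "0 \<le> R"
proof (rule ccontr)
  assume "\<not> 0 \<le> R"
  then have "AE x in M. False" by (intro eventually_mono[OF bounded]) linarith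
  then show False by simp
qed

definition drift :: "real \<Rightarrow> nat \<Rightarrow> real^2 \<Rightarrow> real" where
  "drift E k v = (\<integral>\<omega>. ln (norm (Mnat E \<omega> k *v v)) \<partial>P)"

abbreviation lc :: "real \<Rightarrow> real" where "lc K \<equiv> ln (K + R + 2)"

lemma lc_pos: "0 \<le> K \<Longrightarrow> 0 < lc K"
  using R_nonneg by simp

lemma AE_ln_norm_bound:
  assumes "norm v = 1" "\<bar>E\<bar> \<le> K"
  shows "AE \<omega> in P. \<bar>ln (norm (Mnat E \<omega> k *v v))\<bar> \<le> real k * lc K"
  using AE_bounded by eventually_elim (use ln_norm_Mnat_bound assms in blast)

lemma AE_ln_mnorm_bound:
  assumes "\<bar>E\<bar> \<le> K"
  shows "AE \<omega> in P. \<bar>ln (mnorm (Mnat E \<omega> k))\<bar> \<le> real k * lc K"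
  using AE_bounded
proof eventually_elim
  case (elim \<omega>)
  then show ?case using ln_mnorm_Mnat_bound[of \<omega> R E K k] assms by simp
qed

lemma integrable_ln_norm:
  assumes "norm v = 1" shows "integrable P (\<lambda>\<omega>. ln (norm (Mnat E \<omega> k *v v)))"
  using AE_ln_norm_bound[OF assms order_refl, where k=k and E=E]
  by (intro finite_measure.integrable_const_bound[OF prob_space.finite_measure[OF prob_space_P], of _ "real k * lc \<bar>E\<bar>"]) auto

lemma integrable_ln_mnorm: "integrable P (\<lambda>\<omega>. ln (mnorm (Mnat E \<omega> k)))"
  using AE_ln_mnorm_bound[OF order_refl, where k=k and E=E]
  by (intro finite_measure.integrable_const_bound[OF prob_space.finite_measure[OF prob_space_P], of _ "real k * lc \<bar>E\<bar>"]) auto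

lemma nn_integral_const_bound:
  assumes "AE \<omega> in P. f \<omega> \<le> c" shows "(\<integral>\<^sup>+\<omega>. f \<omega> \<partial>P) \<le> c"
  using nn_integral_mono_AE[OF assms] by (simp add: prob_space.emeasure_space_1[OF prob_space_P, simplified])

lemma Mnat_scale:
  assumes "w \<noteq> 0"
  shows "norm (Mnat E \<omega> n *v w) = norm w * norm (Mnat E \<omega> n *v (w /\<^sub>R norm w))"
proof -
  have "Mnat E \<omega> n *v w = norm w *\<^sub>R (Mnat E \<omega> n *v (w /\<^sub>R norm w))"
    using assms by (simp add: matrix_vector_mult_scaleR)
  then show ?thesis by simp
qed

text \<open>Uniformity in \<open>E\<close> matters: the exponent \<open>s\<close> and the constant \<open>C\<close> depend on the energy only
  through the block length \<open>k\<close>.\<close>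

lemma negative_moment_decay:
  assumes K: "0 \<le> K" and k: "1 \<le> k" and \<epsilon>: "0 < \<epsilon>"
  shows "\<exists>s>0. \<exists>C>0. \<forall>E. \<bar>E\<bar> \<le> K \<longrightarrow> (\<forall>v. norm v = 1 \<longrightarrow> real k * (c + \<epsilon>) \<le> drift E k v) \<longrightarrow>
    (\<forall>n v. norm v = 1 \<longrightarrow>
      (\<integral>\<^sup>+\<omega>. ennreal (exp (- s * ln (norm (Mnat E \<omega> n *v v)))) \<partial>P) \<le> ennreal (C * exp (- s * c * real n)))"
proof -
  define B where "B = lc K"
  have B: "B > 0" using lc_pos[OF K] by (simp add: B_def)
  obtain s where s: "s > 0" and s1: "s * (real k * B) \<le> 1" and s2: "s * (real k * B\<^sup>2) \<le> \<epsilon>"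
    using small_exponent[OF B k \<epsilon>] by blast
  \<comment> \<open>Pays for products shorter than one block, where only the deterministic bound per
    site is at hand.\<close>
  define C where "C = exp (s * real k * (B + \<bar>c\<bar>))"
  have Cpos: "C > 0" by (simp add: C_def)
  {
    fix E n v assume E: "\<bar>E\<bar> \<le> K" and dr: "\<forall>v. norm v = 1 \<longrightarrow> real k * (c + \<epsilon>) \<le> drift E k v"
    have block: "(\<integral>\<^sup>+\<omega>. ennreal (exp (- s * ln (norm (Mnat E \<omega> k *v v)))) \<partial>P) \<le> ennreal (exp (- s * c * real k))"
      if v: "norm v = 1" for v
    proof -
      have "(\<integral>\<^sup>+\<omega>. ennreal (exp (s * (- ln (norm (Mnat E \<omega> k *v v))))) \<partial>P)
        \<le> ennreal (exp (s * (- (real k * (c + \<epsilon>))) + s\<^sup>2 * (real k * B)\<^sup>2))"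
        using AE_ln_norm_bound[OF v E] dr v s s1
        by (intro prob_space.exp_moment_le[OF prob_space_P]) (auto simp: B_def drift_def)
      also have "s * (- (real k * (c + \<epsilon>))) + s\<^sup>2 * (real k * B)\<^sup>2 = - s * c * real k + s * real k * (s * (real k * B\<^sup>2) - \<epsilon>)"
        by (simp add: algebra_simps power2_eq_square)
      also have "ennreal (exp \<dots>) \<le> ennreal (exp (- s * c * real k))"
        using s k s2 by (intro ennreal_leI) (simp add: mult_nonneg_nonpos)
      finally show ?thesis by simp
    qed
    have "norm v = 1 \<Longrightarrow> (\<integral>\<^sup>+\<omega>. ennreal (exp (- s * ln (norm (Mnat E \<omega> n *v v)))) \<partial>P) \<le> ennreal (C * exp (- s * c * real n))"
    proof (induction n arbitrary: v rule: less_induct)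
      case (less n)
      show ?case
      proof (cases "n < k")
        case True
        have nk: "real n \<le> real k" using True by simp
        have "AE \<omega> in P. ennreal (exp (- s * ln (norm (Mnat E \<omega> n *v v)))) \<le> ennreal (C * exp (- s * c * real n))"
          using AE_ln_norm_bound[OF less.prems E, where k=n]
        proof eventually_elim
          case (elim \<omega>)
          let ?l = "ln (norm (Mnat E \<omega> n *v v))"
          have "- s * ?l \<le> s * \<bar>?l\<bar>" using s mult_left_mono[OF abs_ge_minus_self[of ?l], of s] by simp
          also have "\<dots> \<le> s * (real n * B)" using elim s by (simp add: B_def)
          also have "\<dots> \<le> s * real k * B" using nk s B by (simp add: mult_right_mono)
          finally have 1: "- s * ?l \<le> s * real k * B" .
          have "c * real n \<le> \<bar>c\<bar> * real k" using nk by (intro mult_mono) auto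
          then have "s * (c * real n) \<le> s * (\<bar>c\<bar> * real k)" using s by (intro mult_left_mono) auto
          with 1 have "- s * ?l \<le> s * real k * (B + \<bar>c\<bar>) + - s * c * real n" by (simp add: algebra_simps)
          then show ?case by (intro ennreal_leI) (simp add: C_def flip: exp_add)
        qed
        then show ?thesis by (rule nn_integral_const_bound)
      next
        case False
        \<comment> \<open>The first \<open>k\<close> sites are peeled off. They leave the remaining
          product with a random direction, which is why the induction hypothesis covers all unit
          vectors at once.\<close>
        define m where "m = n - k"
        have n: "n = k + m" "m < n" using False k by (auto simp: m_def)
        let ?F = "\<lambda>x y. ennreal (exp (- s * ln (norm (Mnat E (shift (int k) y) m *v (Mnat E x k *v v)))))"
        have "(\<integral>\<^sup>+\<omega>. ennreal (exp (- s * ln (norm (Mnat E \<omega> n *v v)))) \<partial>P) = (\<integral>\<^sup>+\<omega>. ?F \<omega> \<omega> \<partial>P)"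
          by (simp add: n Mnat_add matrix_vector_mul_assoc)
        also have "\<dots> = (\<integral>\<^sup>+\<omega>. \<integral>\<^sup>+\<omega>'. ?F \<omega> \<omega>' \<partial>P \<partial>P)"
        proof (rule split_nn_integral[where A="{..<int k}"])
          fix x x' y y' :: "int \<Rightarrow> real"
          assume "\<And>i. i \<in> {..<int k} \<Longrightarrow> x i = x' i" "\<And>i. i \<notin> {..<int k} \<Longrightarrow> y i = y' i"
          then have "Mnat E x k = Mnat E x' k" "Mnat E (shift (int k) y) m = Mnat E (shift (int k) y') m"
            by (auto intro!: Mnat_cong simp: shift_apply)
          then show "?F x y = ?F x' y'" by simp
        qed measurable
        also have "\<dots> \<le> (\<integral>\<^sup>+\<omega>. ennreal (C * exp (- s * c * real m)) * ennreal (exp (- s * ln (norm (Mnat E \<omega> k *v v)))) \<partial>P)"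
        proof (rule nn_integral_mono)
          fix \<omega>
          define w where "w = Mnat E \<omega> k *v v"
          have "v \<noteq> 0" using less.prems by auto
          then have w: "w \<noteq> 0" unfolding w_def by (rule Mnat_vec_nonzero)
          let ?u = "w /\<^sub>R norm w"
          have u: "norm ?u = 1" using w by simp
          have "exp (- s * ln (norm (Mnat E x m *v w))) = exp (- s * ln (norm w)) * exp (- s * ln (norm (Mnat E x m *v ?u)))" for x
          proof -
            have "?u \<noteq> 0" using w by simp
            then have "norm (Mnat E x m *v ?u) > 0" using Mnat_vec_nonzero by simp
            then have "ln (norm w * norm (Mnat E x m *v ?u)) = ln (norm w) + ln (norm (Mnat E x m *v ?u))"
              using w by (simp add: ln_mult_pos del: norm_scaleR)
            then show ?thesis
              unfolding Mnat_scale[OF w] by (simp only: distrib_left exp_add)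
          qed
          then have "(\<integral>\<^sup>+\<omega>'. ?F \<omega> \<omega>' \<partial>P) =
            (\<integral>\<^sup>+\<omega>'. ennreal (exp (- s * ln (norm w))) * ennreal (exp (- s * ln (norm (Mnat E (shift (int k) \<omega>') m *v ?u)))) \<partial>P)"
            by (simp add: w_def[symmetric] ennreal_mult)
          also have "\<dots> = ennreal (exp (- s * ln (norm w))) * (\<integral>\<^sup>+\<omega>'. ennreal (exp (- s * ln (norm (Mnat E (shift (int k) \<omega>') m *v ?u)))) \<partial>P)"
            by (rule nn_integral_cmult) measurable
          also have "(\<integral>\<^sup>+\<omega>'. ennreal (exp (- s * ln (norm (Mnat E (shift (int k) \<omega>') m *v ?u)))) \<partial>P)
             = (\<integral>\<^sup>+\<omega>'. ennreal (exp (- s * ln (norm (Mnat E \<omega>' m *v ?u)))) \<partial>P)"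
            by (rule nn_integral_shift) measurable
          also have "ennreal (exp (- s * ln (norm w))) * \<dots> \<le> ennreal (exp (- s * ln (norm w))) * ennreal (C * exp (- s * c * real m))"
            by (intro mult_left_mono less.IH[OF n(2) u]) simp
          finally show "(\<integral>\<^sup>+\<omega>'. ?F \<omega> \<omega>' \<partial>P) \<le> ennreal (C * exp (- s * c * real m)) * ennreal (exp (- s * ln (norm (Mnat E \<omega> k *v v))))"
            unfolding w_def by (simp only: mult.commute)
        qed
        also have "\<dots> = ennreal (C * exp (- s * c * real m)) * (\<integral>\<^sup>+\<omega>. ennreal (exp (- s * ln (norm (Mnat E \<omega> k *v v)))) \<partial>P)"
          by (rule nn_integral_cmult) measurable
        also have "\<dots> \<le> ennreal (C * exp (- s * c * real m)) * ennreal (exp (- s * c * real k))"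
          by (intro mult_left_mono block less.prems) simp
        also have "\<dots> = ennreal (C * exp (- s * c * real n))"
          using Cpos by (simp add: n algebra_simps flip: ennreal_mult exp_add)
        finally show ?thesis .
      qed
    qed
  }
  then show ?thesis using s Cpos by blast
qed


subsection \<open>A locally uniform majorant\<close>

text \<open>The matrix norms for all energies near \<open>E0\<close> are dominated simultaneously by a product of
  independent block norms at the single energy \<open>E0\<close>.\<close>

definition majorant :: "real \<Rightarrow> real \<Rightarrow> real \<Rightarrow> nat \<Rightarrow> nat \<Rightarrow> (int \<Rightarrow> real) \<Rightarrow> real" where
  "majorant E0 D \<epsilon> k n \<omega> = D ^ k * (\<Prod>j<n div k. exp \<epsilon> * mnorm (Mnat E0 (shift (int (j * k)) \<omega>) k))"

lemma borel_measurable_majorant [measurable (raw)]: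
  assumes [measurable]: "f \<in> measurable N P"
  shows "(\<lambda>x. majorant E0 D \<epsilon> k n (f x)) \<in> borel_measurable N"
  unfolding majorant_def by measurable

lemma mnorm_le_majorant:
  assumes \<omega>: "\<And>i. \<bar>\<omega> i\<bar> \<le> R" and E: "\<bar>E\<bar> \<le> K" "\<bar>E0\<bar> \<le> K" and k: "1 \<le> k"
    and close: "real k * (K + R + 2) ^ k * \<bar>E - E0\<bar> \<le> \<epsilon>"
  shows "mnorm (Mnat E \<omega> n) \<le> majorant E0 (K + R + 2) \<epsilon> k n \<omega>"
proof -
  have D: "1 \<le> K + R + 2" using \<omega>[of 0] E(1) by linarith
  have block: "mnorm (Mnat E (shift l \<omega>) k) \<le> exp \<epsilon> * mnorm (Mnat E0 (shift l \<omega>) k)" for l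
  proof -
    let ?\<omega> = "shift l \<omega>"
    have 1: "1 \<le> mnorm (Mnat E0 ?\<omega> k)" by (rule mnorm_ge_1) simp
    have e0: "0 \<le> \<epsilon>" using close D by (rule_tac order.trans[OF _ close]) auto
    have "mnorm (Mnat E ?\<omega> k) \<le> mnorm (Mnat E0 ?\<omega> k) + mnorm (Mnat E ?\<omega> k - Mnat E0 ?\<omega> k)"
      by (rule mnorm_diff_le)
    also have "mnorm (Mnat E ?\<omega> k - Mnat E0 ?\<omega> k) \<le> \<epsilon>"
      by (rule order.trans[OF mnorm_Mnat_Lipschitz close]) (use \<omega> E in \<open>auto simp: shift_apply\<close>)
    \<comment> \<open>As the norm is at least 1, the additive error \<epsilon> becomes a relative
      factor.\<close>
    also have "mnorm (Mnat E0 ?\<omega> k) + \<epsilon> \<le> (1 + \<epsilon>) * mnorm (Mnat E0 ?\<omega> k)"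
      using 1 e0 mult_left_mono[of 1 "mnorm (Mnat E0 ?\<omega> k)" \<epsilon>] by (simp add: algebra_simps)
    also have "\<dots> \<le> exp \<epsilon> * mnorm (Mnat E0 ?\<omega> k)"
      using 1 exp_ge_add_one_self[of \<epsilon>] by (intro mult_right_mono) auto
    finally show ?thesis by simp
  qed
  have blocks: "mnorm (Mnat E \<omega> (q * k)) \<le> (\<Prod>j<q. exp \<epsilon> * mnorm (Mnat E0 (shift (int (j * k)) \<omega>) k))" for q
  proof (induction q)
    case 0
    then show ?case by (auto intro: mnorm_leI)
  next
    case (Suc q)
    have "mnorm (Mnat E \<omega> (Suc q * k)) \<le> mnorm (Mnat E (shift (int (q * k)) \<omega>) k) * mnorm (Mnat E \<omega> (q * k))"
      using Mnat_add[of E \<omega> "q * k" k] mnorm_mult_le by (simp add: add.commute)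
    also have "\<dots> \<le> (exp \<epsilon> * mnorm (Mnat E0 (shift (int (q * k)) \<omega>) k)) * (\<Prod>j<q. exp \<epsilon> * mnorm (Mnat E0 (shift (int (j * k)) \<omega>) k))"
      by (intro mult_mono block Suc mnorm_nonneg mult_nonneg_nonneg) auto
    finally show ?case by (simp add: mult.commute)
  qed
  let ?q = "n div k" and ?r = "n mod k"
  have "mnorm (Mnat E \<omega> n) \<le> mnorm (Mnat E (shift (int (?q * k)) \<omega>) ?r) * mnorm (Mnat E \<omega> (?q * k))"
    using Mnat_add[of E \<omega> "?q * k" ?r] mnorm_mult_le by simp
  also have "\<dots> \<le> (K + R + 2) ^ k * (\<Prod>j<?q. exp \<epsilon> * mnorm (Mnat E0 (shift (int (j * k)) \<omega>) k))"
  proof (intro mult_mono blocks mnorm_nonneg)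
    have "mnorm (Mnat E (shift (int (?q * k)) \<omega>) ?r) \<le> (K + R + 2) ^ ?r"
      by (rule mnorm_Mnat_le) (use \<omega> E in \<open>auto simp: shift_apply\<close>)
    also have "\<dots> \<le> (K + R + 2) ^ k" using D k by (intro power_increasing) (auto intro: less_imp_le)
    finally show "mnorm (Mnat E (shift (int (?q * k)) \<omega>) ?r) \<le> (K + R + 2) ^ k" .
  qed (use D in auto)
  finally show ?thesis by (simp add: majorant_def)
qed

lemma majorant_pos: "0 < D \<Longrightarrow> 0 < majorant E0 D \<epsilon> k n \<omega>"
proof -
  have "0 < mnorm (Mnat E0 (shift l \<omega>) k)" for l
    using mnorm_ge_1[of "Mnat E0 (shift l \<omega>) k"] by simp
  then show "0 < D \<Longrightarrow> ?thesis" unfolding majorant_def by (intro mult_pos_pos prod_pos) auto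
qed

text \<open>Of the \<open>2 * \<epsilon>\<close> per site in the assumption, one \<epsilon> pays for
  the factor \<open>exp \<epsilon>\<close> of each block and the other for the second-order term of
  the exponential moment.\<close>

lemma majorant_moment:
  assumes E0: "\<bar>E0\<bar> \<le> K" and k: "1 \<le> k" and \<epsilon>: "0 < \<epsilon>"
    and dr: "(\<integral>\<omega>. ln (mnorm (Mnat E0 \<omega> k)) \<partial>P) \<le> real k * (c - 2 * \<epsilon>)"
  shows "\<exists>s>0. \<exists>C>0. \<forall>n. (\<integral>\<^sup>+\<omega>. ennreal (exp (s * ln (majorant E0 (K + R + 2) \<epsilon> k n \<omega>))) \<partial>P) \<le> ennreal (C * exp (s * c * real n))"
proof -
  define B where "B = lc K"
  have K: "0 \<le> K" using E0 by linarith
  have D: "1 \<le> K + R + 2" using R_nonneg K by simp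
  have B: "B > 0" using lc_pos[OF K] by (simp add: B_def)
  obtain s where s: "s > 0" and s1: "s * (real k * B) \<le> 1" and s2: "s * (real k * B\<^sup>2) \<le> \<epsilon>"
    using small_exponent[OF B k \<epsilon>] by blast
  define g where "g \<omega> = ennreal (exp (s * (\<epsilon> + ln (mnorm (Mnat E0 \<omega> k)))))" for \<omega>
  have [measurable]: "g \<in> borel_measurable P"
    unfolding g_def by measurable
  have block: "(\<integral>\<^sup>+\<omega>. g \<omega> \<partial>P) \<le> ennreal (exp (s * c * real k))"
  proof -
    have "(\<integral>\<^sup>+\<omega>. g \<omega> \<partial>P) = (\<integral>\<^sup>+\<omega>. ennreal (exp (s * \<epsilon>)) * ennreal (exp (s * ln (mnorm (Mnat E0 \<omega> k)))) \<partial>P)"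
      by (simp add: g_def distrib_left exp_add ennreal_mult)
    also have "\<dots> = ennreal (exp (s * \<epsilon>)) * (\<integral>\<^sup>+\<omega>. ennreal (exp (s * ln (mnorm (Mnat E0 \<omega> k)))) \<partial>P)"
      by (rule nn_integral_cmult) measurable
    also have "(\<integral>\<^sup>+\<omega>. ennreal (exp (s * ln (mnorm (Mnat E0 \<omega> k)))) \<partial>P)
        \<le> ennreal (exp (s * (real k * (c - 2 * \<epsilon>)) + s\<^sup>2 * (real k * B)\<^sup>2))"
      using AE_ln_mnorm_bound[OF E0] dr s s1
      by (intro prob_space.exp_moment_le[OF prob_space_P]) (auto simp: B_def)
    also have "ennreal (exp (s * \<epsilon>)) * ennreal (exp (s * (real k * (c - 2 * \<epsilon>)) + s\<^sup>2 * (real k * B)\<^sup>2))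
       = ennreal (exp (s * c * real k + (s * \<epsilon> * (1 - real k) + s * real k * (s * (real k * B\<^sup>2) - \<epsilon>))))"
      by (simp add: algebra_simps power2_eq_square flip: ennreal_mult exp_add)
    also have "\<dots> \<le> ennreal (exp (s * c * real k))"
    proof -
      have "s * \<epsilon> * (1 - real k) \<le> 0" using s \<epsilon> k by (intro mult_nonneg_nonpos) auto
      moreover have "s * real k * (s * (real k * B\<^sup>2) - \<epsilon>) \<le> 0" using s s2 by (intro mult_nonneg_nonpos) auto
      ultimately show ?thesis by (intro ennreal_leI) simp
    qed
    finally show ?thesis by (simp add: mult_left_mono)
  qed
  have blocks: "(\<integral>\<^sup>+\<omega>. (\<Prod>j<q. g (shift (int (j * k)) \<omega>)) \<partial>P) \<le> ennreal (exp (s * c * real (q * k)))" for q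
  proof (induction q)
    case 0
    then show ?case using prob_space.emeasure_space_1[OF prob_space_P] by simp
  next
    case (Suc q)
    let ?F = "\<lambda>x y. (\<Prod>j<q. g (shift (int (j * k)) x)) * g (shift (int (q * k)) y)"
    have "(\<integral>\<^sup>+\<omega>. (\<Prod>j<Suc q. g (shift (int (j * k)) \<omega>)) \<partial>P) = (\<integral>\<^sup>+\<omega>. ?F \<omega> \<omega> \<partial>P)" by simp
    also have "\<dots> = (\<integral>\<^sup>+\<omega>. \<integral>\<^sup>+\<omega>'. ?F \<omega> \<omega>' \<partial>P \<partial>P)"
    proof (rule split_nn_integral[where A="{..<int (q * k)}"])
      fix x x' y y' :: "int \<Rightarrow> real"
      assume xx: "\<And>i. i \<in> {..<int (q * k)} \<Longrightarrow> x i = x' i" and yy: "\<And>i. i \<notin> {..<int (q * k)} \<Longrightarrow> y i = y' i"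
      have "Mnat E0 (shift (int (j * k)) x) k = Mnat E0 (shift (int (j * k)) x') k" if "j < q" for j
      proof (rule Mnat_cong)
        fix i assume i: "0 \<le> i" "i < int k"
        have "(j + 1) * k \<le> q * k" using that by (intro mult_right_mono) auto
        then have "j * k + k \<le> q * k" by simp
        then have "i + int (j * k) < int (q * k)" using i by linarith
        then show "shift (int (j * k)) x i = shift (int (j * k)) x' i" using xx by (simp add: shift_apply)
      qed
      moreover have "Mnat E0 (shift (int (q * k)) y) k = Mnat E0 (shift (int (q * k)) y') k"
        using yy by (auto intro!: Mnat_cong simp: shift_apply)
      ultimately show "?F x y = ?F x' y'" by (simp add: g_def)
    qed measurable
    also have "\<dots> = (\<integral>\<^sup>+\<omega>. (\<Prod>j<q. g (shift (int (j * k)) \<omega>)) * (\<integral>\<^sup>+\<omega>'. g \<omega>' \<partial>P) \<partial>P)"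
      by (simp add: nn_integral_cmult nn_integral_shift[of g])
    also have "\<dots> = (\<integral>\<^sup>+\<omega>. (\<Prod>j<q. g (shift (int (j * k)) \<omega>)) \<partial>P) * (\<integral>\<^sup>+\<omega>'. g \<omega>' \<partial>P)"
      by (rule nn_integral_multc) measurable
    also have "\<dots> \<le> ennreal (exp (s * c * real (q * k))) * ennreal (exp (s * c * real k))"
      by (intro mult_mono Suc block) auto
    also have "\<dots> = ennreal (exp (s * c * real (Suc q * k)))"
      by (simp add: algebra_simps flip: ennreal_mult exp_add)
    finally show ?case .
  qed
  define C where "C = exp (s * (real k * B)) * exp (s * \<bar>c\<bar> * real k)"
  have "(\<integral>\<^sup>+\<omega>. ennreal (exp (s * ln (majorant E0 (K + R + 2) \<epsilon> k n \<omega>))) \<partial>P) \<le> ennreal (C * exp (s * c * real n))" for n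
  proof -
    let ?q = "n div k"
    have "ennreal (exp (s * ln (majorant E0 (K + R + 2) \<epsilon> k n \<omega>))) = ennreal (exp (s * (real k * B))) * (\<Prod>j<?q. g (shift (int (j * k)) \<omega>))" for \<omega>
    proof -
      have pos: "0 < mnorm (Mnat E0 (shift l \<omega>) k)" for l
        using mnorm_ge_1[of "Mnat E0 (shift l \<omega>) k"] by simp
      have nz: "mnorm (Mnat E0 (shift l \<omega>) k) \<noteq> 0" for l
        using pos[of l] by simp
      have pp: "0 < (\<Prod>j<?q. exp \<epsilon> * mnorm (Mnat E0 (shift (int (j * k)) \<omega>) k))"
        using pos by (intro prod_pos) auto
      have "ln (majorant E0 (K + R + 2) \<epsilon> k n \<omega>) = real k * B + (\<Sum>j<?q. \<epsilon> + ln (mnorm (Mnat E0 (shift (int (j * k)) \<omega>) k)))"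
        unfolding majorant_def B_def using D pos pp
        by (simp add: ln_mult ln_realpow ln_prod nz)
      moreover have "exp (s * (x + sum f {..<?q})) = exp (s * x) * (\<Prod>j<?q. exp (s * f j))" for x and f :: "nat \<Rightarrow> real"
        by (simp only: distrib_left exp_add sum_distrib_left) (simp add: exp_sum)
      ultimately show ?thesis
        by (simp only: g_def ennreal_mult exp_ge_zero prod_nonneg prod_ennreal)
    qed
    then have "(\<integral>\<^sup>+\<omega>. ennreal (exp (s * ln (majorant E0 (K + R + 2) \<epsilon> k n \<omega>))) \<partial>P)
       = ennreal (exp (s * (real k * B))) * (\<integral>\<^sup>+\<omega>. (\<Prod>j<?q. g (shift (int (j * k)) \<omega>)) \<partial>P)"
      by (simp add: nn_integral_cmult)
    also have "\<dots> \<le> ennreal (exp (s * (real k * B))) * ennreal (exp (s * c * real (?q * k)))"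
      by (intro mult_left_mono blocks) auto
    also have "\<dots> = ennreal (exp (s * (real k * B) + s * c * real (?q * k)))"
      by (simp flip: ennreal_mult exp_add)
    also have "\<dots> \<le> ennreal (C * exp (s * c * real n))"
    proof -
      have "real n = real (?q * k) + real (n mod k)"
        using div_mult_mod_eq[of n k] by (metis of_nat_add)
      moreover have "- (c * real (n mod k)) \<le> \<bar>c\<bar> * real k"
      proof -
        have "- (c * real (n mod k)) \<le> \<bar>c * real (n mod k)\<bar>" by linarith
        also have "\<dots> = \<bar>c\<bar> * real (n mod k)" by (simp add: abs_mult)
        also have "\<dots> \<le> \<bar>c\<bar> * real k" using k by (intro mult_left_mono) (auto intro: less_imp_le)
        finally show ?thesis .
      qed
      ultimately have "c * real (?q * k) \<le> \<bar>c\<bar> * real k + c * real n" by (simp add: algebra_simps)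
      then have "s * (c * real (?q * k)) \<le> s * (\<bar>c\<bar> * real k + c * real n)" using s by (intro mult_left_mono) auto
      then show ?thesis
        by (intro ennreal_leI) (simp add: C_def algebra_simps flip: exp_add)
    qed
    finally show ?thesis .
  qed
  then show ?thesis using s by (intro exI[of _ s] conjI exI[of _ C]) (auto simp: C_def)
qed


subsection \<open>The Lyapunov exponent as a uniform drift\<close>

definition min_drift :: "real \<Rightarrow> nat \<Rightarrow> real" where
  "min_drift E k = Inf (drift E k ` sphere 0 1)"

text \<open>A supremum over block lengths, so that every rate below \<open>Lam E\<close> has a
  finite block as witness.\<close>

definition Lam :: "real \<Rightarrow> real" where
  "Lam E = (SUP k\<in>{1..}. min_drift E k / real k)"

lemma abs_drift_le:
  assumes "norm v = 1" "\<bar>E\<bar> \<le> K" shows "\<bar>drift E k v\<bar> \<le> real k * lc K"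
proof -
  interpret PP: prob_space P by (rule prob_space_P)
  have "\<bar>drift E k v\<bar> \<le> (\<integral>\<omega>. \<bar>ln (norm (Mnat E \<omega> k *v v))\<bar> \<partial>P)"
    unfolding drift_def using integral_abs_bound by blast
  also have "\<dots> \<le> (\<integral>\<omega>. real k * lc K \<partial>P)"
    using AE_ln_norm_bound[OF assms] integrable_ln_norm[OF assms(1)]
    by (intro integral_mono_AE) auto
  finally show ?thesis by (simp add: PP.prob_space)
qed

lemma sphere_nonempty: "sphere (0 :: real^2) 1 \<noteq> {}"
  by (auto intro!: exI[of _ "axis 1 1"])

lemma drift_bdd_below: "bdd_below (drift E k ` sphere 0 1)"
  using abs_drift_le[OF _ order_refl, of _ E k] by (intro bdd_belowI2[of _ "- (real k * lc \<bar>E\<bar>)"]) (force simp: abs_le_iff)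

lemma min_drift_le: "norm v = 1 \<Longrightarrow> min_drift E k \<le> drift E k v"
  unfolding min_drift_def by (rule cInf_lower[OF _ drift_bdd_below]) auto

lemma min_drift_greatest: "(\<And>v. norm v = 1 \<Longrightarrow> c \<le> drift E k v) \<Longrightarrow> c \<le> min_drift E k"
  unfolding min_drift_def using sphere_nonempty by (intro cInf_greatest) auto

lemma min_drift_approx: "\<exists>v. norm v = 1 \<and> drift E k v \<le> min_drift E k + 1"
proof -
  have "\<exists>x\<in>drift E k ` sphere 0 1. x < min_drift E k + 1"
    unfolding min_drift_def using sphere_nonempty by (intro cInf_lessD) auto
  then show ?thesis by (auto intro: less_imp_le)
qed

lemma min_drift_upper: "min_drift E k \<le> real k * lc \<bar>E\<bar>"
proof -
  have n: "norm (axis 1 1 :: real^2) = 1" by simp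
  show ?thesis using min_drift_le[OF n, of E k] abs_drift_le[OF n order_refl, of E k] by linarith
qed

lemma Lam_bdd: "bdd_above ((\<lambda>k. min_drift E k / real k) ` {1..})"
  using min_drift_upper[of E] by (intro bdd_aboveI2[of _ _ "lc \<bar>E\<bar>"]) (simp add: divide_le_eq mult.commute)

lemma min_drift_le_Lam: "1 \<le> k \<Longrightarrow> min_drift E k \<le> real k * Lam E"
  using cSUP_upper[OF _ Lam_bdd, of k E] by (simp add: Lam_def divide_le_eq mult.commute)

lemma Lam_approx:
  assumes "c < Lam E" shows "\<exists>k\<ge>1. real k * c < min_drift E k"
proof -
  have "\<exists>k\<in>{1..}. c < min_drift E k / real k"
    using assms unfolding Lam_def by (subst (asm) less_cSUP_iff[OF _ Lam_bdd]) auto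
  then show ?thesis by (auto simp: less_divide_eq mult.commute)
qed

lemma Lam_ge: "1 \<le> k \<Longrightarrow> (\<And>v. norm v = 1 \<Longrightarrow> real k * c \<le> drift E k v) \<Longrightarrow> c \<le> Lam E"
  using order.trans[OF min_drift_greatest[of "real k * c" E k] min_drift_le_Lam[of k E]] by simp

lemma ln_norm_split:
  assumes "w \<noteq> 0"
  shows "ln (norm (Mnat E \<omega> n *v w)) = ln (norm w) + ln (norm (Mnat E \<omega> n *v (w /\<^sub>R norm w)))"
proof -
  have "w /\<^sub>R norm w \<noteq> 0" using assms by simp
  then have "norm (Mnat E \<omega> n *v (w /\<^sub>R norm w)) > 0" using Mnat_vec_nonzero by simp
  then show ?thesis unfolding Mnat_scale[OF assms] using assms by (simp add: ln_mult)
qed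

text \<open>Conditioning on site 0: the first step contributes its logarithm, and the shifted
  product starts afresh from the normalized image. The cut \<open>{..<1}\<close> gives site 0 to the
  first copy and the sites from 1 on to the second.\<close>

lemma drift_Suc:
  fixes E :: real
  assumes v: "norm v = 1"
  defines "u \<equiv> \<lambda>\<omega>. Mone E (\<omega> 0) *v v"
  shows "drift E (Suc k) v = (\<integral>\<omega>. ln (norm (u \<omega>)) + drift E k (u \<omega> /\<^sub>R norm (u \<omega>)) \<partial>P)"
    and "integrable P (\<lambda>\<omega>. ln (norm (u \<omega>)) + drift E k (u \<omega> /\<^sub>R norm (u \<omega>)))"
proof -
  interpret PP: prob_space P by (rule prob_space_P)
  interpret pair_sigma_finite P P by (rule pair_sigma_P)
  interpret PPP: prob_space "P \<Otimes>\<^sub>M P" by (rule pair_prob_P)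
  let ?F = "\<lambda>(x :: int \<Rightarrow> real) (y :: int \<Rightarrow> real). ln (norm (Mnat E (shift 1 y) k *v (Mone E (x 0) *v v)))"
  have v0: "v \<noteq> 0" using v by auto
  have u0: "u \<omega> \<noteq> 0" for \<omega> unfolding u_def using v0 by (intro mult_vec_nonzero) auto
  have inner: "(\<integral>\<omega>'. ?F \<omega> \<omega>' \<partial>P) = ln (norm (u \<omega>)) + drift E k (u \<omega> /\<^sub>R norm (u \<omega>))" for \<omega>
  proof -
    have "norm (u \<omega> /\<^sub>R norm (u \<omega>)) = 1" using u0 by simp
    note i = integrable_ln_norm[OF this, of E k]
    have "(\<integral>\<omega>'. ?F \<omega> \<omega>' \<partial>P) = (\<integral>\<omega>'. ln (norm (Mnat E \<omega>' k *v (u \<omega>))) \<partial>P)"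
      unfolding u_def by (rule integral_shift) measurable
    also have "\<dots> = (\<integral>\<omega>'. ln (norm (u \<omega>)) + ln (norm (Mnat E \<omega>' k *v (u \<omega> /\<^sub>R norm (u \<omega>)))) \<partial>P)"
      by (simp only: ln_norm_split[OF u0])
    also have "\<dots> = ln (norm (u \<omega>)) + drift E k (u \<omega> /\<^sub>R norm (u \<omega>))"
      using i by (simp add: drift_def PP.prob_space)
    finally show ?thesis .
  qed
  have b1: "AE x in P. \<bar>ln (norm (u x))\<bar> \<le> lc \<bar>E\<bar>"
    using AE_ln_norm_bound[OF v order_refl, of E 1] by (simp add: u_def)
  have b2: "AE x in P. AE y in P. norm (?F x y) \<le> lc \<bar>E\<bar> + real k * lc \<bar>E\<bar>"
    using b1
  proof eventually_elim
    case (elim x)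
    show ?case using AE_bounded
    proof eventually_elim
      fix y :: "int \<Rightarrow> real" assume y: "\<forall>i. \<bar>y i\<bar> \<le> R"
      have "norm (u x /\<^sub>R norm (u x)) = 1" using u0 by simp
      then have "\<bar>ln (norm (Mnat E (shift 1 y) k *v (u x /\<^sub>R norm (u x))))\<bar> \<le> real k * lc \<bar>E\<bar>"
        using y by (intro ln_norm_Mnat_bound) (auto simp: shift_apply)
      then show "norm (?F x y) \<le> lc \<bar>E\<bar> + real k * lc \<bar>E\<bar>"
        using elim ln_norm_split[OF u0[of x], of E "shift 1 y" k] unfolding u_def real_norm_def by linarith
    qed
  qed
  have "AE z in P \<Otimes>\<^sub>M P. norm (?F (fst z) (snd z)) \<le> lc \<bar>E\<bar> + real k * lc \<bar>E\<bar>"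
  proof (rule AE_pair_measure)
    show "{x \<in> space (P \<Otimes>\<^sub>M P). norm (?F (fst x) (snd x)) \<le> lc \<bar>E\<bar> + real k * lc \<bar>E\<bar>} \<in> sets (P \<Otimes>\<^sub>M P)"
      by measurable
  qed (use b2 in simp)
  then have int: "integrable (P \<Otimes>\<^sub>M P) (\<lambda>z. ?F (fst z) (snd z))"
    by (intro PPP.integrable_const_bound) auto
  have dep: "?F x y = ?F x' y'" if "\<And>i. i \<in> {..<1::int} \<Longrightarrow> x i = x' i" "\<And>i. i \<notin> {..<1::int} \<Longrightarrow> y i = y' i" for x x' y y' :: "int \<Rightarrow> real"
  proof -
    have "Mnat E (shift 1 y) k = Mnat E (shift 1 y') k" using that(2) by (auto intro!: Mnat_cong simp: shift_apply)
    then show ?thesis using that(1)[of 0] by simp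
  qed
  have "Mnat E \<omega> (Suc k) = Mnat E (shift 1 \<omega>) k ** Mone E (\<omega> 0)" for \<omega>
    using Mnat_add[of E \<omega> 1 k] by simp
  then have "drift E (Suc k) v = (\<integral>\<omega>. ?F \<omega> \<omega> \<partial>P)"
    by (simp only: drift_def matrix_vector_mul_assoc)
  also have "\<dots> = (\<integral>\<omega>. \<integral>\<omega>'. ?F \<omega> \<omega>' \<partial>P \<partial>P)" by (rule split_integral(1)[where F="?F" and A="{..<1}", OF int]) (rule dep; simp)
  finally show "drift E (Suc k) v = (\<integral>\<omega>. ln (norm (u \<omega>)) + drift E k (u \<omega> /\<^sub>R norm (u \<omega>)) \<partial>P)"
    unfolding inner .
  show "integrable P (\<lambda>\<omega>. ln (norm (u \<omega>)) + drift E k (u \<omega> /\<^sub>R norm (u \<omega>)))"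
  proof -
    have "integrable P (\<lambda>\<omega>. \<integral>\<omega>'. ?F \<omega> \<omega>' \<partial>P)"
      by (rule split_integral(2)[where F="?F" and A="{..<1}", OF int]) (rule dep; simp)
    then show ?thesis unfolding inner .
  qed
qed

text \<open>A near-minimizer for \<open>k\<close> steps is reused for \<open>k + 1\<close> steps,
  where one further matrix changes the logarithm by at most \<open>lc\<close>. The 1 is the defect
  of the near-minimizer.\<close>

lemma min_drift_Suc_le: "min_drift E (Suc k) \<le> min_drift E k + lc \<bar>E\<bar> + 1"
proof -
  interpret PP: prob_space P by (rule prob_space_P)
  obtain v where v: "norm v = 1" "drift E k v \<le> min_drift E k + 1" using min_drift_approx by blast
  have "min_drift E (Suc k) \<le> drift E (Suc k) v" by (rule min_drift_le[OF v(1)])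
  also have "\<dots> \<le> (\<integral>\<omega>. lc \<bar>E\<bar> + ln (norm (Mnat E \<omega> k *v v)) \<partial>P)"
    unfolding drift_def
  proof (rule integral_mono_AE)
    show "AE \<omega> in P. ln (norm (Mnat E \<omega> (Suc k) *v v)) \<le> lc \<bar>E\<bar> + ln (norm (Mnat E \<omega> k *v v))"
      using AE_bounded
    proof eventually_elim
      case (elim \<omega>)
      let ?w = "Mnat E \<omega> k *v v"
      have "v \<noteq> 0" using v by auto
      then have w: "?w \<noteq> 0" by (rule Mnat_vec_nonzero)
      have "norm (?w /\<^sub>R norm ?w) = 1" using w by simp
      then have "\<bar>ln (norm (Mnat E (shift (int k) \<omega>) 1 *v (?w /\<^sub>R norm ?w)))\<bar> \<le> real 1 * lc \<bar>E\<bar>"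
        using elim by (intro ln_norm_Mnat_bound) (auto simp: shift_apply)
      moreover have "ln (norm (Mnat E \<omega> (Suc k) *v v)) = ln (norm ?w) + ln (norm (Mnat E (shift (int k) \<omega>) 1 *v (?w /\<^sub>R norm ?w)))"
        using ln_norm_split[OF w, of E "shift (int k) \<omega>" 1] Mnat_add[of E \<omega> k 1] by (simp add: matrix_vector_mul_assoc)
      ultimately show ?case by simp
    qed
  qed (use integrable_ln_norm[OF v(1)] in \<open>auto simp del: Mnat.simps\<close>)
  also have "\<dots> = lc \<bar>E\<bar> + drift E k v"
    using integrable_ln_norm[OF v(1)] by (simp add: drift_def PP.prob_space)
  finally show ?thesis using v(2) by linarith
qed

text \<open>The excess of the drift over its minimum is nonnegative, and its mean after one step is
  bounded; hence it is bounded at some point of each of the two pieces of the support.\<close>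

lemma near_minimizer_step:
  fixes E :: real
  assumes v: "norm v = 1" and near: "drift E (Suc k) v \<le> min_drift E (Suc k) + C"
  assumes S: "S \<in> sets borel" "p \<le> prob S"
  defines "u \<equiv> \<lambda>\<alpha>. Mone E \<alpha> *v v"
  shows "\<exists>\<alpha>\<in>S. \<bar>\<alpha>\<bar> \<le> R \<and> drift E k (u \<alpha> /\<^sub>R norm (u \<alpha>)) \<le> min_drift E k + (C + 2 * lc \<bar>E\<bar> + 2) / p"
proof (rule ccontr)
  interpret PP: prob_space P by (rule prob_space_P)
  \<comment> \<open>Chosen so that \<open>?H * p = C + 2 * lc \<bar>E\<bar> + 2\<close>: the mean of
    \<open>?h\<close> would then be at least
    \<open>min_drift E k + lc \<bar>E\<bar> + C + 2\<close>, which exceeds by 1 the upper bound from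
    \<open>near\<close> and \<open>min_drift_Suc_le\<close>.\<close>
  let ?H = "(C + 2 * lc \<bar>E\<bar> + 2) / p"
  let ?h = "\<lambda>\<omega>. ln (norm (u (\<omega> 0))) + drift E k (u (\<omega> 0) /\<^sub>R norm (u (\<omega> 0)))"
  assume "\<not> ?thesis"
  then have big: "min_drift E k + ?H < drift E k (u \<alpha> /\<^sub>R norm (u \<alpha>))" if "\<alpha> \<in> S" "\<bar>\<alpha>\<bar> \<le> R" for \<alpha>
    using that by (meson not_le)
  have v0: "v \<noteq> 0" using v by auto
  have u0: "u \<alpha> \<noteq> 0" for \<alpha> unfolding u_def using v0 by (intro mult_vec_nonzero) auto
  have PS: "measure P {\<omega>. \<omega> 0 \<in> S} = prob S"
  proof -
    interpret PS: product_prob_space "\<lambda>_::int. M" UNIV by (rule product_prob)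
    show ?thesis using PS.emeasure_PiM_Collect_single[of 0 S] S(1) by (simp add: measure_def sets_M)
  qed
  have mS [measurable]: "{\<omega>. \<omega> 0 \<in> S} \<in> sets P"
  proof -
    have "{\<omega> \<in> space P. \<omega> 0 \<in> S} \<in> sets P" using S(1) by measurable
    then show ?thesis by simp
  qed
  have "min_drift E k - lc \<bar>E\<bar> + ?H * p \<le> min_drift E k - lc \<bar>E\<bar> + ?H * measure P {\<omega>. \<omega> 0 \<in> S}"
  proof -
    have "0 \<le> drift E (Suc k) v - min_drift E (Suc k)" using min_drift_le[OF v] by simp
    then have "0 \<le> C" using near by simp
    then have "0 \<le> ?H" using p lc_pos[of "\<bar>E\<bar>"] by simp
    then show ?thesis using S(2) unfolding PS by (intro add_left_mono mult_left_mono)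
  qed
  also have "\<dots> = (\<integral>\<omega>. min_drift E k - lc \<bar>E\<bar> + ?H * indicator {\<omega>. \<omega> 0 \<in> S} \<omega> \<partial>P)"
    by (subst Bochner_Integration.integral_add) (auto simp: PP.prob_space PP.emeasure_eq_measure)
  also have "\<dots> \<le> (\<integral>\<omega>. ?h \<omega> \<partial>P)"
  proof (rule integral_mono_AE)
    show "AE \<omega> in P. min_drift E k - lc \<bar>E\<bar> + ?H * indicator {\<omega>. \<omega> 0 \<in> S} \<omega> \<le> ?h \<omega>"
      using AE_bounded
    proof eventually_elim
      case (elim \<omega>)
      have 1: "\<bar>ln (norm (u (\<omega> 0)))\<bar> \<le> lc \<bar>E\<bar>"
        using ln_norm_Mnat_bound[of \<omega> R E "\<bar>E\<bar>" v 1] elim v by (simp add: u_def)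
      have 2: "min_drift E k \<le> drift E k (u (\<omega> 0) /\<^sub>R norm (u (\<omega> 0)))"
        using u0 by (intro min_drift_le) simp
      show ?case using 1 2 big[of "\<omega> 0"] elim by (auto simp: indicator_def)
    qed
    show "integrable P ?h" unfolding u_def by (rule drift_Suc(2)[OF v])
    show "integrable P (\<lambda>\<omega>. min_drift E k - lc \<bar>E\<bar> + ?H * indicator {\<omega>. \<omega> 0 \<in> S} \<omega>)"
      by (intro Bochner_Integration.integrable_add integrable_mult_right integrable_real_indicator)
        (auto simp: PP.emeasure_eq_measure)
  qed
  also have "\<dots> = drift E (Suc k) v" unfolding u_def by (rule drift_Suc(1)[OF v, symmetric])
  also have "\<dots> \<le> min_drift E k + lc \<bar>E\<bar> + 1 + C" using near min_drift_Suc_le[of E k] by linarith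
  finally show False using p by simp
qed


lemma prob_pieces: "{..a} \<in> sets borel" "p \<le> prob {..a}" "{b..} \<in> sets borel" "p \<le> prob {b..}"
  using p by auto

lemma norm_Mone_le: "norm v = 1 \<Longrightarrow> \<bar>\<alpha>\<bar> \<le> R \<Longrightarrow> norm (Mone E \<alpha> *v v) \<le> \<bar>E\<bar> + R + 2"
  using norm_matrix_vector_le[of "Mone E \<alpha>" v] mnorm_Mone_le[of E \<alpha>] by simp

text \<open>The images of \<open>v\<close> under two site values \<alpha>, \<beta> span the area
  (\<beta> - \<alpha>) times the square of \<open>v $ 1\<close>, which degenerates for small
  \<open>v $ 1\<close>. A preliminary step prevents this: its first component (E - \<alpha>)
  \<open>v $ 1\<close> - \<open>v $ 2\<close> cannot be small for both site values when
  \<open>v\<close> is a unit vector. Hence \<open>near_minimizer_step\<close> is applied twice in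
  succession.\<close>

lemma near_minimizer_pair:
  "\<exists>\<kappa>>0. \<exists>C. \<forall>n. \<exists>v w. norm v = 1 \<and> norm w = 1 \<and> \<kappa> \<le> \<bar>wedge v w\<bar>
     \<and> drift E n v \<le> min_drift E n + C \<and> drift E n w \<le> min_drift E n + C"
proof -
  define D where "D = \<bar>E\<bar> + R + 2"
  define C1 where "C1 = (1 + 2 * lc \<bar>E\<bar> + 2) / p"
  define C2 where "C2 = (C1 + 2 * lc \<bar>E\<bar> + 2) / p"
  \<comment> \<open>If the first component were below \<delta> for both site values,
    \<open>\<bar>v $ 1\<bar> + \<bar>v $ 2\<bar>\<close> would be at most
    \<open>\<delta> * t = 1 / 2\<close>, too little for a unit vector.\<close>
  define t where "t = 2 / (b - a) + 1 + 2 * D / (b - a)"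
  define \<delta> where "\<delta> = 1 / (2 * t)"
  have D: "D \<ge> 2" using R_nonneg by (simp add: D_def)
  have t: "t > 0" using ab D by (simp add: t_def add_pos_pos)
  then have \<delta>: "\<delta> > 0" by (simp add: \<delta>_def)
  have C1: "C1 \<ge> 0" using p lc_pos[of "\<bar>E\<bar>"] by (simp add: C1_def)
  \<comment> \<open>\<open>\<delta> / D\<close> bounds the first component after normalizing the
    preliminary step; the division by \<open>D\<^sup>2\<close> normalizes the two final
    images.\<close>
  define \<kappa> where "\<kappa> = (b - a) * (\<delta> / D)\<^sup>2 / D\<^sup>2"
  have \<kappa>: "\<kappa> > 0" using ab \<delta> D by (simp add: \<kappa>_def)
  let ?u = "\<lambda>v \<alpha>. Mone E \<alpha> *v v"
  let ?n = "\<lambda>x :: real^2. x /\<^sub>R norm x"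
  have unz: "?u v \<alpha> \<noteq> 0" if "norm v = 1" for v \<alpha>
    using that by (intro mult_vec_nonzero) auto
  have nn: "norm (?n (?u v \<alpha>)) = 1" if "norm v = 1" for v \<alpha>
    using unz[OF that] by simp
  have u1: "?u v \<alpha> $ 1 = (E - \<alpha>) * v $ 1 - v $ 2" "?u v \<alpha> $ 2 = v $ 1" for v \<alpha>
    by (simp_all add: matrix_vector_mult_def sum_2)
  have "\<exists>v w. norm v = 1 \<and> norm w = 1 \<and> \<kappa> \<le> \<bar>wedge v w\<bar>
     \<and> drift E n v \<le> min_drift E n + C2 \<and> drift E n w \<le> min_drift E n + C2" for n
  proof -
    obtain v where v: "norm v = 1" "drift E (Suc (Suc n)) v \<le> min_drift E (Suc (Suc n)) + 1"
      using min_drift_approx by blast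
    obtain \<alpha> where \<alpha>: "\<alpha> \<le> a" "\<bar>\<alpha>\<bar> \<le> R" "drift E (Suc n) (?n (?u v \<alpha>)) \<le> min_drift E (Suc n) + C1"
      using near_minimizer_step[OF v prob_pieces(1,2)] by (auto simp: C1_def)
    obtain \<beta> where \<beta>: "b \<le> \<beta>" "\<bar>\<beta>\<bar> \<le> R" "drift E (Suc n) (?n (?u v \<beta>)) \<le> min_drift E (Suc n) + C1"
      using near_minimizer_step[OF v prob_pieces(3,4)] by (auto simp: C1_def)
    have "\<exists>\<gamma>. \<bar>\<gamma>\<bar> \<le> R \<and> drift E (Suc n) (?n (?u v \<gamma>)) \<le> min_drift E (Suc n) + C1 \<and> \<delta> \<le> \<bar>?u v \<gamma> $ 1\<bar>"
    proof (rule ccontr)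
      assume "\<not> ?thesis"
      then have s: "\<bar>(E - \<alpha>) * v $ 1 - v $ 2\<bar> < \<delta>" "\<bar>(E - \<beta>) * v $ 1 - v $ 2\<bar> < \<delta>"
        using \<alpha>(2,3) \<beta>(2,3) unfolding u1 by (meson not_le)+
      have "(b - a) * \<bar>v $ 1\<bar> \<le> (\<beta> - \<alpha>) * \<bar>v $ 1\<bar>" using \<alpha>(1) \<beta>(1) by (intro mult_right_mono) auto
      also have "\<dots> = \<bar>((E - \<alpha>) * v $ 1 - v $ 2) - ((E - \<beta>) * v $ 1 - v $ 2)\<bar>"
      proof -
        have "((E - \<alpha>) * v $ 1 - v $ 2) - ((E - \<beta>) * v $ 1 - v $ 2) = (\<beta> - \<alpha>) * v $ 1"
          by (simp add: algebra_simps)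
        then show ?thesis using \<alpha>(1) \<beta>(1) ab by (simp add: abs_mult)
      qed
      also have "\<dots> \<le> 2 * \<delta>" using s by linarith
      finally have x: "\<bar>v $ 1\<bar> \<le> 2 * \<delta> / (b - a)" using ab by (simp add: pos_le_divide_eq mult.commute)
      have "\<bar>v $ 2\<bar> \<le> \<delta> + \<bar>(E - \<alpha>) * v $ 1\<bar>" using s(1) by linarith
      also have "\<bar>(E - \<alpha>) * v $ 1\<bar> \<le> D * (2 * \<delta> / (b - a))"
        unfolding abs_mult using \<alpha>(2) x D by (intro mult_mono) (auto simp: D_def)
      finally have y: "\<bar>v $ 2\<bar> \<le> \<delta> + D * (2 * \<delta> / (b - a))" by simp
      have "1 \<le> \<bar>v $ 1\<bar> + \<bar>v $ 2\<bar>" using norm_le_l1_cart[of v] v(1) by (simp add: sum_2)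
      also have "\<dots> \<le> 2 * \<delta> / (b - a) + (\<delta> + D * (2 * \<delta> / (b - a)))" using x y by linarith
      also have "\<dots> = \<delta> * t" by (simp add: t_def algebra_simps)
      also have "\<dots> = 1 / 2" using t by (simp add: \<delta>_def)
      finally show False by simp
    qed
    then obtain \<gamma> where \<gamma>: "\<bar>\<gamma>\<bar> \<le> R" "drift E (Suc n) (?n (?u v \<gamma>)) \<le> min_drift E (Suc n) + C1" "\<delta> \<le> \<bar>?u v \<gamma> $ 1\<bar>"
      by blast
    define z where "z = ?n (?u v \<gamma>)"
    have z: "norm z = 1" unfolding z_def by (rule nn[OF v(1)])
    have z1: "\<delta> / D \<le> \<bar>z $ 1\<bar>"
    proof -
      have pos: "norm (?u v \<gamma>) > 0" using unz[OF v(1)] by simp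
      have "\<delta> / D \<le> \<bar>?u v \<gamma> $ 1\<bar> / norm (?u v \<gamma>)"
        using \<gamma>(3) norm_Mone_le[OF v(1) \<gamma>(1), of E] \<delta> pos by (intro frac_le) (auto simp: D_def)
      also have "\<dots> = \<bar>z $ 1\<bar>" by (simp add: z_def abs_mult divide_inverse mult.commute)
      finally show ?thesis .
    qed
    have zd: "drift E (Suc n) z \<le> min_drift E (Suc n) + C1" using \<gamma>(2) by (simp add: z_def)
    obtain \<alpha>' where \<alpha>': "\<alpha>' \<le> a" "\<bar>\<alpha>'\<bar> \<le> R" "drift E n (?n (?u z \<alpha>')) \<le> min_drift E n + C2"
      using near_minimizer_step[OF z zd prob_pieces(1,2)] by (auto simp: C2_def)
    obtain \<beta>' where \<beta>': "b \<le> \<beta>'" "\<bar>\<beta>'\<bar> \<le> R" "drift E n (?n (?u z \<beta>')) \<le> min_drift E n + C2"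
      using near_minimizer_step[OF z zd prob_pieces(3,4)] by (auto simp: C2_def)
    let ?v = "?u z \<alpha>'" and ?w = "?u z \<beta>'"
    have pos: "norm ?v > 0" "norm ?w > 0" using unz[OF z] by simp_all
    have w0: "wedge ?v ?w = (\<beta>' - \<alpha>') * (z $ 1)\<^sup>2"
      unfolding wedge_def u1 by (simp add: algebra_simps power2_eq_square)
    have "\<kappa> \<le> (\<beta>' - \<alpha>') * (z $ 1)\<^sup>2 / (norm ?v * norm ?w)"
      unfolding \<kappa>_def
    proof (rule frac_le)
      show "(b - a) * (\<delta> / D)\<^sup>2 \<le> (\<beta>' - \<alpha>') * (z $ 1)\<^sup>2"
        using \<alpha>'(1) \<beta>'(1) ab z1 \<delta> D power_mono[OF z1, of 2] by (intro mult_mono) auto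
      show "norm ?v * norm ?w \<le> D\<^sup>2"
        unfolding power2_eq_square D_def using D
        by (intro mult_mono norm_Mone_le z \<alpha>'(2) \<beta>'(2)) (auto simp: D_def)
    qed (use \<alpha>'(1) \<beta>'(1) ab pos in auto)
    also have "\<dots> = \<bar>wedge (?n ?v) (?n ?w)\<bar>"
    proof -
      have "wedge (?n ?v) (?n ?w) = wedge ?v ?w / (norm ?v * norm ?w)"
        by (simp add: wedge_def divide_inverse algebra_simps)
      then show ?thesis using w0 \<alpha>'(1) \<beta>'(1) ab pos by simp
    qed
    finally have "\<kappa> \<le> \<bar>wedge (?n ?v) (?n ?w)\<bar>" .
    then show ?thesis using nn[OF z] \<alpha>'(3) \<beta>'(3) by blast
  qed
  then show ?thesis using \<kappa> by blast
qed

text \<open>Cramer's rule: a unit vector is a combination of \<open>v\<close> and \<open>w\<close>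
  with coefficients of modulus at most \<open>1 / \<kappa>\<close>.\<close>

lemma mnorm_le_pair:
  assumes v: "norm v = 1" and w: "norm w = 1" and \<kappa>: "0 < \<kappa>" "\<kappa> \<le> \<bar>wedge v w\<bar>"
  shows "mnorm A \<le> 2 / \<kappa> * max (norm (A *v v)) (norm (A *v w))"
proof (rule mnorm_leI)
  fix x :: "real^2" assume x: "norm x = 1"
  let ?m = "max (norm (A *v v)) (norm (A *v w))"
  have "wedge v w *\<^sub>R x = wedge x w *\<^sub>R v + wedge v x *\<^sub>R w"
    by (simp add: vec_eq_iff forall_2 wedge_def algebra_simps)
  then have "A *v (wedge v w *\<^sub>R x) = A *v (wedge x w *\<^sub>R v + wedge v x *\<^sub>R w)" by simp
  then have eq: "wedge v w *\<^sub>R (A *v x) = wedge x w *\<^sub>R (A *v v) + wedge v x *\<^sub>R (A *v w)"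
    by (simp only: matrix_vector_right_distrib matrix_vector_mult_scaleR)
  have "\<kappa> * norm (A *v x) \<le> \<bar>wedge v w\<bar> * norm (A *v x)" using \<kappa> by (intro mult_right_mono) auto
  also have "\<dots> = norm (wedge x w *\<^sub>R (A *v v) + wedge v x *\<^sub>R (A *v w))" by (simp flip: eq)
  also have "\<dots> \<le> \<bar>wedge x w\<bar> * norm (A *v v) + \<bar>wedge v x\<bar> * norm (A *v w)"
    by (rule order.trans[OF norm_triangle_ineq]) simp
  also have "\<dots> \<le> 1 * ?m + 1 * ?m"
    using abs_wedge_le[of x w] abs_wedge_le[of v x] v w x by (intro add_mono mult_mono) auto
  finally show "norm (A *v x) \<le> 2 / \<kappa> * ?m" using \<kappa> by (simp add: field_simps)
qed

section \<open>Identification of the uniform drift with the Lyapunov exponent\<close>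

definition mean_ln :: "real \<Rightarrow> nat \<Rightarrow> real" where
  "mean_ln E n = (\<integral>\<omega>. ln (mnorm (Mnat E \<omega> n)) \<partial>P)"

lemma drift_le_mean_ln: assumes "norm v = 1" shows "drift E n v \<le> mean_ln E n"
  unfolding drift_def mean_ln_def
proof (rule integral_mono[OF integrable_ln_norm[OF assms] integrable_ln_mnorm])
  fix \<omega>
  have "v \<noteq> 0" using assms by auto
  then have "0 < norm (Mnat E \<omega> n *v v)" using Mnat_vec_nonzero by simp
  moreover have "norm (Mnat E \<omega> n *v v) \<le> mnorm (Mnat E \<omega> n)"
    using norm_matrix_vector_le[of "Mnat E \<omega> n" v] assms by simp
  ultimately show "ln (norm (Mnat E \<omega> n *v v)) \<le> ln (mnorm (Mnat E \<omega> n))" by (rule ln_mono[rotated])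
qed

lemma real_of_nn_exp:
  assumes [measurable]: "f \<in> borel_measurable P"
    and le: "(\<integral>\<^sup>+\<omega>. ennreal (exp (f \<omega>)) \<partial>P) \<le> ennreal c" and c: "0 \<le> c"
  shows "integrable P (\<lambda>\<omega>. exp (f \<omega>))" "(\<integral>\<omega>. exp (f \<omega>) \<partial>P) \<le> c"
proof -
  show i: "integrable P (\<lambda>\<omega>. exp (f \<omega>))"
    using le by (intro integrableI_bounded) (auto intro: order.strict_trans1 simp: ennreal_less_top)
  show "(\<integral>\<omega>. exp (f \<omega>) \<partial>P) \<le> c"
    using le c nn_integral_eq_integral[OF i] by simp
qed

text \<open>Exponential moments bound the negative part of the deviation by a constant, so a vector whose
  mean growth is nearly minimal grows, in \<open>L\<^sup>1\<close>, close to the deterministic minimal rate.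
  Two transversal vectors of this kind control the matrix norm.\<close>

lemma abs_deviation:
  assumes v: "norm v = 1" and s: "0 < s" and C: "0 < C"
    and mom: "(\<integral>\<^sup>+\<omega>. ennreal (exp (- s * ln (norm (Mnat E \<omega> n *v v)))) \<partial>P) \<le> ennreal (C * exp (- s * c * real n))"
  shows "(\<integral>\<omega>. \<bar>ln (norm (Mnat E \<omega> n *v v)) - c * real n\<bar> \<partial>P) \<le> drift E n v - c * real n + 2 * C / s"
    and "c * real n - C / s \<le> drift E n v"
proof -
  interpret PP: prob_space P by (rule prob_space_P)
  let ?X = "\<lambda>\<omega>. ln (norm (Mnat E \<omega> n *v v)) - c * real n"
  note i = integrable_ln_norm[OF v, of E n]
  have iX: "integrable P ?X" using i by simp
  have ie: "integrable P (\<lambda>\<omega>. exp (- s * ln (norm (Mnat E \<omega> n *v v))))"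
    and le: "(\<integral>\<omega>. exp (- s * ln (norm (Mnat E \<omega> n *v v))) \<partial>P) \<le> C * exp (- s * c * real n)"
    using C by (intro real_of_nn_exp[OF _ mom]; simp)+
  have e: "exp (- s * ?X \<omega>) = exp (s * c * real n) * exp (- s * ln (norm (Mnat E \<omega> n *v v)))" for \<omega>
    by (simp add: algebra_simps flip: exp_add)
  have ie': "integrable P (\<lambda>\<omega>. exp (- s * ?X \<omega>))" unfolding e using ie by simp
  have le': "(\<integral>\<omega>. exp (- s * ?X \<omega>) \<partial>P) \<le> C"
  proof -
    have "(\<integral>\<omega>. exp (- s * ?X \<omega>) \<partial>P) = exp (s * c * real n) * (\<integral>\<omega>. exp (- s * ln (norm (Mnat E \<omega> n *v v))) \<partial>P)"
      unfolding e by simp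
    also have "\<dots> \<le> exp (s * c * real n) * (C * exp (- s * c * real n))" by (intro mult_left_mono le) simp
    also have "\<dots> = C" by (simp add: exp_minus)
    finally show ?thesis .
  qed
  have pt: "- y \<le> exp (- s * y) / s" for y :: real
    using s exp_ge_add_one_self[of "- s * y"] by (simp add: field_simps)
  \<comment> \<open>The modulus is the value plus twice the negative part, and only the negative
    part is paid for by the exponential moment.\<close>
  have "\<bar>?X \<omega>\<bar> \<le> ?X \<omega> + 2 * (exp (- s * ?X \<omega>) / s)" for \<omega>
    using pt[of "?X \<omega>"] s by (cases "0 \<le> ?X \<omega>") auto
  then have "(\<integral>\<omega>. \<bar>?X \<omega>\<bar> \<partial>P) \<le> (\<integral>\<omega>. ?X \<omega> + 2 * (exp (- s * ?X \<omega>) / s) \<partial>P)"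
    by (intro integral_mono integrable_abs Bochner_Integration.integrable_add integrable_mult_right integrable_divide iX ie')
  also have "\<dots> = drift E n v - c * real n + 2 * ((\<integral>\<omega>. exp (- s * ?X \<omega>) \<partial>P) / s)"
    using i ie' by (simp add: drift_def)
  also have "\<dots> \<le> drift E n v - c * real n + 2 * (C / s)"
    using le' s by (intro add_left_mono mult_left_mono divide_right_mono) auto
  finally show "(\<integral>\<omega>. \<bar>?X \<omega>\<bar> \<partial>P) \<le> drift E n v - c * real n + 2 * C / s" by simp
  have "0 \<le> (\<integral>\<omega>. ?X \<omega> + exp (- s * ?X \<omega>) / s \<partial>P)"
  proof (rule Bochner_Integration.integral_nonneg)
    show "0 \<le> ?X \<omega> + exp (- s * ?X \<omega>) / s" for \<omega> using pt[of "?X \<omega>"] by linarith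
  qed
  also have "\<dots> = drift E n v - c * real n + (\<integral>\<omega>. exp (- s * ?X \<omega>) \<partial>P) / s"
    using i ie' by (simp add: drift_def)
  also have "\<dots> \<le> drift E n v - c * real n + C / s" using le' s by (intro add_left_mono divide_right_mono) auto
  finally show "c * real n - C / s \<le> drift E n v" by simp
qed

lemma negative_moment_Lam:
  assumes c: "c < Lam E"
  shows "\<exists>s>0. \<exists>C>0. \<forall>n v. norm v = 1 \<longrightarrow>
      (\<integral>\<^sup>+\<omega>. ennreal (exp (- s * ln (norm (Mnat E \<omega> n *v v)))) \<partial>P) \<le> ennreal (C * exp (- s * c * real n))"
proof -
  define c' where "c' = (c + Lam E) / 2"
  have c': "c' < Lam E" "0 < c' - c" using c by (auto simp: c'_def field_simps)
  obtain k where k: "k \<ge> 1" "real k * c' < min_drift E k" using Lam_approx[OF c'(1)] by blast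
  have "real k * (c + (c' - c)) \<le> drift E k v" if "norm v = 1" for v
    using min_drift_le[OF that, of E k] k(2) by simp
  then show ?thesis
    using negative_moment_decay[OF _ k(1) c'(2), of "\<bar>E\<bar>" c] by fastforce
qed

text \<open>For a near-minimizer the mean deviation from rate \<open>c\<close> is about (Lam E - c)
  n. Two transversal near-minimizers add this twice to c n, which gives the slope
  \<open>2 * Lam E - c\<close>; it tends to \<open>Lam E\<close> together with
  \<open>c\<close>.\<close>

lemma mean_ln_bounds:
  assumes c: "c < Lam E"
  shows "\<exists>C. \<forall>n. c * real n - C \<le> mean_ln E n \<and> mean_ln E n \<le> (2 * Lam E - c) * real n + C"
proof -
  interpret PP: prob_space P by (rule prob_space_P)
  obtain s C where s: "s > 0" "C > 0" and mom: "\<And>n v. norm v = 1 \<Longrightarrow>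
      (\<integral>\<^sup>+\<omega>. ennreal (exp (- s * ln (norm (Mnat E \<omega> n *v v)))) \<partial>P) \<le> ennreal (C * exp (- s * c * real n))"
    using negative_moment_Lam[OF c] by blast
  obtain \<kappa> C' where \<kappa>: "\<kappa> > 0" and pair: "\<And>n. \<exists>v w. norm v = 1 \<and> norm w = 1 \<and> \<kappa> \<le> \<bar>wedge v w\<bar>
     \<and> drift E n v \<le> min_drift E n + C' \<and> drift E n w \<le> min_drift E n + C'"
    using near_minimizer_pair[of E] by blast
  have n1: "norm (axis 1 1 :: real^2) = 1" by simp
  define q where "q = C / s"
  have q: "0 < q" using s by (simp add: q_def)
  define C'' where "C'' = \<bar>ln (2 / \<kappa>)\<bar> + 2 * \<bar>C'\<bar> + 4 * q + 2 * \<bar>min_drift E 0\<bar>"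
  have "c * real n - C'' \<le> mean_ln E n \<and> mean_ln E n \<le> (2 * Lam E - c) * real n + C''" for n
  proof
    have "c * real n - C / s \<le> mean_ln E n"
      using abs_deviation(2)[OF n1 s mom[OF n1]] drift_le_mean_ln[OF n1] by (rule order.trans)
    then show "c * real n - C'' \<le> mean_ln E n"
      using q by (simp add: C''_def flip: q_def)
    obtain v w where vw: "norm v = 1" "norm w = 1" "\<kappa> \<le> \<bar>wedge v w\<bar>"
      "drift E n v \<le> min_drift E n + C'" "drift E n w \<le> min_drift E n + C'" using pair by blast
    \<comment> \<open>\<open>Lam\<close> only sees block lengths from 1 on, so \<open>n = 0\<close>
      goes into the constant.\<close>
    have mL: "min_drift E n \<le> real n * Lam E + \<bar>min_drift E 0\<bar>"
      using min_drift_le_Lam[of n E] by (cases n) auto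
    let ?X = "\<lambda>v \<omega>. ln (norm (Mnat E \<omega> n *v v)) - c * real n"
    have "ln (mnorm (Mnat E \<omega> n)) \<le> ln (2 / \<kappa>) + c * real n + (\<bar>?X v \<omega>\<bar> + \<bar>?X w \<omega>\<bar>)" for \<omega>
    proof -
      have "v \<noteq> 0" "w \<noteq> 0" using vw by auto
      then have pos: "0 < norm (Mnat E \<omega> n *v v)" "0 < norm (Mnat E \<omega> n *v w)" using Mnat_vec_nonzero by auto
      have m1: "0 < mnorm (Mnat E \<omega> n)" using mnorm_ge_1[of "Mnat E \<omega> n"] by simp
      have "ln (mnorm (Mnat E \<omega> n)) \<le> ln (2 / \<kappa> * max (norm (Mnat E \<omega> n *v v)) (norm (Mnat E \<omega> n *v w)))"
        by (rule ln_mono[OF mnorm_le_pair[OF vw(1,2) \<kappa> vw(3)] m1])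
      also have "\<dots> = ln (2 / \<kappa>) + ln (max (norm (Mnat E \<omega> n *v v)) (norm (Mnat E \<omega> n *v w)))"
        using \<kappa> pos by (intro ln_mult_pos) (auto simp: less_max_iff_disj)
      also have "\<dots> \<le> ln (2 / \<kappa>) + (c * real n + (\<bar>?X v \<omega>\<bar> + \<bar>?X w \<omega>\<bar>))"
        by (cases "norm (Mnat E \<omega> n *v v) \<le> norm (Mnat E \<omega> n *v w)") (auto simp: max_def)
      finally show ?thesis by simp
    qed
    then have "mean_ln E n \<le> (\<integral>\<omega>. ln (2 / \<kappa>) + c * real n + (\<bar>?X v \<omega>\<bar> + \<bar>?X w \<omega>\<bar>) \<partial>P)"
      unfolding mean_ln_def using integrable_ln_mnorm integrable_ln_norm[OF vw(1)] integrable_ln_norm[OF vw(2)]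
      by (intro integral_mono) auto
    also have "\<dots> = ln (2 / \<kappa>) + c * real n + ((\<integral>\<omega>. \<bar>?X v \<omega>\<bar> \<partial>P) + (\<integral>\<omega>. \<bar>?X w \<omega>\<bar> \<partial>P))"
      using integrable_ln_norm[OF vw(1)] integrable_ln_norm[OF vw(2)] by simp
    also have "\<dots> \<le> ln (2 / \<kappa>) + c * real n + ((drift E n v - c * real n + 2 * C / s) + (drift E n w - c * real n + 2 * C / s))"
      by (intro add_left_mono add_mono abs_deviation(1) vw s mom)
    also have "\<dots> \<le> (2 * Lam E - c) * real n + C''"
    proof -
      have "2 * C / s = 2 * q" by (simp add: q_def)
      then show ?thesis using vw(4,5) mL abs_ge_self[of "ln (2 / \<kappa>)"] abs_ge_self[of C']
        by (simp add: C''_def algebra_simps)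
    qed
    finally show "mean_ln E n \<le> (2 * Lam E - c) * real n + C''" .
  qed
  then show ?thesis by blast
qed

lemma mean_ln_limit: "(\<lambda>n. mean_ln E n / real n) \<longlonglongrightarrow> Lam E"
proof (rule LIMSEQ_I)
  fix r :: real assume r: "0 < r"
  obtain C where C: "\<And>n. (Lam E - r / 2) * real n - C \<le> mean_ln E n"
    "\<And>n. mean_ln E n \<le> (2 * Lam E - (Lam E - r / 2)) * real n + C"
    using mean_ln_bounds[of "Lam E - r / 2" E] r by auto
  obtain N where N: "real N > 2 * \<bar>C\<bar> / r" "N \<ge> 1" using reals_Archimedean2
    by (metis le_add2 less_add_one max.cobounded1 max.cobounded2 of_nat_mono order.strict_trans2)
  have "norm (mean_ln E n / real n - Lam E) < r" if "n \<ge> N" for n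
  proof -
    have n: "real n > 0" "real n > 2 * \<bar>C\<bar> / r" using that N by (simp, linarith)
    have Cn: "\<bar>C\<bar> < r / 2 * real n" using n(2) r by (simp add: field_simps)
    have "\<bar>mean_ln E n - Lam E * real n\<bar> < r * real n"
      using C(1)[of n] C(2)[of n] Cn abs_ge_self[of C] by (simp add: algebra_simps abs_less_iff)
    moreover have "mean_ln E n / real n - Lam E = (mean_ln E n - Lam E * real n) / real n"
      using n by (simp add: field_simps)
    ultimately show ?thesis using n by (simp add: pos_divide_less_eq)
  qed
  then show "\<exists>no. \<forall>n\<ge>no. norm (mean_ln E n / real n - Lam E) < r" by blast
qed

lemma lyap_eq_Lam: "lyap P E = Lam E"
  unfolding lyap_def using mean_ln_limit[of E]
  by (intro limI) (simp add: mean_ln_def)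

end

text \<open>The quadratic factor is the size of both later counts: of windows by position and
  length, and of grid points with a drop.\<close>

lemma summable_poly_exp:
  fixes \<eta> :: real assumes "0 < \<eta>"
  shows "summable (\<lambda>n. (real n + 1)\<^sup>2 * exp (- \<eta> * real n))"
proof (rule summable_comparison_test_bigo)
  have "summable (\<lambda>n. exp (- \<eta> / 2) ^ n)"
    using assms by (intro summable_geometric) auto
  then have "summable (\<lambda>n. exp (- \<eta> / 2 * real n))"
    by (simp only: exp_of_nat2_mult)
  then show "summable (\<lambda>n. norm (exp (- \<eta> / 2 * real n)))" by simp
  show "(\<lambda>n. (real n + 1)\<^sup>2 * exp (- \<eta> * real n)) \<in> O(\<lambda>n. exp (- \<eta> / 2 * real n))"
    using assms by real_asymp
qed

context iid_potential
begin

subsection \<open>Locally uniform large deviations\<close>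

lemma exp_tail:
  assumes [measurable]: "f \<in> borel_measurable P"
    and le: "(\<integral>\<^sup>+\<omega>. ennreal (exp (f \<omega>)) \<partial>P) \<le> ennreal c" and c: "0 \<le> c"
  shows "measure P {\<omega>. t \<le> f \<omega>} \<le> c * exp (- t)"
proof -
  have "measure P {\<omega> \<in> space P. exp t \<le> exp (f \<omega>)} \<le> (\<integral>\<omega>. exp (f \<omega>) \<partial>P) / exp t"
    by (rule integral_Markov_inequality_measure[where A="{}"])
      (use real_of_nn_exp[OF _ le c] in auto)
  also have "\<dots> \<le> c / exp t"
    using real_of_nn_exp(2)[OF _ le c] by (intro divide_right_mono) auto
  finally show ?thesis by (simp add: exp_minus field_simps)
qed

lemma measure_shift:
  assumes [measurable]: "{\<omega>. Q \<omega>} \<in> sets P"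
  shows "measure P {\<omega>. Q (shift k \<omega>)} = measure P {\<omega>. Q \<omega>}"
proof -
  have "measure P {\<omega>. Q \<omega>} = measure (distr P P (shift k)) {\<omega>. Q \<omega>}" by (simp add: distr_shift)
  also have "\<dots> = measure P (shift k -` {\<omega>. Q \<omega>} \<inter> space P)"
    using measurable_shift[OF measurable_ident_sets[OF refl], of k] by (intro measure_distr) auto
  finally show ?thesis by (simp add: vimage_def)
qed

lemma drift_Lipschitz:
  assumes v: "norm v = 1" and E: "\<bar>E\<bar> \<le> K" "\<bar>E'\<bar> \<le> K"
  shows "\<bar>drift E k v - drift E' k v\<bar> \<le> real k * ((K + R + 2) ^ k)\<^sup>2 * \<bar>E - E'\<bar>"
proof -
  interpret PP: prob_space P by (rule prob_space_P)
  define D where "D = K + R + 2"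
  have D: "D \<ge> 1" using E(1) R_nonneg by (simp add: D_def)
  let ?x = "\<lambda>E \<omega>. norm (Mnat E \<omega> k *v v)"
  have "AE \<omega> in P. \<bar>ln (?x E \<omega>) - ln (?x E' \<omega>)\<bar> \<le> real k * (D ^ k)\<^sup>2 * \<bar>E - E'\<bar>"
    using AE_bounded
  proof eventually_elim
    case (elim \<omega>)
    have v0: "v \<noteq> 0" using v by auto
    have pos: "0 < ?x F \<omega>" for F using Mnat_vec_nonzero[OF v0] by simp
    have lower: "1 \<le> D ^ k * ?x F \<omega>" if "\<bar>F\<bar> \<le> K" for F
    proof -
      have "1 \<le> mnorm (Mnat F \<omega> k) * ?x F \<omega>" using norm_le_mnorm_mult[of "Mnat F \<omega> k" v] v by simp
      also have "\<dots> \<le> D ^ k * ?x F \<omega>" unfolding D_def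
        using elim that by (intro mult_right_mono mnorm_Mnat_le) auto
      finally show ?thesis .
    qed
    have diff: "\<bar>?x F \<omega> - ?x F' \<omega>\<bar> \<le> real k * D ^ k * \<bar>F - F'\<bar>" if "\<bar>F\<bar> \<le> K" "\<bar>F'\<bar> \<le> K" for F F'
    proof -
      have "\<bar>?x F \<omega> - ?x F' \<omega>\<bar> \<le> norm ((Mnat F \<omega> k - Mnat F' \<omega> k) *v v)"
        unfolding matrix_vector_mult_diff_rdistrib by (rule norm_triangle_ineq3)
      also have "\<dots> \<le> mnorm (Mnat F \<omega> k - Mnat F' \<omega> k)"
        using norm_matrix_vector_le[of "Mnat F \<omega> k - Mnat F' \<omega> k" v] v by simp
      also have "\<dots> \<le> real k * D ^ k * \<bar>F - F'\<bar>"
        unfolding D_def using elim that by (intro mnorm_Mnat_Lipschitz) auto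
      finally show ?thesis .
    qed
    have one: "ln (?x F \<omega>) - ln (?x F' \<omega>) \<le> real k * (D ^ k)\<^sup>2 * \<bar>F - F'\<bar>" if F: "\<bar>F\<bar> \<le> K" "\<bar>F'\<bar> \<le> K" for F F'
    proof -
      have "ln (?x F \<omega>) - ln (?x F' \<omega>) = ln (?x F \<omega> / ?x F' \<omega>)" using pos by (simp add: ln_div)
      also have "\<dots> \<le> ?x F \<omega> / ?x F' \<omega> - 1" using pos by (intro ln_le_minus_one) simp
      also have "\<dots> = (?x F \<omega> - ?x F' \<omega>) / ?x F' \<omega>" using pos[of F'] by (simp add: field_simps)
      also have "\<dots> \<le> \<bar>?x F \<omega> - ?x F' \<omega>\<bar> / ?x F' \<omega>" using pos[of F'] by (intro divide_right_mono) auto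
      also have "\<dots> \<le> \<bar>?x F \<omega> - ?x F' \<omega>\<bar> * D ^ k"
        using lower[OF F(2)] pos[of F'] mult_left_mono[OF lower[OF F(2)], of "\<bar>?x F \<omega> - ?x F' \<omega>\<bar>"]
        by (simp add: pos_divide_le_eq mult.assoc)
      also have "\<dots> \<le> (real k * D ^ k * \<bar>F - F'\<bar>) * D ^ k"
        using diff[OF F] D by (intro mult_right_mono) auto
      finally show ?thesis by (simp add: power2_eq_square mult_ac)
    qed
    show ?case using one[OF E] one[OF E(2,1)] by (simp add: abs_le_iff abs_minus_commute)
  qed
  moreover have "\<bar>drift E k v - drift E' k v\<bar> \<le> (\<integral>\<omega>. \<bar>ln (?x E \<omega>) - ln (?x E' \<omega>)\<bar> \<partial>P)"
    unfolding drift_def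
    by (subst Bochner_Integration.integral_diff[OF integrable_ln_norm[OF v] integrable_ln_norm[OF v], symmetric])
      (rule integral_abs_bound)
  ultimately show ?thesis
    using integral_mono_AE[of P "\<lambda>\<omega>. \<bar>ln (?x E \<omega>) - ln (?x E' \<omega>)\<bar>" "\<lambda>_. real k * (D ^ k)\<^sup>2 * \<bar>E - E'\<bar>"]
      integrable_ln_norm[OF v] by (simp add: D_def)
qed

text \<open>The witness block has rate \<open>c + 3 * \<epsilon>\<close> at \<open>E0\<close>. One
  \<epsilon> is lost in changing the energy, one in the second-order term of the moment, and the
  third becomes the decay rate \<open>s * \<epsilon>\<close>. The growth of one fixed unit vector
  bounds the norm from below.\<close>

lemma local_lower_tail:
  assumes c: "c < Lam E0"
  shows "\<exists>\<delta>>0. \<exists>\<eta>>0. \<exists>C>0. \<forall>E. \<bar>E - E0\<bar> < \<delta> \<longrightarrow> c \<le> Lam E \<and>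
    (\<forall>n m. measure P {\<omega>. mnorm (Mnat E (shift m \<omega>) n) \<le> exp (c * real n)} \<le> C * exp (- \<eta> * real n))"
proof -
  define \<epsilon> where "\<epsilon> = (Lam E0 - c) / 4"
  have \<epsilon>: "0 < \<epsilon>" using c by (simp add: \<epsilon>_def)
  have "c + 3 * \<epsilon> < Lam E0" using c by (simp add: \<epsilon>_def field_simps)
  then obtain k where k: "k \<ge> 1" "real k * (c + 3 * \<epsilon>) < min_drift E0 k"
    using Lam_approx by blast
  define K where "K = \<bar>E0\<bar> + 1"
  define L where "L = real k * ((K + R + 2) ^ k)\<^sup>2"
  have L: "L > 0" using k R_nonneg by (simp add: L_def K_def add_nonneg_pos)
  define \<delta> where "\<delta> = min 1 (real k * \<epsilon> / L)"
  have \<delta>: "\<delta> > 0" using k \<epsilon> L by (simp add: \<delta>_def)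
  have K0: "0 \<le> K" by (simp add: K_def)
  obtain s C where s: "s > 0" "C > 0" and mom: "\<And>E. \<bar>E\<bar> \<le> K \<Longrightarrow>
      (\<And>v. norm v = 1 \<Longrightarrow> real k * ((c + \<epsilon>) + \<epsilon>) \<le> drift E k v) \<Longrightarrow>
    (\<forall>n v. norm v = 1 \<longrightarrow>
      (\<integral>\<^sup>+\<omega>. ennreal (exp (- s * ln (norm (Mnat E \<omega> n *v v)))) \<partial>P) \<le> ennreal (C * exp (- s * (c + \<epsilon>) * real n)))"
    using negative_moment_decay[OF K0 k(1) \<epsilon>, of "c + \<epsilon>"] by meson
  have "c \<le> Lam E \<and> (\<forall>n m. measure P {\<omega>. mnorm (Mnat E (shift m \<omega>) n) \<le> exp (c * real n)} \<le> C * exp (- (s * \<epsilon>) * real n))"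
    if E: "\<bar>E - E0\<bar> < \<delta>" for E
  proof
    have EK: "\<bar>E\<bar> \<le> K" "\<bar>E0\<bar> \<le> K" using E by (auto simp: K_def \<delta>_def)
    have dr: "real k * ((c + \<epsilon>) + \<epsilon>) \<le> drift E k v" if v: "norm v = 1" for v
    proof -
      have "\<bar>drift E k v - drift E0 k v\<bar> \<le> L * \<bar>E - E0\<bar>" using drift_Lipschitz[OF v EK, of k] by (simp add: L_def)
      also have "\<dots> \<le> L * (real k * \<epsilon> / L)" using E L by (intro mult_left_mono) (auto simp: \<delta>_def)
      also have "\<dots> = real k * \<epsilon>" using L by simp
      finally show ?thesis using k(2) min_drift_le[OF v, of E0 k] by (simp add: algebra_simps)
    qed
    have "c + 2 * \<epsilon> \<le> Lam E" using dr by (intro Lam_ge[OF k(1)]) (simp add: algebra_simps)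
    then show "c \<le> Lam E" using \<epsilon> by simp
    show "\<forall>n m. measure P {\<omega>. mnorm (Mnat E (shift m \<omega>) n) \<le> exp (c * real n)} \<le> C * exp (- (s * \<epsilon>) * real n)"
    proof (intro allI)
      fix n m
      let ?v = "axis 1 1 :: real^2"
      have v: "norm ?v = 1" by simp
      let ?f = "\<lambda>\<omega>. - s * ln (norm (Mnat E \<omega> n *v ?v))"
      have "measure P {\<omega>. mnorm (Mnat E (shift m \<omega>) n) \<le> exp (c * real n)}
         = measure P {\<omega>. mnorm (Mnat E \<omega> n) \<le> exp (c * real n)}"
      proof (rule measure_shift)
        have "{\<omega> \<in> space P. mnorm (Mnat E \<omega> n) \<le> exp (c * real n)} \<in> sets P" by measurable
        then show "{\<omega>. mnorm (Mnat E \<omega> n) \<le> exp (c * real n)} \<in> sets P" by simp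
      qed
      also have "\<dots> \<le> measure P {\<omega>. - s * (c * real n) \<le> ?f \<omega>}"
      proof (rule finite_measure.finite_measure_mono[OF prob_space.finite_measure[OF prob_space_P]])
        show "{\<omega>. mnorm (Mnat E \<omega> n) \<le> exp (c * real n)} \<subseteq> {\<omega>. - s * (c * real n) \<le> ?f \<omega>}"
        proof clarify
          fix \<omega> assume le: "mnorm (Mnat E \<omega> n) \<le> exp (c * real n)"
          have "?v \<noteq> 0" using v by force
          then have pos: "0 < norm (Mnat E \<omega> n *v ?v)" using Mnat_vec_nonzero by simp
          have "norm (Mnat E \<omega> n *v ?v) \<le> exp (c * real n)"
            using norm_matrix_vector_le[of "Mnat E \<omega> n" ?v] v le by simp
          then have "ln (norm (Mnat E \<omega> n *v ?v)) \<le> c * real n" using ln_mono[OF _ pos] by fastforce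
          then show "- s * (c * real n) \<le> ?f \<omega>" using s by simp
        qed
        have "{\<omega> \<in> space P. - s * (c * real n) \<le> ?f \<omega>} \<in> sets P" by measurable
        then show "{\<omega>. - s * (c * real n) \<le> ?f \<omega>} \<in> sets P" by simp
      qed
      also have "\<dots> \<le> (C * exp (- s * (c + \<epsilon>) * real n)) * exp (- (- s * (c * real n)))"
        using mom[OF EK(1) dr] v s by (intro exp_tail) auto
      also have "\<dots> = C * exp (- (s * \<epsilon>) * real n)"
        by (simp add: algebra_simps flip: exp_add)
      finally show "measure P {\<omega>. mnorm (Mnat E (shift m \<omega>) n) \<le> exp (c * real n)} \<le> C * exp (- (s * \<epsilon>) * real n)" .
    qed
  qed
  moreover have "0 < s * \<epsilon>" using s \<epsilon> by simp
  ultimately show ?thesis using \<delta> s by blast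
qed

text \<open>Convergence of the mean log norms provides a block whose rate at \<open>E0\<close> is
  below \<open>c - 2 * \<epsilon> = Lam E0 + 2 * \<epsilon>\<close>. Since \<open>W\<close>
  dominates all nearby energies at once, upper bounds later require a union over windows
  only.\<close>

lemma local_majorant:
  assumes c: "Lam E0 < c"
  shows "\<exists>\<delta>>0. \<exists>s>0. \<exists>C>0. \<exists>W. (\<forall>n. W n \<in> borel_measurable P) \<and> (\<forall>n \<omega>. 0 < W n \<omega>) \<and>
    (\<forall>\<omega>. (\<forall>i. \<bar>\<omega> i\<bar> \<le> R) \<longrightarrow> (\<forall>E. \<bar>E - E0\<bar> < \<delta> \<longrightarrow> (\<forall>n. mnorm (Mnat E \<omega> n) \<le> W n \<omega>))) \<and>
    (\<forall>n. (\<integral>\<^sup>+\<omega>. ennreal (exp (s * ln (W n \<omega>))) \<partial>P) \<le> ennreal (C * exp (s * c * real n)))"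
proof -
  define \<epsilon> where "\<epsilon> = (c - Lam E0) / 4"
  have \<epsilon>: "0 < \<epsilon>" using c by (simp add: \<epsilon>_def)
  have "eventually (\<lambda>n. mean_ln E0 n / real n < Lam E0 + 2 * \<epsilon>) sequentially"
    using mean_ln_limit[of E0] \<epsilon> by (intro order_tendstoD(2)) auto
  then obtain k where k: "k \<ge> 1" "mean_ln E0 k / real k < Lam E0 + 2 * \<epsilon>"
    unfolding eventually_sequentially by (metis max.cobounded1 max.cobounded2)
  have "mean_ln E0 k \<le> real k * (c - 2 * \<epsilon>)"
    using k by (simp add: divide_less_eq \<epsilon>_def field_simps)
  then have dr: "(\<integral>\<omega>. ln (mnorm (Mnat E0 \<omega> k)) \<partial>P) \<le> real k * (c - 2 * \<epsilon>)" by (simp add: mean_ln_def)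
  define K where "K = \<bar>E0\<bar> + 1"
  have E0K: "\<bar>E0\<bar> \<le> K" by (simp add: K_def)
  have D: "K + R + 2 > 0" using R_nonneg by (simp add: K_def add_nonneg_pos)
  define L where "L = real k * (K + R + 2) ^ k"
  have L: "L > 0" using k D by (simp add: L_def)
  define \<delta> where "\<delta> = min 1 (\<epsilon> / L)"
  have \<delta>: "\<delta> > 0" using \<epsilon> L by (simp add: \<delta>_def)
  obtain s C where s: "s > 0" "C > 0" and
    mom: "\<And>n. (\<integral>\<^sup>+\<omega>. ennreal (exp (s * ln (majorant E0 (K + R + 2) \<epsilon> k n \<omega>))) \<partial>P) \<le> ennreal (C * exp (s * c * real n))"
    using majorant_moment[OF E0K k(1) \<epsilon> dr] by blast
  have maj: "mnorm (Mnat E \<omega> n) \<le> majorant E0 (K + R + 2) \<epsilon> k n \<omega>"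
    if "\<forall>i. \<bar>\<omega> i\<bar> \<le> R" "\<bar>E - E0\<bar> < \<delta>" for \<omega> E n
  proof (rule mnorm_le_majorant)
    show "\<bar>E\<bar> \<le> K" using that by (auto simp: K_def \<delta>_def)
    have "L * \<bar>E - E0\<bar> \<le> L * (\<epsilon> / L)" using that L by (intro mult_left_mono) (auto simp: \<delta>_def)
    also have "L * (\<epsilon> / L) = \<epsilon>" using L by simp
    finally show "real k * (K + R + 2) ^ k * \<bar>E - E0\<bar> \<le> \<epsilon>" by (simp add: L_def)
  qed (use that E0K k in auto)
  show ?thesis
    using \<delta> s mom maj majorant_pos[OF D]
    by (intro exI[of _ \<delta>] conjI exI[of _ s] exI[of _ C] exI[of _ "majorant E0 (K + R + 2) \<epsilon> k"]) auto
qed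

text \<open>The inequality y \<le> exp y turns the exponential moment of the majorant into a bound
  \<open>c * n + C / s\<close> for the mean log norm at each nearby energy.\<close>

lemma Lam_local_le:
  assumes c: "Lam E0 < c" shows "\<exists>\<delta>>0. \<forall>E. \<bar>E - E0\<bar> < \<delta> \<longrightarrow> Lam E \<le> c"
proof -
  interpret PP: prob_space P by (rule prob_space_P)
  obtain \<delta> s C W where \<delta>: "\<delta> > 0" and s: "s > 0" "C > 0"
    and W: "\<And>n. W n \<in> borel_measurable P" "\<And>n \<omega>. 0 < W n \<omega>"
    and maj: "\<And>\<omega> E n. (\<forall>i. \<bar>\<omega> i\<bar> \<le> R) \<Longrightarrow> \<bar>E - E0\<bar> < \<delta> \<Longrightarrow> mnorm (Mnat E \<omega> n) \<le> W n \<omega>"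
    and mom: "\<And>n. (\<integral>\<^sup>+\<omega>. ennreal (exp (s * ln (W n \<omega>))) \<partial>P) \<le> ennreal (C * exp (s * c * real n))"
    using local_majorant[OF c] by metis
  have "Lam E \<le> c" if E: "\<bar>E - E0\<bar> < \<delta>" for E
  proof -
    have up: "mean_ln E n \<le> c * real n + C / s" for n
    proof -
      note [measurable] = W(1)
      have C0: "0 \<le> C * exp (s * c * real n)" using s by simp
      have ie: "integrable P (\<lambda>\<omega>. exp (s * ln (W n \<omega>)))"
        and le: "(\<integral>\<omega>. exp (s * ln (W n \<omega>)) \<partial>P) \<le> C * exp (s * c * real n)"
        by (rule real_of_nn_exp[OF _ mom C0]; simp)+
      have "AE \<omega> in P. ln (mnorm (Mnat E \<omega> n)) \<le> c * real n + exp (s * ln (W n \<omega>)) * exp (- s * c * real n) / s"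
        using AE_bounded
      proof eventually_elim
        case (elim \<omega>)
        have "0 < mnorm (Mnat E \<omega> n)" using mnorm_ge_1[of "Mnat E \<omega> n"] by simp
        then have 1: "ln (mnorm (Mnat E \<omega> n)) \<le> ln (W n \<omega>)" using ln_mono[OF maj[OF elim E, of n]] by simp
        have "s * ln (W n \<omega>) + - s * c * real n \<le> exp (s * ln (W n \<omega>) + - s * c * real n)"
          using exp_ge_add_one_self[of "s * ln (W n \<omega>) + - s * c * real n"] by linarith
        then have "s * (ln (W n \<omega>) - c * real n) \<le> exp (s * ln (W n \<omega>)) * exp (- s * c * real n)"
          by (simp only: exp_add) (simp add: algebra_simps)
        then have "ln (W n \<omega>) - c * real n \<le> exp (s * ln (W n \<omega>)) * exp (- s * c * real n) / s"
          using s by (simp add: pos_le_divide_eq mult.commute)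
        then show ?case using 1 by linarith
      qed
      then have "mean_ln E n \<le> (\<integral>\<omega>. c * real n + exp (s * ln (W n \<omega>)) * exp (- s * c * real n) / s \<partial>P)"
        unfolding mean_ln_def using ie
        by (intro integral_mono_AE integrable_ln_mnorm Bochner_Integration.integrable_add integrable_divide integrable_mult_left) auto
      also have "\<dots> = c * real n + (\<integral>\<omega>. exp (s * ln (W n \<omega>)) \<partial>P) * exp (- s * c * real n) / s"
        using ie by simp
      also have "\<dots> \<le> c * real n + (C * exp (s * c * real n)) * exp (- s * c * real n) / s"
        using le s by (intro add_left_mono divide_right_mono mult_right_mono) auto
      also have "\<dots> = c * real n + C / s" by (simp add: exp_minus)
      finally show ?thesis .
    qed
    have "(\<lambda>n. c + C / s * (1 / real n)) \<longlonglongrightarrow> c + C / s * 0"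
      by (intro tendsto_intros lim_1_over_n)
    then have lim: "(\<lambda>n. c + C / s * (1 / real n)) \<longlonglongrightarrow> c" by simp
    show "Lam E \<le> c"
    proof (rule LIMSEQ_le[OF mean_ln_limit lim], intro exI[of _ 1] allI impI)
      fix n :: nat assume "1 \<le> n"
      then show "mean_ln E n / real n \<le> c + C / s * (1 / real n)"
        using up[of n] by (simp add: field_simps)
    qed
  qed
  then show ?thesis using \<delta> by blast
qed

end

section \<open>Asymptotic events on windows and energy grids\<close>

lemma continuous_mnorm_Mnat: "continuous_on UNIV (\<lambda>E. mnorm (Mnat E \<omega> n))"
proof -
  from Mnat_entry_poly[of n \<omega>] obtain q where
    q: "\<And>E i j. Mnat E \<omega> n $ i $ j = poly (q i j) E" by metis
  have "(\<lambda>E. Mnat E \<omega> n) = (\<lambda>E. \<chi> i j. poly (q i j) E)"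
    by (simp add: fun_eq_iff vec_eq_iff q)
  then have "continuous_on UNIV (\<lambda>E. Mnat E \<omega> n)"
    by (simp only:) (intro continuous_intros)
  then show ?thesis by (rule continuous_on_compose2[OF continuous_mnorm]) auto
qed

text \<open>The slack is \<open>\<epsilon> * n\<close> on the scale of the whole picture, whatever
  the length \<open>l\<close>, so that arbitrarily short subwindows are covered. These occur as the
  two outer factors in \<open>Mnat_telescope\<close>.\<close>

definition window_upper :: "real \<Rightarrow> real \<Rightarrow> real \<Rightarrow> nat \<Rightarrow> real \<Rightarrow> (int \<Rightarrow> real) \<Rightarrow> bool" where
  "window_upper c \<epsilon> \<delta> T E0 \<omega> \<longleftrightarrow> eventually (\<lambda>n. \<forall>m l. \<bar>m\<bar> \<le> int (T * n) \<longrightarrow> l \<le> T * n \<longrightarrow>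
     (\<forall>E. \<bar>E - E0\<bar> < \<delta> \<longrightarrow> mnorm (Mnat E (shift m \<omega>) l) \<le> exp (c * real l + \<epsilon> * real n))) sequentially"

definition grid_lower :: "real \<Rightarrow> real \<Rightarrow> real \<Rightarrow> real \<Rightarrow> (int \<Rightarrow> real) \<Rightarrow> bool" where
  "grid_lower c \<eta> \<delta> E0 \<omega> \<longleftrightarrow> eventually (\<lambda>n. \<forall>i::int. \<bar>i * exp (- \<eta> * real n)\<bar> < \<delta> \<longrightarrow>
      exp (c * real (2 * n)) < mnorm (Mnat (E0 + i * exp (- \<eta> * real n)) (shift (- int n) \<omega>) (2 * n))) sequentially"

text \<open>Restricting to rational energies keeps the event measurable and loses nothing, by continuity.\<close>

definition drop_event :: "real \<Rightarrow> real \<Rightarrow> nat \<Rightarrow> int \<Rightarrow> (int \<Rightarrow> real) set" where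
  "drop_event E0 r n i = {\<omega>. \<exists>y\<in>\<rat>. \<bar>y - (E0 + i * r)\<bar> \<le> r \<and>
     mnorm (Mnat y (shift (- int n) \<omega>) (2 * n)) < mnorm (Mnat (E0 + i * r) (shift (- int n) \<omega>) (2 * n)) / 8}"

text \<open>The central window selects the grid points at which anything is claimed;
  \<open>m n\<close> will be the left end of a long window on one side of it.\<close>

definition drop_lower :: "real \<Rightarrow> real \<Rightarrow> real \<Rightarrow> nat \<Rightarrow> (nat \<Rightarrow> int) \<Rightarrow> real \<Rightarrow> (int \<Rightarrow> real) \<Rightarrow> bool" where
  "drop_lower c \<eta> \<delta> T m E0 \<omega> \<longleftrightarrow> eventually (\<lambda>n. \<forall>i::int. \<bar>i * exp (- \<eta> * real n)\<bar> < \<delta> \<longrightarrow>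
      \<omega> \<in> drop_event E0 (exp (- \<eta> * real n)) n i \<longrightarrow>
      exp (c * real (T * n)) < mnorm (Mnat (E0 + i * exp (- \<eta> * real n)) (shift (m n) \<omega>) (T * n))) sequentially"

lemma window_upper_mono: "window_upper c \<epsilon> \<delta> T E0 \<omega> \<Longrightarrow> \<delta>' \<le> \<delta> \<Longrightarrow> window_upper c \<epsilon> \<delta>' T E0 \<omega>"
  unfolding window_upper_def by (rule eventually_mono, assumption) force

lemma grid_lower_mono: "grid_lower c \<eta> \<delta> E0 \<omega> \<Longrightarrow> \<delta>' \<le> \<delta> \<Longrightarrow> grid_lower c \<eta> \<delta>' E0 \<omega>"
  unfolding grid_lower_def by (rule eventually_mono, assumption) force

lemma drop_lower_mono: "drop_lower c \<eta> \<delta> T m E0 \<omega> \<Longrightarrow> \<delta>' \<le> \<delta> \<Longrightarrow> drop_lower c \<eta> \<delta>' T m E0 \<omega>"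
  unfolding drop_lower_def by (rule eventually_mono, assumption) force

context iid_potential
begin

subsection \<open>Almost sure events\<close>

lemma borel_cantelli_bound:
  fixes A :: "nat \<Rightarrow> (int \<Rightarrow> real) set"
  assumes A: "\<And>n. A n \<in> sets P" and \<eta>: "0 < \<eta>"
    and le: "\<And>n. measure P (A n) \<le> C * ((real n + 1)\<^sup>2 * exp (- \<eta> * real n))"
  shows "AE \<omega> in P. eventually (\<lambda>n. \<omega> \<notin> A n) sequentially"
proof -
  have "summable (\<lambda>n. measure P (A n))"
    by (rule summable_comparison_test'[where N=0, OF summable_mult[OF summable_poly_exp[OF \<eta>], of C]])
      (use le in auto)
  then have "AE \<omega> in P. eventually (\<lambda>n. \<omega> \<in> space P - A n) sequentially"
    by (intro borel_cantelli_AE1 A) (auto simp: finite_measure.emeasure_finite[OF prob_space.finite_measure[OF prob_space_P]] less_top[symmetric])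
  then show ?thesis by eventually_elim (auto elim: eventually_mono)
qed

lemma measure_UN_le:
  assumes "finite I" "\<And>i. i \<in> I \<Longrightarrow> A i \<in> sets P" "\<And>i. i \<in> I \<Longrightarrow> measure P (A i) \<le> c"
  shows "measure P (\<Union>i\<in>I. A i) \<le> real (card I) * c"
proof -
  have "measure P (\<Union>i\<in>I. A i) \<le> (\<Sum>i\<in>I. measure P (A i))"
    using assms by (intro finite_measure.finite_measure_subadditive_finite[OF prob_space.finite_measure[OF prob_space_P]]) auto
  also have "\<dots> \<le> real (card I) * c" using sum_bounded_above[of I "\<lambda>i. measure P (A i)" c] assms(3) by simp
  finally show ?thesis .
qed

text \<open>The union bound runs over quadratically many pairs of position and length; the energies
  are handled simultaneously by the majorant.\<close>

lemma AE_upper: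
  assumes c: "Lam E0 < c" and \<epsilon>: "0 < \<epsilon>"
  shows "\<exists>\<delta>>0. AE \<omega> in P. window_upper c \<epsilon> \<delta> T E0 \<omega>"
proof -
  obtain \<delta> s C W where \<delta>: "\<delta> > 0" and s: "s > 0" "C > 0"
    and W: "\<And>n. W n \<in> borel_measurable P" "\<And>n \<omega>. 0 < W n \<omega>"
    and maj: "\<And>\<omega> E n. (\<forall>i. \<bar>\<omega> i\<bar> \<le> R) \<Longrightarrow> \<bar>E - E0\<bar> < \<delta> \<Longrightarrow> mnorm (Mnat E \<omega> n) \<le> W n \<omega>"
    and mom: "\<And>n. (\<integral>\<^sup>+\<omega>. ennreal (exp (s * ln (W n \<omega>))) \<partial>P) \<le> ennreal (C * exp (s * c * real n))"
    using local_majorant[OF c] by metis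
  note [measurable] = W(1)
  let ?B = "\<lambda>n l m. {\<omega>. s * (c * real l + \<epsilon> * real n) \<le> s * ln (W l (shift m \<omega>))}"
  define I where "I n = {- int (T * n)..int (T * n)} \<times> {..T * n}" for n
  let ?A = "\<lambda>n. \<Union>(m, l)\<in>I n. ?B n l m"
  have Bm: "?B n l m \<in> sets P" for n l m
  proof -
    have "{\<omega> \<in> space P. s * (c * real l + \<epsilon> * real n) \<le> s * ln (W l (shift m \<omega>))} \<in> sets P" by measurable
    then show ?thesis by simp
  qed
  have Ble: "measure P (?B n l m) \<le> C * exp (- (s * \<epsilon>) * real n)" for n l m
  proof -
    have "measure P (?B n l m) = measure P {\<omega>. s * (c * real l + \<epsilon> * real n) \<le> s * ln (W l \<omega>)}"
      by (rule measure_shift) (use Bm[of l n 0] in simp)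
    also have "\<dots> \<le> (C * exp (s * c * real l)) * exp (- (s * (c * real l + \<epsilon> * real n)))"
      using s by (intro exp_tail[OF _ mom]) auto
    also have "\<dots> = C * exp (- (s * \<epsilon>) * real n)" by (simp add: algebra_simps flip: exp_add)
    finally show ?thesis .
  qed
  have "AE \<omega> in P. eventually (\<lambda>n. \<omega> \<notin> ?A n) sequentially"
  proof (rule borel_cantelli_bound)
    show "?A n \<in> sets P" for n using Bm by (auto simp: I_def)
    show "0 < s * \<epsilon>" using s \<epsilon> by simp
    show "measure P (?A n) \<le> ((2 * real T + 1)\<^sup>2 * C) * ((real n + 1)\<^sup>2 * exp (- (s * \<epsilon>) * real n))" for n
    proof -
      have "measure P (\<Union>ml\<in>I n. (case ml of (m, l) \<Rightarrow> ?B n l m)) \<le> real (card (I n)) * (C * exp (- (s * \<epsilon>) * real n))"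
        using Bm Ble by (intro measure_UN_le) (auto simp: I_def)
      moreover have "real (card (I n)) \<le> (2 * real T + 1)\<^sup>2 * (real n + 1)\<^sup>2"
      proof -
        have "card {- int k..int k} = 2 * k + 1" for k
          by (simp add: nat_add_distrib nat_mult_distrib)
        then have "card (I n) = (2 * (T * n) + 1) * (T * n + 1)"
          by (simp only: I_def card_cartesian_product card_atMost) simp
        then have "real (card (I n)) = real ((2 * (T * n) + 1) * (T * n + 1))" by (simp only:)
        also have "\<dots> = (2 * (real T * real n) + 1) * (real T * real n + 1)" by (simp add: algebra_simps)
        also have "\<dots> \<le> ((2 * real T + 1) * (real n + 1)) * ((2 * real T + 1) * (real n + 1))"
          by (intro mult_mono) (auto simp: algebra_simps)
        finally show ?thesis by (simp add: power2_eq_square mult_ac)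
      qed
      ultimately have "measure P (?A n) \<le> ((2 * real T + 1)\<^sup>2 * (real n + 1)\<^sup>2) * (C * exp (- (s * \<epsilon>) * real n))"
        using s by (meson mult_right_mono order.trans mult_nonneg_nonneg exp_ge_zero less_imp_le)
      then show ?thesis by (simp add: mult_ac)
    qed
  qed
  then have "AE \<omega> in P. window_upper c \<epsilon> \<delta> T E0 \<omega>"
    using AE_bounded
  proof eventually_elim
    case (elim \<omega>)
    show ?case unfolding window_upper_def using elim(1)
    proof (rule eventually_mono, intro allI impI)
      fix n m l E assume nA: "\<omega> \<notin> ?A n" and ml: "\<bar>m\<bar> \<le> int (T * n)" "l \<le> T * n" and E: "\<bar>E - E0\<bar> < \<delta>"
      have "(m, l) \<in> I n" using ml by (auto simp: I_def abs_le_iff)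
      then have "\<omega> \<notin> ?B n l m" using nA by blast
      then have "ln (W l (shift m \<omega>)) < c * real l + \<epsilon> * real n" using s by simp
      then have "exp (ln (W l (shift m \<omega>))) \<le> exp (c * real l + \<epsilon> * real n)" by simp
      then have "W l (shift m \<omega>) \<le> exp (c * real l + \<epsilon> * real n)" using W(2)[of l "shift m \<omega>"] by simp
      moreover have "mnorm (Mnat E (shift m \<omega>) l) \<le> W l (shift m \<omega>)"
        using elim(2) E by (intro maj) (auto simp: shift_apply)
      ultimately show "mnorm (Mnat E (shift m \<omega>) l) \<le> exp (c * real l + \<epsilon> * real n)" by linarith
    qed
  qed
  then show ?thesis using \<delta> by blast
qed

lemma grid_card:
  assumes r: "0 < r" and \<delta>: "0 < \<delta>"
  shows "finite {i::int. \<bar>real_of_int i * r\<bar> < \<delta>}" "real (card {i::int. \<bar>real_of_int i * r\<bar> < \<delta>}) \<le> 2 * \<delta> / r + 1"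
proof -
  have sub: "{i::int. \<bar>real_of_int i * r\<bar> < \<delta>} \<subseteq> {i. \<bar>real_of_int i - 0\<bar> \<le> \<delta> / r}"
    using r by (auto simp: abs_mult pos_le_divide_eq)
  have d: "0 \<le> \<delta> / r" using r \<delta> by simp
  show "finite {i::int. \<bar>real_of_int i * r\<bar> < \<delta>}"
    by (rule finite_subset[OF sub card_int_interval(1)[OF d]])
  show "real (card {i::int. \<bar>real_of_int i * r\<bar> < \<delta>}) \<le> 2 * \<delta> / r + 1"
    using card_mono[OF card_int_interval(1)[OF d] sub] card_int_interval(2)[OF d, of 0] by linarith
qed

text \<open>A grid of order exp(\<eta> n) points meets tails of order exp(-2 \<eta> n), since the
  windows have length 2n. The tail rate itself can therefore serve as spacing exponent.\<close>

lemma AE_grid_lower: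
  assumes c: "c < Lam E0"
  shows "\<exists>\<delta>>0. \<exists>\<eta>>0. AE \<omega> in P. grid_lower c \<eta> \<delta> E0 \<omega>"
proof -
  obtain \<delta> \<eta> C where \<delta>: "\<delta> > 0" and \<eta>: "\<eta> > 0" "C > 0"
    and H: "\<forall>E. \<bar>E - E0\<bar> < \<delta> \<longrightarrow> c \<le> Lam E \<and>
    (\<forall>n m. measure P {\<omega>. mnorm (Mnat E (shift m \<omega>) n) \<le> exp (c * real n)} \<le> C * exp (- \<eta> * real n))"
    using local_lower_tail[OF c] by (elim exE conjE)
  have tail: "measure P {\<omega>. mnorm (Mnat E (shift m \<omega>) n) \<le> exp (c * real n)} \<le> C * exp (- \<eta> * real n)"
    if "\<bar>E - E0\<bar> < \<delta>" for E n m
    using H that by blast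
  let ?r = "\<lambda>n. exp (- \<eta> * real n)"
  let ?I = "\<lambda>n. {i::int. \<bar>i * ?r n\<bar> < \<delta>}"
  let ?B = "\<lambda>n i. {\<omega>. mnorm (Mnat (E0 + i * ?r n) (shift (- int n) \<omega>) (2 * n)) \<le> exp (c * real (2 * n))}"
  let ?A = "\<lambda>n. \<Union>i\<in>?I n. ?B n (real_of_int i)"
  have Bm: "?B n i \<in> sets P" for n i
  proof -
    have "{\<omega> \<in> space P. mnorm (Mnat (E0 + i * ?r n) (shift (- int n) \<omega>) (2 * n)) \<le> exp (c * real (2 * n))} \<in> sets P" by measurable
    then show ?thesis by simp
  qed
  have "AE \<omega> in P. eventually (\<lambda>n. \<omega> \<notin> ?A n) sequentially"
  proof (rule borel_cantelli_bound[OF _ \<eta>(1)])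
    fix n
    note fin = grid_card[OF exp_gt_zero[of "- \<eta> * real n"] \<delta>]
    show "?A n \<in> sets P" using fin Bm by auto
    have "measure P (?A n) \<le> real (card (?I n)) * (C * exp (- \<eta> * real (2 * n)))"
    proof (intro measure_UN_le fin(1) Bm)
      fix i assume "i \<in> ?I n"
      then show "measure P (?B n i) \<le> C * exp (- \<eta> * real (2 * n))" by (intro tail) simp
    qed
    also have "\<dots> \<le> (2 * \<delta> / ?r n + 1) * (C * exp (- \<eta> * real (2 * n)))"
      using fin(2) \<eta> by (intro mult_right_mono) auto
    also have "\<dots> = C * (2 * \<delta> + ?r n) * ?r n"
    proof -
      have e: "exp (- \<eta> * real (2 * n)) = ?r n * ?r n" by (simp add: algebra_simps flip: exp_add)
      have "(2 * \<delta> / q + 1) * (C * (q * q)) = C * (2 * \<delta> + q) * q" if "0 < q" for q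
        using that by (simp add: field_simps)
      from this[OF exp_gt_zero] show ?thesis unfolding e .
    qed
    also have "\<dots> \<le> C * (2 * \<delta> + 1) * ((real n + 1)\<^sup>2 * ?r n)"
    proof -
      have r1: "?r n \<le> 1" using \<eta> by simp
      have "1 \<le> (real n + 1)\<^sup>2" by (simp add: one_le_power)
      then have "?r n \<le> (real n + 1)\<^sup>2 * ?r n" using mult_right_mono[of 1 "(real n + 1)\<^sup>2" "?r n"] by simp
      then show ?thesis using r1 \<eta> \<delta> by (intro mult_mono) auto
    qed
    finally show "measure P (?A n) \<le> (C * (2 * \<delta> + 1)) * ((real n + 1)\<^sup>2 * ?r n)" .
  qed
  then have "AE \<omega> in P. grid_lower c \<eta> \<delta> E0 \<omega>"
    unfolding grid_lower_def by eventually_elim (auto elim!: eventually_mono simp: not_le)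
  then show ?thesis using \<delta> \<eta> by blast
qed

lemma sets_drop_event [measurable]: "drop_event E0 r n i \<in> sets P"
proof -
  have "drop_event E0 r n i = (\<Union>y\<in>{y\<in>\<rat>. \<bar>y - (E0 + i * r)\<bar> \<le> r}.
     {\<omega> \<in> space P. mnorm (Mnat y (shift (- int n) \<omega>) (2 * n)) < mnorm (Mnat (E0 + i * r) (shift (- int n) \<omega>) (2 * n)) / 8})"
    by (auto simp: drop_event_def)
  also have "\<dots> \<in> sets P"
  proof (rule sets.countable_UN')
    show "countable {y\<in>\<rat>. \<bar>y - (E0 + i * r)\<bar> \<le> r}"
      by (rule countable_subset[OF _ countable_rat]) auto
  qed (intro image_subsetI, measurable)
  finally show ?thesis .
qed

text \<open>Selection and test use disjoint windows, and every configuration selects at most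
  quadratically many grid points. The union bound thus costs a polynomial factor only, and the
  spacing exponent \<open>\<eta>0\<close> may be prescribed independently of the tail rate at
  \<open>c\<close>, even for \<open>c\<close> close to \<open>Lam E0\<close>.\<close>

lemma AE_drop_lower:
  assumes c: "c < Lam E0" and \<eta>0: "0 < \<eta>0" and T: "1 \<le> T"
    and m: "\<And>n. int n \<le> m n \<or> m n + int (T * n) \<le> - int n"
  shows "\<exists>\<delta>>0. AE \<omega> in P. drop_lower c \<eta>0 \<delta> T m E0 \<omega>"
proof -
  interpret PP: prob_space P by (rule prob_space_P)
  obtain \<delta> \<eta> C where \<delta>: "\<delta> > 0" and \<eta>: "\<eta> > 0" "C > 0"
    and H: "\<forall>E. \<bar>E - E0\<bar> < \<delta> \<longrightarrow> c \<le> Lam E \<and>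
    (\<forall>n m. measure P {\<omega>. mnorm (Mnat E (shift m \<omega>) n) \<le> exp (c * real n)} \<le> C * exp (- \<eta> * real n))"
    using local_lower_tail[OF c] by (elim exE conjE)
  have tail: "measure P {\<omega>. mnorm (Mnat E (shift m \<omega>) n) \<le> exp (c * real n)} \<le> C * exp (- \<eta> * real n)"
    if "\<bar>E - E0\<bar> < \<delta>" for E n m
    using H that by blast
  let ?r = "\<lambda>n. exp (- \<eta>0 * real n)"
  let ?I = "\<lambda>n. {i::int. \<bar>i * ?r n\<bar> < \<delta>}"
  define D where "D n i = drop_event E0 (?r n) n i" for n i
  define B where "B n i = {\<omega>. mnorm (Mnat (E0 + real_of_int i * ?r n) (shift (m n) \<omega>) (T * n)) \<le> exp (c * real (T * n))}" for n i
  let ?A = "\<lambda>n. \<Union>i\<in>?I n. D n i \<inter> B n i"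
  have [measurable]: "D n i \<in> sets P" for n i by (simp add: D_def)
  have [measurable]: "B n i \<in> sets P" for n i
  proof -
    have "{\<omega> \<in> space P. mnorm (Mnat (E0 + real_of_int i * ?r n) (shift (m n) \<omega>) (T * n)) \<le> exp (c * real (T * n))} \<in> sets P" by measurable
    then show ?thesis by (simp only: B_def space_P UNIV_I simp_thms)
  qed
  have indep: "emeasure P (D n i \<inter> B n i) = emeasure P (D n i) * emeasure P (B n i)" for n i
  proof -
    let ?F = "\<lambda>x y. indicator (D n i) x * indicator (B n i) y :: ennreal"
    let ?S = "{- int n..<int n}"
    have "emeasure P (D n i \<inter> B n i) = (\<integral>\<^sup>+\<omega>. ?F \<omega> \<omega> \<partial>P)"
      by (simp flip: indicator_inter_arith)
    also have "\<dots> = (\<integral>\<^sup>+\<omega>. \<integral>\<^sup>+\<omega>'. ?F \<omega> \<omega>' \<partial>P \<partial>P)"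
    proof (rule split_nn_integral[where A="?S"])
      show "(\<lambda>z. ?F (fst z) (snd z)) \<in> borel_measurable (P \<Otimes>\<^sub>M P)"
        by measurable
      fix x x' y y' :: "int \<Rightarrow> real"
      assume xx: "\<And>i. i \<in> ?S \<Longrightarrow> x i = x' i" and yy: "\<And>i. i \<notin> ?S \<Longrightarrow> y i = y' i"
      have "Mnat F (shift (- int n) x) (2 * n) = Mnat F (shift (- int n) x') (2 * n)" for F
        by (rule Mnat_cong) (auto simp: shift_apply intro!: xx)
      then have 1: "x \<in> D n i \<longleftrightarrow> x' \<in> D n i" by (simp add: D_def drop_event_def)
      have "Mnat F (shift (m n) y) (T * n) = Mnat F (shift (m n) y') (T * n)" for F
      proof (rule Mnat_cong)
        fix j assume j: "0 \<le> j" "j < int (T * n)"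
        have "j + m n \<notin> ?S" using m[of n] j by auto
        then show "shift (m n) y j = shift (m n) y' j" using yy by (simp add: shift_apply)
      qed
      then have 2: "y \<in> B n i \<longleftrightarrow> y' \<in> B n i" by (simp add: B_def)
      show "?F x y = ?F x' y'" using 1 2 by (simp add: indicator_def)
    qed
    also have "\<dots> = emeasure P (D n i) * emeasure P (B n i)"
      by (simp add: nn_integral_cmult nn_integral_multc)
    finally show ?thesis .
  qed
  have "AE \<omega> in P. eventually (\<lambda>n. \<omega> \<notin> ?A n) sequentially"
  proof (rule borel_cantelli_bound[OF _ \<eta>(1)])
    fix n
    note fin = grid_card(1)[OF exp_gt_zero[of "- \<eta>0 * real n"] \<delta>]
    show "?A n \<in> sets P" using fin by auto
    show "measure P (?A n) \<le> (C * 128) * ((real n + 1)\<^sup>2 * exp (- \<eta> * real n))"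
    proof (cases "n = 0")
      \<comment> \<open>The empty product is the identity and cannot drop, whereas the root count
        asks for positive length.\<close>
      case True
      have "?A n = {}" using mnorm_nonneg[of "mat 1"] True by (auto simp: D_def drop_event_def)
      then have "measure P (?A n) = 0" by (simp only: measure_empty)
      then show ?thesis using \<eta> by simp
    next
      case False
      define q where "q = C * exp (- \<eta> * real (T * n))"
      have q: "0 \<le> q" using \<eta> by (simp add: q_def)
      define N where "N = 4 * ((2 * n) * (4 * (2 * n) + 1))"
      have "emeasure P (?A n) \<le> (\<Sum>i\<in>?I n. emeasure P (D n i \<inter> B n i))"
        using fin by (intro emeasure_subadditive_finite) auto
      also have "\<dots> \<le> (\<Sum>i\<in>?I n. emeasure P (D n i) * ennreal q)"
      proof (rule sum_mono)
        fix i assume "i \<in> ?I n"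
        then have "measure P (B n i) \<le> q" unfolding q_def B_def by (intro tail) auto
        then show "emeasure P (D n i \<inter> B n i) \<le> emeasure P (D n i) * ennreal q"
          unfolding indep by (intro mult_left_mono) (auto simp: PP.emeasure_eq_measure ennreal_leI)
      qed
      also have "\<dots> = (\<Sum>i\<in>?I n. emeasure P (D n i)) * ennreal q" by (simp add: sum_distrib_right)
      \<comment> \<open>The sum is the expected number of selected grid points. The root count
        bounds that number pointwise, so no probability of an individual selection has to be
        estimated.\<close>
      also have "(\<Sum>i\<in>?I n. emeasure P (D n i)) = (\<integral>\<^sup>+\<omega>. (\<Sum>i\<in>?I n. indicator (D n i) \<omega>) \<partial>P)"
        by (subst nn_integral_sum) auto
      also have "\<dots> \<le> ennreal (real N)"
      proof (rule nn_integral_const_bound, rule AE_I2)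
        fix \<omega>
        let ?S = "{i::int. \<exists>y. \<bar>y - (E0 + i * ?r n)\<bar> \<le> ?r n \<and>
           mnorm (Mnat y (shift (- int n) \<omega>) (2 * n)) < mnorm (Mnat (E0 + i * ?r n) (shift (- int n) \<omega>) (2 * n)) / 8}"
        have S: "finite ?S" "card ?S \<le> N"
          unfolding N_def using False by (intro card_mnorm_drops; simp)+
        have "(\<Sum>i\<in>?I n. indicator (D n i) \<omega>) = (\<Sum>i\<in>?I n. if \<omega> \<in> D n i then 1 else 0 :: ennreal)"
          by (simp add: indicator_def of_bool_def)
        also have "\<dots> = (\<Sum>i\<in>{i\<in>?I n. \<omega> \<in> D n i}. 1)"
          by (rule sum.inter_filter[OF fin, symmetric])
        also have "\<dots> = of_nat (card {i\<in>?I n. \<omega> \<in> D n i})" by simp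
        also have "\<dots> \<le> of_nat (card ?S)"
          by (intro of_nat_mono card_mono S) (auto simp: D_def drop_event_def)
        also have "\<dots> \<le> of_nat N" using S by (intro of_nat_mono)
        finally show "(\<Sum>i\<in>?I n. indicator (D n i) \<omega>) \<le> ennreal (real N)"
          by (simp add: ennreal_of_nat_eq_real_of_nat)
      qed
      finally have "emeasure P (?A n) \<le> ennreal (real N) * ennreal q" by (simp add: mult_right_mono)
      then have "measure P (?A n) \<le> real N * q"
        using q by (simp add: PP.emeasure_eq_measure flip: ennreal_mult)
      also have "\<dots> \<le> (128 * (real n + 1)\<^sup>2) * (C * exp (- \<eta> * real n))"
      proof (intro mult_mono)
        show "real N \<le> 128 * (real n + 1)\<^sup>2" by (simp add: N_def power2_eq_square algebra_simps)
        have "real n \<le> real (T * n)" using T by (simp add: mult_le_cancel_right1)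
        then show "q \<le> C * exp (- \<eta> * real n)" using \<eta> unfolding q_def by (intro mult_left_mono) auto
      qed (use q in auto)
      finally show ?thesis by (simp add: mult_ac)
    qed
  qed
  then have "AE \<omega> in P. drop_lower c \<eta>0 \<delta> T m E0 \<omega>"
  proof eventually_elim
    case (elim \<omega>)
    then show ?case unfolding drop_lower_def by (rule eventually_mono) (auto simp: D_def B_def not_le)
  qed
  then show ?thesis using \<delta> by blast
qed


subsection \<open>Growth at generalized eigenvalues\<close>

text \<open>\<open>\<epsilon> \<le> \<Lambda> / 16\<close> keeps both half-window norms below
  exp(9/8 \<Lambda> n), against exp(3/2 \<Lambda> n) at the grid point, so the gap absorbs the
  polynomial factor and the 8. \<open>\<epsilon> * (2 * T + 2) \<le> \<eta> / 2\<close> lets the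
  spacing beat the ratio of upper to lower bounds on the long window. The radius is
  \<open>2 * \<delta>\<close> because the grid point next to \<open>E\<close> may leave the
  \<delta>-interval, and \<open>T + 1\<close> because the long windows reach out to distance (T + 1)
  n.\<close>

lemma long_window_lower:
  fixes \<Lambda> \<epsilon> \<eta> \<delta> :: real and T :: nat
  assumes E: "E \<in> geneig \<omega>" "\<bar>E - E0\<bar> < \<delta>"
    and par: "0 < \<Lambda>" "0 < \<epsilon>" "\<epsilon> \<le> \<Lambda> / 16" "\<epsilon> * (2 * real T + 2) \<le> \<eta> / 2" "0 < \<eta>" "0 < \<delta>" "1 \<le> T"
    and m: "\<And>n. m n = int n \<or> m n = - int n - int (T * n)"
    and upper: "window_upper (\<Lambda> + \<epsilon>) \<epsilon> (2 * \<delta>) (T + 1) E0 \<omega>"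
    and grid: "grid_lower (3 / 4 * \<Lambda>) \<eta> (2 * \<delta>) E0 \<omega>"
    and danger: "drop_lower (\<Lambda> - \<epsilon>) \<eta> (2 * \<delta>) T m E0 \<omega>"
  shows "eventually (\<lambda>n. exp ((\<Lambda> - \<epsilon>) * real (T * n)) / 2 \<le> mnorm (Mnat E (shift (m n) \<omega>) (T * n))) sequentially"
proof -
  obtain C where C: "\<And>n. mnorm (Mnat E (shift (- int n) \<omega>) (2 * n)) \<le>
     C * (real n + 2) * (mnorm (Mnat E \<omega> n) + mnorm (Mnat E (shift (- int n) \<omega>) n))"
    using geneig_mnorm_le[OF E(1)] by blast
  define C' where "C' = max C 1"
  have C': "C' > 0" "C \<le> C'" by (auto simp: C'_def)
  have ev1: "eventually (\<lambda>n. exp (- \<eta> * real n) < \<delta>) sequentially"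
    using par(5,6) by real_asymp
  have ev2: "eventually (\<lambda>n. 16 * C' * (real n + 2) * exp (9 / 8 * \<Lambda> * real n) < exp (3 / 2 * \<Lambda> * real n)) sequentially"
    using par(1) C' by real_asymp
  have ev3: "eventually (\<lambda>n. 2 * (real T * real n) * exp (- (\<eta> / 2) * real n) \<le> 1) sequentially"
    using par(5) par(7) by real_asymp
  show ?thesis
    using upper[unfolded window_upper_def] grid[unfolded grid_lower_def] danger[unfolded drop_lower_def] ev1 ev2 ev3
  proof eventually_elim
    case (elim n)
    define r where "r = exp (- \<eta> * real n)"
    have r: "0 < r" "r < \<delta>" using elim(4) by (auto simp: r_def)
    \<comment> \<open>Rounding down places \<open>E\<close> in \<open>[g, g + r)\<close>. The strict
      room on the right admits a rational energy near \<open>E\<close> at which the drop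
      persists.\<close>
    define i where "i = \<lfloor>(E - E0) / r\<rfloor>"
    define g where "g = E0 + i * r"
    have gE: "0 \<le> E - g" "E - g < r"
    proof -
      have q: "(E - E0) / r * r = E - E0" using r by simp
      have "real_of_int i * r \<le> (E - E0) / r * r" using r by (intro mult_right_mono) (auto simp: i_def)
      then show "0 \<le> E - g" unfolding q by (simp add: g_def)
      have "(E - E0) / r * r < (real_of_int i + 1) * r" using r by (intro mult_strict_right_mono) (auto simp: i_def)
      then show "E - g < r" unfolding q by (simp add: g_def algebra_simps)
    qed
    have i2: "\<bar>i * r\<bar> < 2 * \<delta>" using gE r E(2) by (simp add: g_def)
    then have g2: "\<bar>g - E0\<bar> < 2 * \<delta>" by (simp add: g_def)
    have E2: "\<bar>E - E0\<bar> < 2 * \<delta>" using E(2) par(6) by simp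
    have up: "mnorm (Mnat F (shift k \<omega>) l) \<le> exp ((\<Lambda> + \<epsilon>) * real l + \<epsilon> * real n)"
      if "\<bar>k\<bar> \<le> int ((T + 1) * n)" "l \<le> (T + 1) * n" "\<bar>F - E0\<bar> < 2 * \<delta>" for F k l
      using elim(1) that by blast
    have "mnorm (Mnat E (shift (- int n) \<omega>) (2 * n)) < mnorm (Mnat g (shift (- int n) \<omega>) (2 * n)) / 8"
    proof -
      let ?X = "mnorm (Mnat E (shift 0 \<omega>) n)" and ?Y = "mnorm (Mnat E (shift (- int n) \<omega>) n)"
      have XY: "?X \<le> exp (9 / 8 * \<Lambda> * real n)" "?Y \<le> exp (9 / 8 * \<Lambda> * real n)"
      proof -
        have "(\<Lambda> + \<epsilon>) * real n + \<epsilon> * real n = (\<Lambda> + 2 * \<epsilon>) * real n" by (simp add: algebra_simps)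
        also have "\<dots> \<le> 9 / 8 * \<Lambda> * real n" using par(3) by (intro mult_right_mono) auto
        finally have e: "exp ((\<Lambda> + \<epsilon>) * real n + \<epsilon> * real n) \<le> exp (9 / 8 * \<Lambda> * real n)" by simp
        show "?X \<le> exp (9 / 8 * \<Lambda> * real n)"
          by (rule order.trans[OF up e]) (use E2 in auto)
        show "?Y \<le> exp (9 / 8 * \<Lambda> * real n)"
          by (rule order.trans[OF up e]) (use E2 in auto)
      qed
      have "mnorm (Mnat E (shift (- int n) \<omega>) (2 * n)) \<le> C * (real n + 2) * (?X + ?Y)" using C[of n] by simp
      also have "\<dots> \<le> C' * (real n + 2) * (2 * exp (9 / 8 * \<Lambda> * real n))"
        using XY C' mnorm_nonneg by (intro mult_mono add_nonneg_nonneg) auto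
      finally have "8 * mnorm (Mnat E (shift (- int n) \<omega>) (2 * n)) \<le> 16 * C' * (real n + 2) * exp (9 / 8 * \<Lambda> * real n)" by simp
      also have "\<dots> < exp (3 / 2 * \<Lambda> * real n)" by (rule elim(5))
      also have "\<dots> < mnorm (Mnat g (shift (- int n) \<omega>) (2 * n))"
        using elim(2) i2 unfolding r_def g_def by (auto simp: mult_ac)
      finally show ?thesis by simp
    qed
    then have "\<omega> \<in> drop_event E0 r n i"
    proof -
      let ?f = "\<lambda>y. mnorm (Mnat y (shift (- int n) \<omega>) (2 * n))"
      assume lt: "?f E < ?f g / 8"
      have "open {y. ?f y < ?f g / 8}"
        using continuous_mnorm_Mnat by (intro open_Collect_less continuous_on_const) auto
      then obtain e where e: "e > 0" "ball E e \<subseteq> {y. ?f y < ?f g / 8}" using lt openE by blast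
      obtain y where y: "y \<in> \<rat>" "E < y" "y < min (E + e) (g + r)"
        using Rats_dense_in_real[of E "min (E + e) (g + r)"] e(1) gE by auto
      have "y \<in> ball E e" using y by (simp add: dist_real_def)
      then have "?f y < ?f g / 8" using e(2) by auto
      moreover have "\<bar>y - g\<bar> \<le> r" using y gE by auto
      ultimately show ?thesis using y(1) unfolding drop_event_def g_def by blast
    qed
    then have low: "exp ((\<Lambda> - \<epsilon>) * real (T * n)) < mnorm (Mnat g (shift (m n) \<omega>) (T * n))"
      using elim(3) i2 unfolding r_def g_def by blast
    let ?l = "T * n"
    \<comment> \<open>One slack \<open>\<epsilon> * n\<close> for each of the two subwindows to the
      left and right of the exchanged site.\<close>
    define B where "B = exp ((\<Lambda> + \<epsilon>) * real ?l + 2 * \<epsilon> * real n)"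
    have "mnorm (Mnat g (shift (m n) \<omega>) ?l - Mnat E (shift (m n) \<omega>) ?l) \<le> real ?l * B * \<bar>g - E\<bar>"
    proof (rule mnorm_Mnat_diff_le)
      fix j assume j: "j < ?l"
      have j': "int j < int T * int n" using j by (metis of_nat_less_iff of_nat_mult)
      have "mnorm (Mnat g (shift (int j + 1) (shift (m n) \<omega>)) (?l - 1 - j)) \<le> exp ((\<Lambda> + \<epsilon>) * real (?l - 1 - j) + \<epsilon> * real n)"
        unfolding shift_shift using m[of n] j j' g2 by (intro up) (auto simp: algebra_simps)
      moreover have "mnorm (Mnat E (shift (m n) \<omega>) j) \<le> exp ((\<Lambda> + \<epsilon>) * real j + \<epsilon> * real n)"
        using m[of n] j j' E2 by (intro up) (auto simp: algebra_simps)
      ultimately have "mnorm (Mnat g (shift (int j + 1) (shift (m n) \<omega>)) (?l - 1 - j)) * mnorm (Mnat E (shift (m n) \<omega>) j)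
        \<le> exp ((\<Lambda> + \<epsilon>) * real (?l - 1 - j) + \<epsilon> * real n) * exp ((\<Lambda> + \<epsilon>) * real j + \<epsilon> * real n)"
        by (intro mult_mono mnorm_nonneg) auto
      also have "\<dots> = exp ((\<Lambda> + \<epsilon>) * (real (?l - 1 - j) + real j) + 2 * \<epsilon> * real n)"
        by (simp add: algebra_simps flip: exp_add)
      also have "\<dots> \<le> B"
      proof -
        have "real (?l - 1 - j) + real j \<le> real ?l" using j by linarith
        then have "(\<Lambda> + \<epsilon>) * (real (?l - 1 - j) + real j) \<le> (\<Lambda> + \<epsilon>) * real ?l"
          using par(1,2) by (intro mult_left_mono) auto
        then show ?thesis by (simp add: B_def)
      qed
      finally show "mnorm (Mnat g (shift (int j + 1) (shift (m n) \<omega>)) (?l - 1 - j)) * mnorm (Mnat E (shift (m n) \<omega>) j) \<le> B" .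
    qed
    also have "\<dots> \<le> real ?l * B * r" using gE by (intro mult_left_mono) (auto simp: B_def)
    also have "\<dots> \<le> exp ((\<Lambda> - \<epsilon>) * real ?l) / 2"
    proof -
      have "B * r = exp ((\<Lambda> - \<epsilon>) * real ?l) * exp ((\<epsilon> * (2 * real T + 2) - \<eta>) * real n)"
        by (simp add: B_def r_def algebra_simps flip: exp_add)
      also have "\<dots> \<le> exp ((\<Lambda> - \<epsilon>) * real ?l) * exp (- (\<eta> / 2) * real n)"
      proof (intro mult_left_mono)
        have "(\<epsilon> * (2 * real T + 2) - \<eta>) * real n \<le> - (\<eta> / 2) * real n"
          by (rule mult_right_mono) (use par(4) in auto)
        then show "exp ((\<epsilon> * (2 * real T + 2) - \<eta>) * real n) \<le> exp (- (\<eta> / 2) * real n)" by simp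
      qed simp
      finally have "real ?l * B * r \<le> real ?l * (exp ((\<Lambda> - \<epsilon>) * real ?l) * exp (- (\<eta> / 2) * real n))"
        by (simp only: mult.assoc) (intro mult_left_mono, auto)
      also have "\<dots> = exp ((\<Lambda> - \<epsilon>) * real ?l) * (2 * (real T * real n) * exp (- (\<eta> / 2) * real n)) / 2"
        by simp
      also have "\<dots> \<le> exp ((\<Lambda> - \<epsilon>) * real ?l) * 1 / 2"
        by (intro divide_right_mono mult_left_mono elim(6)) auto
      finally show ?thesis by simp
    qed
    finally have "mnorm (Mnat g (shift (m n) \<omega>) ?l - Mnat E (shift (m n) \<omega>) ?l) \<le> exp ((\<Lambda> - \<epsilon>) * real ?l) / 2" .
    then show "exp ((\<Lambda> - \<epsilon>) * real ?l) / 2 \<le> mnorm (Mnat E (shift (m n) \<omega>) ?l)"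
      using low mnorm_diff_le[of "Mnat g (shift (m n) \<omega>) ?l" "Mnat E (shift (m n) \<omega>) ?l"] by linarith
  qed
qed

end

lemma eventually_div_sequentially:
  fixes T :: nat
  assumes "eventually Q sequentially" "0 < T"
  shows "eventually (\<lambda>N. Q (N div T)) sequentially"
proof -
  from assms(1) obtain n0 where n0: "\<And>n. n \<ge> n0 \<Longrightarrow> Q n" by (auto simp: eventually_sequentially)
  have "Q (N div T)" if "N \<ge> n0 * T" for N
    using that assms(2) div_le_mono[of "n0 * T" N T] by (intro n0) simp
  then show ?thesis by (auto simp: eventually_sequentially)
qed

context iid_potential
begin

lemma AE_limsup:
  assumes \<epsilon>: "0 < \<epsilon>"
  shows "\<exists>\<delta>>0. AE \<omega> in P. \<forall>E. \<bar>E - E0\<bar> < \<delta> \<longrightarrow> eventually (\<lambda>n.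
     ln (mnorm (Mnat E \<omega> n)) \<le> (Lam E0 + \<epsilon>) * real n \<and>
     ln (mnorm (Mnat E (shift (- int n) \<omega>) n)) \<le> (Lam E0 + \<epsilon>) * real n) sequentially"
proof -
  have h: "Lam E0 < Lam E0 + \<epsilon> / 2" "0 < \<epsilon> / 2" using \<epsilon> by auto
  from AE_upper[OF h, of 1] obtain \<delta> where \<delta>: "\<delta> > 0" and ae: "AE \<omega> in P. window_upper (Lam E0 + \<epsilon> / 2) (\<epsilon> / 2) \<delta> 1 E0 \<omega>"
    by (elim exE conjE)
  have "AE \<omega> in P. \<forall>E. \<bar>E - E0\<bar> < \<delta> \<longrightarrow> eventually (\<lambda>n.
     ln (mnorm (Mnat E \<omega> n)) \<le> (Lam E0 + \<epsilon>) * real n \<and>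
     ln (mnorm (Mnat E (shift (- int n) \<omega>) n)) \<le> (Lam E0 + \<epsilon>) * real n) sequentially"
    using ae
  proof eventually_elim
    case (elim \<omega>)
    show ?case
    proof (intro allI impI)
      fix E assume E: "\<bar>E - E0\<bar> < \<delta>"
      show "eventually (\<lambda>n. ln (mnorm (Mnat E \<omega> n)) \<le> (Lam E0 + \<epsilon>) * real n \<and>
        ln (mnorm (Mnat E (shift (- int n) \<omega>) n)) \<le> (Lam E0 + \<epsilon>) * real n) sequentially"
        using elim[unfolded window_upper_def]
      proof eventually_elim
        case (elim n)
        have "ln (mnorm (Mnat E (shift m \<omega>) n)) \<le> (Lam E0 + \<epsilon>) * real n" if "\<bar>m\<bar> \<le> int n" for m
        proof -
          have "mnorm (Mnat E (shift m \<omega>) n) \<le> exp ((Lam E0 + \<epsilon> / 2) * real n + \<epsilon> / 2 * real n)"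
            using elim that E by simp
          also have "(Lam E0 + \<epsilon> / 2) * real n + \<epsilon> / 2 * real n = (Lam E0 + \<epsilon>) * real n" by (simp add: algebra_simps)
          finally have "ln (mnorm (Mnat E (shift m \<omega>) n)) \<le> ln (exp ((Lam E0 + \<epsilon>) * real n))"
            using mnorm_ge_1[of "Mnat E (shift m \<omega>) n"] by (intro ln_mono) auto
          then show ?thesis by simp
        qed
        from this[of 0] this[of "- int n"] show ?case by simp
      qed
    qed
  qed
  then show ?thesis using \<delta> by blast
qed

text \<open>The order of choices matters: \<open>T\<close> from \<open>e\<close> and \<Lambda>, then
  \<eta> from the coarse rate 3/4 \<Lambda>, and only then \<epsilon>, small relative to \<eta> and
  \<open>T\<close>. \<open>AE_drop_lower\<close> accepts this earlier \<eta> as spacing exponent for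
  the rate \<Lambda> - \<epsilon>.\<close>

lemma AE_liminf:
  assumes e: "0 < e"
  shows "\<exists>\<delta>>0. AE \<omega> in P. \<forall>E\<in>geneig \<omega>. \<bar>E - E0\<bar> < \<delta> \<longrightarrow> eventually (\<lambda>N.
     (Lam E0 - e) * real N \<le> ln (mnorm (Mnat E \<omega> N)) \<and>
     (Lam E0 - e) * real N \<le> ln (mnorm (Mnat E (shift (- int N) \<omega>) N))) sequentially"
proof (cases "Lam E0 \<le> e")
  case True
  have "(Lam E0 - e) * real N \<le> ln (mnorm (Mnat E \<omega> N))" for N E \<omega>
  proof -
    have "(Lam E0 - e) * real N \<le> 0" using True by (intro mult_nonpos_nonneg) auto
    also have "0 \<le> ln (mnorm (Mnat E \<omega> N))" using mnorm_ge_1[of "Mnat E \<omega> N"] by simp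
    finally show ?thesis .
  qed
  then show ?thesis by (intro exI[of _ 1]) auto
next
  case False
  define \<Lambda> where "\<Lambda> = Lam E0"
  have \<Lambda>: "0 < \<Lambda>" "e < \<Lambda>" using False e by (auto simp: \<Lambda>_def)
  obtain T0 where T0: "16 * \<Lambda> / e < real T0" using reals_Archimedean2 by blast
  define T where "T = T0 + 1"
  have T: "1 \<le> T" "16 * \<Lambda> < e * real T" using T0 e by (auto simp: T_def field_simps)
  have "3 / 4 * \<Lambda> < Lam E0" using \<Lambda> by (simp add: \<Lambda>_def)
  from AE_grid_lower[OF this] obtain \<delta>1 \<eta> where d1: "\<delta>1 > 0" "\<eta> > 0" and
    grid: "AE \<omega> in P. grid_lower (3 / 4 * \<Lambda>) \<eta> \<delta>1 E0 \<omega>"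
    by (elim exE conjE)
  define \<epsilon> where "\<epsilon> = min (e / 16) (\<eta> / 2 / (2 * real T + 2))"
  have \<epsilon>: "0 < \<epsilon>" "\<epsilon> \<le> e / 16" "\<epsilon> * (2 * real T + 2) \<le> \<eta> / 2"
  proof -
    show "0 < \<epsilon>" using e d1 by (simp add: \<epsilon>_def)
    show "\<epsilon> \<le> e / 16" unfolding \<epsilon>_def by (rule min.cobounded1)
    have "\<epsilon> \<le> \<eta> / 2 / (2 * real T + 2)" by (simp add: \<epsilon>_def)
    moreover have "0 < 2 * real T + 2" by simp
    ultimately show "\<epsilon> * (2 * real T + 2) \<le> \<eta> / 2" by (simp only: pos_le_divide_eq)
  qed
  have "Lam E0 < \<Lambda> + \<epsilon>" using \<epsilon> by (simp add: \<Lambda>_def)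
  from AE_upper[OF this \<epsilon>(1), of "T + 1"] obtain \<delta>2 where d2: "\<delta>2 > 0" and
    upper: "AE \<omega> in P. window_upper (\<Lambda> + \<epsilon>) \<epsilon> \<delta>2 (T + 1) E0 \<omega>"
    by (elim exE conjE)
  have c3: "\<Lambda> - \<epsilon> < Lam E0" using \<epsilon> by (simp add: \<Lambda>_def)
  have "int n \<le> int n \<or> int n + int (T * n) \<le> - int n" for n by simp
  from AE_drop_lower[OF c3 d1(2) T(1), of int, OF this] obtain \<delta>3 where d3: "\<delta>3 > 0" and
    right: "AE \<omega> in P. drop_lower (\<Lambda> - \<epsilon>) \<eta> \<delta>3 T int E0 \<omega>"
    by (elim exE conjE)
  have "int n \<le> - int n - int (T * n) \<or> - int n - int (T * n) + int (T * n) \<le> - int n" for n by simp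
  from AE_drop_lower[OF c3 d1(2) T(1), of "\<lambda>n. - int n - int (T * n)", OF this] obtain \<delta>4 where d4: "\<delta>4 > 0" and
    left: "AE \<omega> in P. drop_lower (\<Lambda> - \<epsilon>) \<eta> \<delta>4 T (\<lambda>n. - int n - int (T * n)) E0 \<omega>"
    by (elim exE conjE)
  define \<delta> where "\<delta> = min 1 (min (min \<delta>1 \<delta>2) (min \<delta>3 \<delta>4) / 2)"
  have d: "0 < \<delta>" "\<delta> \<le> 1" "2 * \<delta> \<le> \<delta>1" "2 * \<delta> \<le> \<delta>2" "2 * \<delta> \<le> \<delta>3" "2 * \<delta> \<le> \<delta>4"
    using d1 d2 d3 d4 by (auto simp: \<delta>_def min_def)
  define D where "D = \<bar>E0\<bar> + 1 + R + 2"
  have D: "1 \<le> D" using R_nonneg by (simp add: D_def)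
  have "AE \<omega> in P. \<forall>E\<in>geneig \<omega>. \<bar>E - E0\<bar> < \<delta> \<longrightarrow> eventually (\<lambda>N.
     (Lam E0 - e) * real N \<le> ln (mnorm (Mnat E \<omega> N)) \<and>
     (Lam E0 - e) * real N \<le> ln (mnorm (Mnat E (shift (- int N) \<omega>) N))) sequentially"
    using grid upper right left AE_bounded
  proof eventually_elim
    case (elim \<omega>)
    show ?case
    proof (intro ballI impI)
      fix E assume E: "E \<in> geneig \<omega>" "\<bar>E - E0\<bar> < \<delta>"
      note up = window_upper_mono[OF elim(2) d(4)] and gr = grid_lower_mono[OF elim(1) d(3)]
      have \<epsilon>16: "\<epsilon> \<le> \<Lambda> / 16" using \<epsilon>(2) \<Lambda> by simp
      have R1: "eventually (\<lambda>n. exp ((\<Lambda> - \<epsilon>) * real (T * n)) / 2 \<le> mnorm (Mnat E (shift (int n) \<omega>) (T * n))) sequentially"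
        by (rule long_window_lower[OF E \<Lambda>(1) \<epsilon>(1) \<epsilon>16 \<epsilon>(3) d1(2) d(1) T(1) _ up gr drop_lower_mono[OF elim(3) d(5)]]) simp
      have L1: "eventually (\<lambda>n. exp ((\<Lambda> - \<epsilon>) * real (T * n)) / 2 \<le> mnorm (Mnat E (shift (- int n - int (T * n)) \<omega>) (T * n))) sequentially"
        by (rule long_window_lower[OF E \<Lambda>(1) \<epsilon>(1) \<epsilon>16 \<epsilon>(3) d1(2) d(1) T(1) _ up gr drop_lower_mono[OF elim(4) d(6)]]) simp
      have const: "eventually (\<lambda>n. (\<Lambda> - e) * real (T + 1) + ln 2 + real (T + 1) * ln D \<le> e / 2 * real n) sequentially"
        using e by real_asymp
      have "0 < T + 1" by simp
      from eventually_div_sequentially[OF up[unfolded window_upper_def] this] eventually_div_sequentially[OF R1 this]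
        eventually_div_sequentially[OF L1 this] eventually_div_sequentially[OF const this]
      show "eventually (\<lambda>N. (Lam E0 - e) * real N \<le> ln (mnorm (Mnat E \<omega> N)) \<and>
         (Lam E0 - e) * real N \<le> ln (mnorm (Mnat E (shift (- int N) \<omega>) N))) sequentially"
      proof eventually_elim
        case (elim N)
        \<comment> \<open>The interval of length \<open>N\<close> is cut into half of the central
          window, of length \<open>n\<close>, a long window of length \<open>T * n\<close> and a
          remainder of bounded length \<open>j\<close>.\<close>
        define n where "n = N div (T + 1)"
        define j where "j = N mod (T + 1)"
        have N: "N = n + T * n + j" "j \<le> T + 1"
        proof -
          have "N = n * (T + 1) + j" unfolding n_def j_def by (rule div_mult_mod_eq[symmetric])
          then show "N = n + T * n + j" by (simp add: algebra_simps)
          show "j \<le> T + 1" unfolding j_def by (simp add: less_imp_le)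
        qed
        have upn: "mnorm (Mnat E (shift m \<omega>) n) \<le> exp ((\<Lambda> + 2 * \<epsilon>) * real n)" if "m = 0 \<or> m = - int n" for m
        proof -
          have "mnorm (Mnat E (shift m \<omega>) n) \<le> exp ((\<Lambda> + \<epsilon>) * real n + \<epsilon> * real n)"
            using elim(1)[folded n_def, rule_format, of m n E] that E(2) d(1) by auto
          then show ?thesis by (simp add: algebra_simps)
        qed
        have small: "mnorm (Mnat E (shift m \<omega>) j) \<le> D ^ (T + 1)" for m
        proof -
          have "mnorm (Mnat E (shift m \<omega>) j) \<le> D ^ j"
            unfolding D_def using \<open>\<forall>i. \<bar>\<omega> i\<bar> \<le> R\<close> E(2) d(2) by (intro mnorm_Mnat_le) (auto simp: shift_apply)
          also have "\<dots> \<le> D ^ (T + 1)" using N(2) D by (intro power_increasing)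
          finally show ?thesis .
        qed
        have key: "(\<Lambda> - e) * real N \<le> ln Y"
          if Y: "exp ((\<Lambda> - \<epsilon>) * real (T * n)) / 2 \<le> Y * D ^ (T + 1) * exp ((\<Lambda> + 2 * \<epsilon>) * real n)" and pos: "0 < Y" for Y
        proof -
          have "ln (exp ((\<Lambda> - \<epsilon>) * real (T * n)) / 2) \<le> ln (Y * D ^ (T + 1) * exp ((\<Lambda> + 2 * \<epsilon>) * real n))"
            by (rule ln_mono[OF Y]) simp
          also have "\<dots> = ln Y + real (T + 1) * ln D + (\<Lambda> + 2 * \<epsilon>) * real n"
          proof -
            have "0 < D ^ (T + 1)" using D by (intro zero_less_power) simp
            then show ?thesis using pos D by (simp only: ln_mult_pos mult_pos_pos exp_gt_zero ln_exp ln_realpow)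
          qed
          also have "ln (exp ((\<Lambda> - \<epsilon>) * real (T * n)) / 2) = (\<Lambda> - \<epsilon>) * real (T * n) - ln 2"
            by (simp add: ln_div)
          finally have 1: "(\<Lambda> - \<epsilon>) * real T * real n - (\<Lambda> + 2 * \<epsilon>) * real n - ln 2 - real (T + 1) * ln D \<le> ln Y"
            by simp
          have "(\<Lambda> - e) * real N = (\<Lambda> - e) * (1 + real T) * real n + (\<Lambda> - e) * real j"
            unfolding N(1) by (simp add: algebra_simps)
          also have "(\<Lambda> - e) * real j \<le> (\<Lambda> - e) * real (T + 1)"
            using N(2) \<Lambda>(2) by (intro mult_left_mono) auto
          finally have 2: "(\<Lambda> - e) * real N \<le> (\<Lambda> - e) * (1 + real T) * real n + (\<Lambda> - e) * real (T + 1)" by simp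
          \<comment> \<open>The half window counts once towards the target rate and once as the cost
            of stripping it off, about 2 \<Lambda> n together; \<open>16 * \<Lambda> < e * T\<close>
            makes this small against the gain e T n.\<close>
          have 3: "e / 2 \<le> (\<Lambda> - \<epsilon>) * real T - (\<Lambda> + 2 * \<epsilon>) - (\<Lambda> - e) * (1 + real T)"
          proof -
            have "(\<Lambda> - \<epsilon>) * real T - (\<Lambda> + 2 * \<epsilon>) - (\<Lambda> - e) * (1 + real T) = e * (1 + real T) - \<epsilon> * real T - 2 * \<Lambda> - 2 * \<epsilon>"
              by (simp add: algebra_simps)
            moreover have "\<epsilon> * real T \<le> e / 16 * real T" using \<epsilon>(2) by (intro mult_right_mono) auto
            ultimately show ?thesis using T(2) \<epsilon>(2) e \<Lambda>(1) by (simp add: algebra_simps)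
          qed
          have "e / 2 * real n \<le> ((\<Lambda> - \<epsilon>) * real T - (\<Lambda> + 2 * \<epsilon>) - (\<Lambda> - e) * (1 + real T)) * real n"
            by (rule mult_right_mono[OF 3]) simp
          then show ?thesis
            using 1 2 elim(4)[folded n_def] by (simp add: algebra_simps)
        qed
        have pos: "0 < mnorm (Mnat E \<omega>' N)" for \<omega>' using mnorm_ge_1[of "Mnat E \<omega>' N"] by simp
        have Dpos: "0 \<le> D ^ (T + 1)" using D by simp
        have "exp ((\<Lambda> - \<epsilon>) * real (T * n)) / 2 \<le> mnorm (Mnat E \<omega> N) * D ^ (T + 1) * exp ((\<Lambda> + 2 * \<epsilon>) * real n)"
        proof -
          let ?A = "Mnat E (shift (int n) \<omega>) (T * n)"
          have "exp ((\<Lambda> - \<epsilon>) * real (T * n)) / 2 \<le> mnorm ?A" using elim(2) by (simp add: n_def)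
          also have "\<dots> \<le> mnorm (?A ** Mnat E \<omega> n) * mnorm (Mnat E \<omega> n)" by (rule mnorm_factor_le) simp
          also have "?A ** Mnat E \<omega> n = Mnat E \<omega> (n + T * n)" by (rule Mnat_add[symmetric])
          also have "mnorm \<dots> * mnorm (Mnat E \<omega> n) \<le> (mnorm (Mnat E \<omega> N) * D ^ (T + 1)) * exp ((\<Lambda> + 2 * \<epsilon>) * real n)"
          proof (rule mult_mono)
            have "mnorm (Mnat E \<omega> (n + T * n)) \<le> mnorm (Mnat E (shift (int (n + T * n)) \<omega>) j ** Mnat E \<omega> (n + T * n)) * mnorm (Mnat E (shift (int (n + T * n)) \<omega>) j)"
              by (rule mnorm_factor_le) simp
            also have "Mnat E (shift (int (n + T * n)) \<omega>) j ** Mnat E \<omega> (n + T * n) = Mnat E \<omega> N"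
              unfolding N(1) by (rule Mnat_add[symmetric])
            also have "mnorm (Mnat E \<omega> N) * mnorm (Mnat E (shift (int (n + T * n)) \<omega>) j) \<le> mnorm (Mnat E \<omega> N) * D ^ (T + 1)"
              by (intro mult_left_mono small mnorm_nonneg)
            finally show "mnorm (Mnat E \<omega> (n + T * n)) \<le> mnorm (Mnat E \<omega> N) * D ^ (T + 1)" .
            show "mnorm (Mnat E \<omega> n) \<le> exp ((\<Lambda> + 2 * \<epsilon>) * real n)" using upn[of 0] by simp
          qed (use Dpos mnorm_nonneg in auto)
          finally show ?thesis .
        qed
        from key[OF this pos] have r: "(Lam E0 - e) * real N \<le> ln (mnorm (Mnat E \<omega> N))" by (simp add: \<Lambda>_def)
        have "exp ((\<Lambda> - \<epsilon>) * real (T * n)) / 2 \<le> mnorm (Mnat E (shift (- int N) \<omega>) N) * D ^ (T + 1) * exp ((\<Lambda> + 2 * \<epsilon>) * real n)"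
        proof -
          let ?k = "- int n - int (T * n)"
          let ?A = "Mnat E (shift ?k \<omega>) (T * n)"
          let ?G = "Mnat E (shift ?k \<omega>) (T * n + n)"
          have "exp ((\<Lambda> - \<epsilon>) * real (T * n)) / 2 \<le> mnorm ?A" using elim(3) by (simp add: n_def)
          also have "\<dots> \<le> mnorm (Mnat E (shift (- int n) \<omega>) n ** ?A) * mnorm (Mnat E (shift (- int n) \<omega>) n)"
            by (rule mnorm_factor_le) simp
          also have "Mnat E (shift (- int n) \<omega>) n ** ?A = ?G"
            using Mnat_add[of E "shift ?k \<omega>" "T * n" n] by simp
          also have "mnorm ?G * mnorm (Mnat E (shift (- int n) \<omega>) n) \<le> (mnorm (Mnat E (shift (- int N) \<omega>) N) * D ^ (T + 1)) * exp ((\<Lambda> + 2 * \<epsilon>) * real n)"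
          proof (rule mult_mono)
            have "mnorm ?G \<le> mnorm (?G ** Mnat E (shift (- int N) \<omega>) j) * mnorm (Mnat E (shift (- int N) \<omega>) j)"
              by (rule mnorm_factor_le) simp
            also have "?G ** Mnat E (shift (- int N) \<omega>) j = Mnat E (shift (- int N) \<omega>) N"
            proof -
              have "shift (int j) (shift (- int N) \<omega>) = shift ?k \<omega>" using N(1) by simp
              moreover have "j + (T * n + n) = N" using N(1) by simp
              ultimately show ?thesis using Mnat_add[of E "shift (- int N) \<omega>" j "T * n + n"] by simp
            qed
            also have "mnorm (Mnat E (shift (- int N) \<omega>) N) * mnorm (Mnat E (shift (- int N) \<omega>) j) \<le> mnorm (Mnat E (shift (- int N) \<omega>) N) * D ^ (T + 1)"
              by (intro mult_left_mono small mnorm_nonneg)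
            finally show "mnorm ?G \<le> mnorm (Mnat E (shift (- int N) \<omega>) N) * D ^ (T + 1)" .
            show "mnorm (Mnat E (shift (- int n) \<omega>) n) \<le> exp ((\<Lambda> + 2 * \<epsilon>) * real n)" using upn[of "- int n"] by simp
          qed (use Dpos mnorm_nonneg in auto)
          finally show ?thesis .
        qed
        from key[OF this pos] r show ?case by (simp add: \<Lambda>_def)
      qed
    qed
  qed
  then show ?thesis using d(1) by blast
qed


section \<open>From intervals around a reference energy to all generalized eigenvalues\<close>

lemma AE_local_rate:
  assumes e: "0 < e"
  shows "\<exists>\<delta>>0. AE \<omega> in P. \<forall>E\<in>geneig \<omega>. \<bar>E - E0\<bar> < \<delta> \<longrightarrow> eventually (\<lambda>N.
     \<bar>ln (mnorm (Mnat E \<omega> N)) - Lam E * real N\<bar> \<le> 2 * e * real N \<and>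
     \<bar>ln (mnorm (Mnat E (shift (- int N) \<omega>) N)) - Lam E * real N\<bar> \<le> 2 * e * real N) sequentially"
proof -
  from AE_limsup[OF e, of E0] obtain \<delta>1 where d1: "0 < \<delta>1" and up: "AE \<omega> in P. \<forall>E. \<bar>E - E0\<bar> < \<delta>1 \<longrightarrow> eventually (\<lambda>n.
     ln (mnorm (Mnat E \<omega> n)) \<le> (Lam E0 + e) * real n \<and>
     ln (mnorm (Mnat E (shift (- int n) \<omega>) n)) \<le> (Lam E0 + e) * real n) sequentially"
    by (elim exE conjE)
  from AE_liminf[OF e, of E0] obtain \<delta>2 where d2: "0 < \<delta>2" and low: "AE \<omega> in P. \<forall>E\<in>geneig \<omega>. \<bar>E - E0\<bar> < \<delta>2 \<longrightarrow> eventually (\<lambda>N.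
     (Lam E0 - e) * real N \<le> ln (mnorm (Mnat E \<omega> N)) \<and>
     (Lam E0 - e) * real N \<le> ln (mnorm (Mnat E (shift (- int N) \<omega>) N))) sequentially"
    by (elim exE conjE)
  have "Lam E0 < Lam E0 + e" using e by simp
  from Lam_local_le[OF this] obtain \<delta>3 where d3: "0 < \<delta>3" "\<And>E. \<bar>E - E0\<bar> < \<delta>3 \<Longrightarrow> Lam E \<le> Lam E0 + e" by blast
  have "Lam E0 - e < Lam E0" using e by simp
  from local_lower_tail[OF this] obtain \<delta>4 where d4: "0 < \<delta>4" "\<And>E. \<bar>E - E0\<bar> < \<delta>4 \<Longrightarrow> Lam E0 - e \<le> Lam E" by blast
  define \<delta> where "\<delta> = min (min \<delta>1 \<delta>2) (min \<delta>3 \<delta>4)"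
  have d: "0 < \<delta>" using d1 d2 d3 d4 by (simp add: \<delta>_def)
  have "AE \<omega> in P. \<forall>E\<in>geneig \<omega>. \<bar>E - E0\<bar> < \<delta> \<longrightarrow> eventually (\<lambda>N.
     \<bar>ln (mnorm (Mnat E \<omega> N)) - Lam E * real N\<bar> \<le> 2 * e * real N \<and>
     \<bar>ln (mnorm (Mnat E (shift (- int N) \<omega>) N)) - Lam E * real N\<bar> \<le> 2 * e * real N) sequentially"
    using up low
  proof eventually_elim
    case (elim \<omega>)
    show ?case
    proof (intro ballI impI)
      fix E assume E: "E \<in> geneig \<omega>" "\<bar>E - E0\<bar> < \<delta>"
      \<comment> \<open>Replacing \<open>Lam E0\<close> by \<open>Lam E\<close> costs a second
        \<open>e\<close>, hence the \<open>2 * e\<close> in the conclusion.\<close>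
      have L: "Lam E0 - e \<le> Lam E" "Lam E \<le> Lam E0 + e" using d3(2)[of E] d4(2)[of E] E(2) by (auto simp: \<delta>_def)
      have u: "eventually (\<lambda>n. ln (mnorm (Mnat E \<omega> n)) \<le> (Lam E0 + e) * real n \<and>
         ln (mnorm (Mnat E (shift (- int n) \<omega>) n)) \<le> (Lam E0 + e) * real n) sequentially"
        using elim(1) E(2) by (simp add: \<delta>_def)
      have l: "eventually (\<lambda>N. (Lam E0 - e) * real N \<le> ln (mnorm (Mnat E \<omega> N)) \<and>
         (Lam E0 - e) * real N \<le> ln (mnorm (Mnat E (shift (- int N) \<omega>) N))) sequentially"
        using elim(2) E by (simp add: \<delta>_def)
      show "eventually (\<lambda>N. \<bar>ln (mnorm (Mnat E \<omega> N)) - Lam E * real N\<bar> \<le> 2 * e * real N \<and>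
         \<bar>ln (mnorm (Mnat E (shift (- int N) \<omega>) N)) - Lam E * real N\<bar> \<le> 2 * e * real N) sequentially"
        using u l
      proof eventually_elim
        case (elim N)
        have "(Lam E - 2 * e) * real N \<le> (Lam E0 - e) * real N" "(Lam E0 + e) * real N \<le> (Lam E + 2 * e) * real N"
          using L by (intro mult_right_mono; simp)+
        then show ?case using elim by (simp add: algebra_simps abs_le_iff)
      qed
    qed
  qed
  then show ?thesis using d by blast
qed

text \<open>The exceptional null set must not depend on the energy. By Lindelof countably many of
  the intervals from \<open>AE_local_rate\<close> cover the line, and the precisions
  \<open>1 / (k + 1)\<close> are countably many as well.\<close>

lemma AE_rate:
  "AE \<omega> in P. \<forall>E\<in>geneig \<omega>.
     (\<lambda>N. ln (mnorm (Mnat E \<omega> N)) / real N) \<longlonglongrightarrow> Lam E \<and>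
     (\<lambda>N. ln (mnorm (Mnat E (shift (- int N) \<omega>) N)) / real N) \<longlonglongrightarrow> Lam E"
proof -
  define Q where "Q e \<omega> E \<longleftrightarrow> eventually (\<lambda>N.
     \<bar>ln (mnorm (Mnat E \<omega> N)) - Lam E * real N\<bar> \<le> 2 * e * real N \<and>
     \<bar>ln (mnorm (Mnat E (shift (- int N) \<omega>) N)) - Lam E * real N\<bar> \<le> 2 * e * real N) sequentially" for e \<omega> E
  have one: "AE \<omega> in P. \<forall>E\<in>geneig \<omega>. Q e \<omega> E" if e: "0 < e" for e
  proof -
    have "\<forall>E0. \<exists>\<delta>>0. AE \<omega> in P. \<forall>E\<in>geneig \<omega>. \<bar>E - E0\<bar> < \<delta> \<longrightarrow> Q e \<omega> E"
      unfolding Q_def using AE_local_rate[OF e] by (rule allI)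
    then obtain \<delta> where \<delta>': "\<forall>E0. 0 < \<delta> E0 \<and> (AE \<omega> in P. \<forall>E\<in>geneig \<omega>. \<bar>E - E0\<bar> < \<delta> E0 \<longrightarrow> Q e \<omega> E)"
      by (rule exE[OF choice])
    have \<delta>: "0 < \<delta> E0" "AE \<omega> in P. \<forall>E\<in>geneig \<omega>. \<bar>E - E0\<bar> < \<delta> E0 \<longrightarrow> Q e \<omega> E" for E0
      using \<delta>'[rule_format, of E0] by (rule conjunct1, rule conjunct2)
    obtain F where F: "F \<subseteq> (\<lambda>E0. ball E0 (\<delta> E0)) ` UNIV" "countable F" "\<Union>F = \<Union>((\<lambda>E0. ball E0 (\<delta> E0)) ` UNIV)"
      by (rule Lindelof[of "(\<lambda>E0. ball E0 (\<delta> E0)) ` UNIV"]) auto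
    have "\<exists>S. countable S \<and> S \<subseteq> UNIV \<and> F = (\<lambda>E0. ball E0 (\<delta> E0)) ` S"
      using F(1,2) by (subst countable_subset_image[symmetric]) (rule conjI)
    then obtain S where S: "countable S" "F = (\<lambda>E0. ball E0 (\<delta> E0)) ` S"
      by (elim exE conjE)
    have cover: "\<exists>E0\<in>S. \<bar>E - E0\<bar> < \<delta> E0" for E
    proof -
      have "E \<in> \<Union>F" unfolding F(3) using \<delta>(1)[of E] by (intro UnionI[of "ball E (\<delta> E)"]) auto
      then show ?thesis unfolding S(2) by (auto simp: dist_real_def abs_minus_commute)
    qed
    have "AE \<omega> in P. \<forall>E0\<in>S. \<forall>E\<in>geneig \<omega>. \<bar>E - E0\<bar> < \<delta> E0 \<longrightarrow> Q e \<omega> E"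
      using \<delta>(2) by (simp add: AE_ball_countable[OF S(1)])
    then show ?thesis
    proof eventually_elim
      case (elim \<omega>)
      then show ?case using cover by blast
    qed
  qed
  have "AE \<omega> in P. \<forall>k::nat. \<forall>E\<in>geneig \<omega>. Q (1 / real (Suc k)) \<omega> E"
    unfolding AE_all_countable using one by simp
  then show ?thesis
  proof eventually_elim
    case (elim \<omega>)
    have lim: "(\<lambda>N. f N / real N) \<longlonglongrightarrow> L"
      if f: "\<And>k::nat. eventually (\<lambda>N. \<bar>f N - L * real N\<bar> \<le> 2 * (1 / real (Suc k)) * real N) sequentially" for f :: "nat \<Rightarrow> real" and L
    proof (rule tendstoI)
      fix r :: real assume r: "0 < r"
      obtain k where k: "2 / r < real k" using reals_Archimedean2 by blast
      have k2: "2 * (1 / real (Suc k)) < r" using k r by (simp add: field_simps)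
      show "eventually (\<lambda>N. dist (f N / real N) L < r) sequentially"
        using f[of k] eventually_gt_at_top[of 0]
      proof eventually_elim
        case (elim N)
        have "\<bar>f N - L * real N\<bar> < r * real N"
          using elim mult_strict_right_mono[OF k2, of "real N"] by simp
        moreover have "f N / real N - L = (f N - L * real N) / real N" using elim by (simp add: field_simps)
        ultimately show ?case using elim by (simp add: dist_real_def pos_divide_less_eq)
      qed
    qed
    show ?case
    proof (intro ballI conjI lim)
      fix E and k :: nat assume "E \<in> geneig \<omega>"
      then have "Q (1 / real (Suc k)) \<omega> E" using elim by blast
      then show "eventually (\<lambda>N. \<bar>ln (mnorm (Mnat E \<omega> N)) - Lam E * real N\<bar> \<le> 2 * (1 / real (Suc k)) * real N) sequentially"
        "eventually (\<lambda>N. \<bar>ln (mnorm (Mnat E (shift (- int N) \<omega>) N)) - Lam E * real N\<bar> \<le> 2 * (1 / real (Suc k)) * real N) sequentially"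
        unfolding Q_def by (auto elim: eventually_mono)
    qed
  qed
qed

end

subsection \<open>The support of the single-site measure\<close>

text \<open>The complement of the support is a union of null balls, and by Lindelof countably many
  of them already cover it.\<close>

lemma AE_msupp:
  assumes "sets M = sets borel" shows "AE x in M. x \<in> msupp M"
proof -
  let ?F = "{ball x e | x e. 0 < e \<and> emeasure M (ball x e) = 0}"
  obtain F where F: "F \<subseteq> ?F" "countable F" "\<Union>F = \<Union>?F"
    by (rule Lindelof[of ?F]) auto
  have "\<Union>F \<in> null_sets M"
  proof (rule null_sets_UN'[of F id, simplified])
    fix S assume "S \<in> F"
    then show "S \<in> null_sets M" using F(1) assms by (auto simp: null_sets_def)
  qed (rule F(2))
  then have "AE x in M. x \<notin> \<Union>F" by (rule AE_not_in)
  then show ?thesis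
  proof eventually_elim
    case (elim x)
    show ?case unfolding msupp_def
    proof clarify
      fix e :: real assume "0 < e"
      show "0 < emeasure M (ball x e)"
      proof (rule ccontr)
        assume "\<not> ?thesis"
        then have "emeasure M (ball x e) = 0" by (simp add: not_gr_zero)
        then have "x \<in> \<Union>?F" using \<open>0 < e\<close> by (intro UnionI[of "ball x e"]) auto
        then show False using elim F(3) by simp
      qed
    qed
  qed
qed

lemma iid_potential_exists:
  assumes M: "prob_space M" "sets M = sets borel" "compact (msupp M)"
    and two: "\<exists>a b. a \<in> msupp M \<and> b \<in> msupp M \<and> a \<noteq> b"
  shows "\<exists>R a b p. iid_potential M R a b p"
proof -
  interpret prob_space M by (rule M(1))
  obtain R where R: "\<And>x. x \<in> msupp M \<Longrightarrow> \<bar>x\<bar> \<le> R"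
    using compact_imp_bounded[OF M(3)] by (auto simp: bounded_iff)
  obtain a b where ab: "a \<in> msupp M" "b \<in> msupp M" "a < b"
    using two by (metis linorder_neqE)
  \<comment> \<open>A third of the distance leaves a gap between the half-lines ending at
    \<open>a + d\<close> and starting at \<open>b - d\<close>, which contain the two balls of
    positive mass.\<close>
  define d where "d = (b - a) / 3"
  have d: "0 < d" using ab by (simp add: d_def)
  have pos: "0 < prob (ball x d)" if "x \<in> msupp M" for x
    using that d by (simp add: msupp_def emeasure_eq_measure)
  have "iid_potential M R (a + d) (b - d) (min (prob (ball a d)) (prob (ball b d)))"
  proof unfold_locales
    show "AE x in M. \<bar>x\<bar> \<le> R" using AE_msupp[OF M(2)] by eventually_elim (rule R)
    show "a + d < b - d" using ab by (simp add: d_def field_simps)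
    show "0 < min (prob (ball a d)) (prob (ball b d))" using pos ab by simp
    have "prob (ball a d) \<le> prob {..a + d}"
      using M(2) by (intro finite_measure_mono) (auto simp: dist_real_def)
    then show "min (prob (ball a d)) (prob (ball b d)) \<le> prob {..a + d}" by simp
    have "prob (ball b d) \<le> prob {b - d..}"
      using M(2) by (intro finite_measure_mono) (auto simp: dist_real_def)
    then show "min (prob (ball a d)) (prob (ball b d)) \<le> prob {b - d..}" by simp
  qed (rule M(2))
  then show ?thesis by blast
qed

theorem theorem1p2:
  fixes M :: "real measure"
  assumes "prob_space M"
    and "sets M = sets borel"
    and "compact (msupp M)"
    and "\<exists>a b. a \<in> msupp M \<and> b \<in> msupp M \<and> a \<noteq> b"
  shows "AE \<omega> in PiM (UNIV :: int set) (\<lambda>_. M).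
           \<forall>E \<in> geneig \<omega>.
             ((\<lambda>n::int. ln (mnorm (Mint E \<omega> n)) / real_of_int n)
                 \<longlongrightarrow> lyap (PiM (UNIV :: int set) (\<lambda>_. M)) E) at_top
           \<and> ((\<lambda>n::int. ln (mnorm (Mint E \<omega> n)) / real_of_int \<bar>n\<bar>)
                 \<longlongrightarrow> lyap (PiM (UNIV :: int set) (\<lambda>_. M)) E) at_bot"
proof -
  obtain R a b p where "iid_potential M R a b p" using iid_potential_exists[OF assms] by blast
  then interpret iid_potential M R a b p .
  show ?thesis
    using AE_rate
  proof eventually_elim
    case (elim \<omega>)
    show ?case
    proof (intro ballI conjI)
      fix E assume E: "E \<in> geneig \<omega>"
      have right: "(\<lambda>N. ln (mnorm (Mnat E \<omega> N)) / real N) \<longlonglongrightarrow> Lam E"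
        and left: "(\<lambda>N. ln (mnorm (Mnat E (shift (- int N) \<omega>) N)) / real N) \<longlonglongrightarrow> Lam E"
        using bspec[OF elim E] by (rule conjunct1, rule conjunct2)
      have "((\<lambda>n::int. ln (mnorm (Mnat E \<omega> (nat n))) / real (nat n)) \<longlongrightarrow> Lam E) at_top"
        by (rule filterlim_compose[OF right filterlim_nat_sequentially])
      then show "((\<lambda>n::int. ln (mnorm (Mint E \<omega> n)) / real_of_int n) \<longlongrightarrow> lyap P E) at_top"
        unfolding lyap_eq_Lam
      proof (rule Lim_transform_eventually)
        show "eventually (\<lambda>n::int. ln (mnorm (Mnat E \<omega> (nat n))) / real (nat n) = ln (mnorm (Mint E \<omega> n)) / real_of_int n) at_top"
          using eventually_ge_at_top[of 0] by eventually_elim (simp add: Mint_def)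
      qed
      have neg: "filterlim (\<lambda>n::int. nat (- n)) sequentially at_bot"
        unfolding filterlim_at_top
      proof
        fix Z :: nat
        show "eventually (\<lambda>n::int. Z \<le> nat (- n)) at_bot"
          using eventually_le_at_bot[of "- int Z"] by eventually_elim simp
      qed
      have "((\<lambda>n::int. ln (mnorm (Mnat E (shift (- int (nat (- n))) \<omega>) (nat (- n)))) / real (nat (- n))) \<longlongrightarrow> Lam E) at_bot"
        by (rule filterlim_compose[OF left neg])
      then show "((\<lambda>n::int. ln (mnorm (Mint E \<omega> n)) / real_of_int \<bar>n\<bar>) \<longlongrightarrow> lyap P E) at_bot"
        unfolding lyap_eq_Lam
      proof (rule Lim_transform_eventually)
        \<comment> \<open>For negative \<open>n\<close> the matrix is the inverse of a unimodular
          product over the sites from \<open>n\<close> to -1, and inversion preserves its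
          norm.\<close>
        show "eventually (\<lambda>n::int. ln (mnorm (Mnat E (shift (- int (nat (- n))) \<omega>) (nat (- n)))) / real (nat (- n)) = ln (mnorm (Mint E \<omega> n)) / real_of_int \<bar>n\<bar>) at_bot"
          using eventually_le_at_bot[of "-1"] by eventually_elim (simp add: Mint_def mnorm_matrix_inv)
      qed
    qed
  qed
qed

end
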